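(* Let $(p,q,\gamma)$ be admissible and $T\ge0$. Then there are constants $C_{p,q,T}$ and $C_T$ such that $$\Big\|e^{\mathrm{i}n\tau|\nabla|}\pi_Kf\Big\|_{\ell^p_{\tau}([0,T],L^q(\mathbb{T}^3))}\le C_{p,q,T}(1+K\tau)^{1/p}\|f\|_{H^\gamma(\mathbb{T}^3)},$$ $$\Big\|e^{\mathrm{i}n\tau|\nabla|}\pi_Kh\Big\|_{\ell^2_{\tau}([0,T],L^\infty(\mathbb{T}^3))}\le C_T(1+K\tau+\log K)^{1/2}\|h\|_{H^1(\mathbb{T}^3)},$$ for all $f\in H^\gamma(\mathbb{T}^3)$, $h\in H^1(\mathbb{T}^3)$, $\tau\in(0,1]$ and $K\ge1$.
   Context: A triple $(p,q,\gamma)$ is admissible (in dimension three) if $p\in(2,\infty]$, $q\in[2,\infty)$, $\frac1p+\frac1q\le\frac12$ and $\frac1p+\frac3q=\frac32-\gamma$. The torus $\mathbb{T}^3$ is $[-\pi,\pi]^3$ with opposite sides identified; $\hat v_k=(2\pi)^{-3/2}\langle v,e^{-\mathrm{i}k\cdot x}\rangle$ and $\|v\|_{H^s(\mathbb{T}^3)}^2=\sum_{k\in\mathbb{Z}^3}(1+|k|^2)^s|\hat v_k|^2$. The operator $e^{\mathrm{i}t|\nabla|}$ is the Fourier multiplier with symbol $e^{\mathrm{i}t|k|}$, and $(\pi_Kf)(x)=(2\pi)^{-3/2}\sum_{|k|_\infty\le K}\hat f_ke^{\mathrm{i}k\cdot x}$ with $|k|_\infty=\max_j|k_j|$. Discrete-time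 norm: $\|F_n\|_{\ell^p_\tau(J,X)}=\big(\tau\sum_{n\in\mathbb{Z},\,n\tau\in J}\|F_n\|_X^p\big)^{1/p}$, with supremum over $n\in\mathbb{Z}$, $n\tau\in J$, if $p=\infty$; the free variable $n$ is the summation variable. *)

theory Defs
  imports "HOL-Probability.Essential_Supremum"
begin

text \<open>
  Functions on the torus are represented by functions on \<open>\<real>\<^sup>3\<close> of which only the values on the
  cube \<open>[-\<pi>, \<pi>]\<^sup>3\<close> matter. All norms take values in \<open>[0, \<infinity>]\<close>.
\<close>

definition torus :: "(real^3) measure" where
  "torus = lebesgue_on (cbox (\<chi> i. - pi) (\<chi> i. pi))"

definition ennreal_powr :: "ennreal \<Rightarrow> real \<Rightarrow> ennreal" where
  \<comment> \<open>only used for positive exponents \<open>a\<close>\<close>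
  "ennreal_powr x a = (if x = \<infinity> then \<infinity> else ennreal (enn2real x powr a))"

definition Lnorm :: "ennreal \<Rightarrow> (real^3 \<Rightarrow> complex) \<Rightarrow> ennreal" where
  "Lnorm q v =
    (if q = \<infinity> then esssup torus (\<lambda>x. ennreal (norm (v x)))
     else ennreal_powr (\<integral>\<^sup>+ x. ennreal (norm (v x) powr enn2real q) \<partial>torus) (1 / enn2real q))"

definition freq :: "int^3 \<Rightarrow> real^3" where
  "freq k = (\<chi> i. of_int (k $ i))"

definition fourier_coeff :: "(real^3 \<Rightarrow> complex) \<Rightarrow> int^3 \<Rightarrow> complex" where
  "fourier_coeff v k =
    of_real ((2 * pi) powr (- 3 / 2)) * (\<integral>x. v x * exp (- (\<i> * of_real (freq k \<bullet> x))) \<partial>torus)"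

definition Hnorm :: "real \<Rightarrow> (real^3 \<Rightarrow> complex) \<Rightarrow> ennreal" where
  "Hnorm s v =
    ennreal_powr
      (\<Sum>\<^sub>\<infinity>k\<in>UNIV. ennreal ((1 + (norm (freq k))\<^sup>2) powr s * (norm (fourier_coeff v k))\<^sup>2)) (1 / 2)"

text \<open>
  The elements of \<open>H\<^sup>s\<close> are taken to be square integrable functions, which is the Sobolev space
  for \<open>s \<ge> 0\<close>. Admissibility as defined below implies \<open>\<gamma> \<ge> 1 - 2/q \<ge> 0\<close>, so negative orders
  are not needed.
\<close>

definition Hspace :: "real \<Rightarrow> (real^3 \<Rightarrow> complex) set" where
  "Hspace s = {v \<in> borel_measurable torus. Lnorm 2 v < \<infinity> \<and> Hnorm s v < \<infinity>}"

text \<open>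
  The Fourier multiplier with symbol \<open>m\<close>, as a pointwise Fourier series. The series is summed
  unconditionally; this is the usual \<open>L\<^sup>2\<close> operator whenever the coefficients of the result are
  absolutely summable, in particular on trigonometric polynomials.
\<close>

definition fourier_multiplier ::
    "(real^3 \<Rightarrow> complex) \<Rightarrow> (real^3 \<Rightarrow> complex) \<Rightarrow> real^3 \<Rightarrow> complex" where
  "fourier_multiplier m v x =
    of_real ((2 * pi) powr (- 3 / 2)) *
      (\<Sum>\<^sub>\<infinity>k\<in>UNIV. m (freq k) * fourier_coeff v k * exp (\<i> * of_real (freq k \<bullet> x)))"

definition half_wave :: "real \<Rightarrow> (real^3 \<Rightarrow> complex) \<Rightarrow> real^3 \<Rightarrow> complex" where
  "half_wave t = fourier_multiplier (\<lambda>\<xi>. exp (\<i> * of_real (t * norm \<xi>)))"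

definition freq_proj :: "real \<Rightarrow> (real^3 \<Rightarrow> complex) \<Rightarrow> real^3 \<Rightarrow> complex" where
  "freq_proj K f x =
    of_real ((2 * pi) powr (- 3 / 2)) *
      (\<Sum>k | infnorm (freq k) \<le> K. fourier_coeff f k * exp (\<i> * of_real (freq k \<bullet> x)))"

text \<open>
  The discrete-time norm, for a sequence \<open>F\<close> in a space with norm \<open>N\<close>.
\<close>

definition discrete_norm ::
    "ennreal \<Rightarrow> real \<Rightarrow> real set \<Rightarrow> ('a \<Rightarrow> ennreal) \<Rightarrow> (int \<Rightarrow> 'a) \<Rightarrow> ennreal" where
  "discrete_norm p \<tau> J N F =
    (if p = \<infinity> then (SUP n \<in> {n. of_int n * \<tau> \<in> J}. N (F n))
     else ennreal_powr
       (ennreal \<tau> * (\<Sum>\<^sub>\<infinity>n\<in>{n. of_int n * \<tau> \<in> J}. ennreal_powr (N (F n)) (enn2real p)))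
       (1 / enn2real p))"

text \<open>
  In \<^typ>\<open>ennreal\<close> the inverse of \<open>\<infinity>\<close> is \<open>0\<close>, so \<open>p = \<infinity>\<close> is covered by the same formulas.
\<close>

definition admissible :: "ennreal \<Rightarrow> real \<Rightarrow> real \<Rightarrow> bool" where
  "admissible p q \<gamma> \<longleftrightarrow>
    2 < p \<and> 2 \<le> q \<and>
    enn2real (inverse p) + 1 / q \<le> 1 / 2 \<and>
    enn2real (inverse p) + 3 / q = 3 / 2 - \<gamma>"

end

theory Submission
  imports Defs "HOL-Probability.Probability"
begin

text \<open>
  By duality (the TT* argument) the estimates reduce to pointwise bounds for convolution kernels
  on the torus. Cosine and sine of the half wave are treated separately. The kernel with symbol
  $b^2 \cos(t|k|) / ((a^2+|k|^2)(b^2+|k|^2))$, damped by Fejer weights, is the integral of an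
  explicit radial function on three-space (supported, up to exponential tails, near the light
  cone) against the nonnegative Fejer kernel, which yields the dispersive bound $C/(t + 1/b)$.
  Real interpolation with the trivial $L^2$ bound and the discrete Hardy--Littlewood--Sobolev
  inequality give the estimate for one dyadic shell. The shells are summed by expanding the
  square of the sum and playing off slightly perturbed exponents, and for $q = \infty$ the kernel
  bound is summed over the time grid directly, which costs the logarithm.
\<close>

text \<open>The sharp cutoff \<open>freq_proj\<close> has no kernel with good pointwise bounds. In
  the TT* form the weight, \<open>wave_symbol\<close> times \<open>fejer_weight\<close>, is
  nonnegative everywhere and has a lower bound on the frequencies in question, so any set S of
  frequencies can be enlarged to a whole box: the sharp cutoff survives only in the data. The
  rational symbol is chosen because its one-dimensional inverse transform is a difference of two
  exponentials, and in three dimensions a radial kernel is the derivative of such a profile divided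
  by r; this division is the source of the decay 1/t. One dyadic shell takes a = N and b = 2N; the
  endpoint takes a = 1 and b = 2K, so that one kernel of order -2 serves all frequencies at once.
  The loss K\<tau> comes from the diagonal n = m of the double sum over times, where the kernel is
  of size b and has no decay in time. Scaling 1/p and 1/2 - 1/q by a common factor keeps
  admissibility and scales the regularity by the same factor; this produces the geometric gain
  between shells.\<close>

section \<open>Radial functions on three-space\<close>

text \<open>Serves to turn the frequency onto the first axis in
  \<open>radial_fourier_integral\<close>. Boxes determine the measure, and the preimage of a box is
  its image under the inverse map, which is again orthogonal.\<close>

lemma distr_lborel_orthogonal_transformation:
  fixes f :: "real^'n::{finite,wellorder} \<Rightarrow> real^'n::{finite,wellorder}"
  assumes f: "orthogonal_transformation f"
  shows "distr lborel borel f = lborel"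
proof (rule lborel_eqI[symmetric])
  have cont: "continuous_on UNIV f"
    using f by (simp add: linear_continuous_on linear_linear orthogonal_transformation_linear)
  have meas[measurable]: "f \<in> borel_measurable borel"
    using cont by (rule borel_measurable_continuous_onI)
  fix l u :: "real^'n::{finite,wellorder}" assume lu: "\<And>b. b \<in> Basis \<Longrightarrow> l \<bullet> b \<le> u \<bullet> b"
  have inv: "orthogonal_transformation (inv f)"
    using f by (rule orthogonal_transformation_inv)
  have eq: "f -` box l u = inv f ` box l u"
    using f by (simp add: bij_vimage_eq_inv_image orthogonal_transformation_bij)
  have lm: "box l u \<in> lmeasurable" by simp
  have "emeasure (distr lborel borel f) (box l u) = emeasure lborel (f -` box l u)"
    by (simp add: emeasure_distr)
  also have "\<dots> = emeasure lebesgue (f -` box l u)"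
  proof -
    have "f -` box l u \<in> sets borel" using measurable_sets_borel[OF meas, of "box l u"] by simp
    then show ?thesis by simp
  qed
  also have "\<dots> = ennreal (measure lebesgue (f -` box l u))"
    unfolding eq by (rule emeasure_eq_measure2) (use measurable_orthogonal_image[OF inv lm] in simp)
  also have "\<dots> = ennreal (measure lebesgue (box l u))"
    unfolding eq using measure_orthogonal_image[OF inv lm] by simp
  also have "\<dots> = (\<Prod>b\<in>Basis. (u - l) \<bullet> b)"
    using lu by (simp add: measure_lborel_box_eq inner_diff_left)
  finally show "emeasure (distr lborel borel f) (box l u) = (\<Prod>b\<in>Basis. (u - l) \<bullet> b)" .
qed simp

section \<open>Slicing space into a line and the planes orthogonal to it\<close>

lemma prod_UNIV_3: "prod f (UNIV :: 3 set) = f 1 * (f 2 * f 3)"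
  unfolding UNIV_3 by simp

text \<open>Splits space into a line, which will be the direction of the frequency, and the
  transverse plane. The plane is represented by \<open>complex\<close>, whose discs have a known
  area.\<close>

definition cart3 :: "real \<times> complex \<Rightarrow> real^3" where
  "cart3 p = (\<chi> i. if i = 1 then fst p else if i = 2 then Re (snd p) else Im (snd p))"

lemma cart3_nth [simp]:
  "cart3 p $ 1 = fst p" "cart3 p $ 2 = Re (snd p)" "cart3 p $ 3 = Im (snd p)"
  by (simp_all add: cart3_def)

lemma measurable_cart3 [measurable]: "cart3 \<in> borel_measurable borel"
proof -
  have "continuous_on UNIV cart3"
    unfolding cart3_def
  proof (intro continuous_on_vec_lambda)
    fix i :: 3
    show "continuous_on UNIV (\<lambda>p::real \<times> complex. if i = 1 then fst p else if i = 2 then Re (snd p) else Im (snd p))"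
      by (cases "i = 1"; cases "i = 2") (auto intro!: continuous_intros)
  qed
  then show ?thesis by (rule borel_measurable_continuous_onI)
qed

lemma norm_cart3: "norm (cart3 p) = sqrt ((fst p)\<^sup>2 + (norm (snd p))\<^sup>2)"
  by (cases p) (simp add: norm_vec_def L2_set_def sum_3 cmod_power2 add.assoc)

lemma distr_lborel_cart3: "distr lborel borel cart3 = lborel"
proof (rule lborel_eqI[symmetric])
  fix l u :: "real^3" assume lu: "\<And>b. b \<in> Basis \<Longrightarrow> l \<bullet> b \<le> u \<bullet> b"
  have lu': "l $ i \<le> u $ i" for i
    using lu[of "axis i 1"] by (simp add: inner_axis)
  have "cart3 -` box l u = box (l $ 1, Complex (l $ 2) (l $ 3)) (u $ 1, Complex (u $ 2) (u $ 3))"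
    by (intro set_eqI, unfold vimage_eq mem_box_cart, clarify)
      (auto simp: forall_3 box_def Basis_prod_def Basis_complex_def)
  then have "emeasure (distr lborel borel cart3) (box l u)
     = emeasure lborel (box (l $ 1, Complex (l $ 2) (l $ 3)) (u $ 1, Complex (u $ 2) (u $ 3)))"
    by (simp add: emeasure_distr)
  also have "\<dots> = ennreal ((u$1 - l$1) * ((u$2 - l$2) * (u$3-l$3)))"
  proof (subst emeasure_lborel_box)
    show "(l $ 1, Complex (l $ 2) (l $ 3)) \<bullet> b \<le> (u $ 1, Complex (u $ 2) (u $ 3)) \<bullet> b" if "b \<in> Basis" for b
      using that lu' by (auto simp: Basis_prod_def Basis_complex_def)
    have "(\<Prod>b\<in>Basis. ((u $ 1, Complex (u $ 2) (u $ 3)) - (l $ 1, Complex (l $ 2) (l $ 3))) \<bullet> b)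
        = (u$1 - l$1) * ((u$2 - l$2) * (u$3-l$3))"
      unfolding Basis_prod_def
      by (subst prod.union_disjoint) (auto simp: Basis_complex_def complex_eq_iff)
    then show "ennreal (\<Prod>b\<in>Basis. ((u $ 1, Complex (u $ 2) (u $ 3)) - (l $ 1, Complex (l $ 2) (l $ 3))) \<bullet> b) 
       = ennreal ((u$1 - l$1) * ((u$2 - l$2) * (u$3-l$3)))" by simp
  qed
  also have "(u$1 - l$1) * ((u$2 - l$2) * (u$3-l$3)) = (\<Prod>b\<in>Basis. (u - l) \<bullet> b)"
  proof -
    have B: "(Basis :: (real^3) set) = (\<lambda>i. axis i 1) ` UNIV" by (auto simp: Basis_vec_def)
    have "inj_on (\<lambda>i::3. axis i (1::real)) UNIV" by (auto simp: inj_on_def axis_eq_axis)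
    then show ?thesis unfolding B
      by (subst prod.reindex, assumption, unfold o_def inner_axis prod_UNIV_3) simp
  qed
  finally show "emeasure (distr lborel borel cart3) (box l u) = (\<Prod>b\<in>Basis. (u - l) \<bullet> b)" .
qed simp

text \<open>A disc of squared radius u has area pi u, so the squared radius has constant density pi.
  This takes the place of polar coordinates in the plane.\<close>

lemma distr_lborel_norm_squared_complex:
  "distr lborel borel (\<lambda>z::complex. (norm z)\<^sup>2) = density lborel (\<lambda>u. ennreal (pi * indicator {0..} u))"
proof (rule measure_eqI_generator_eq)
  let ?E = "range (\<lambda>x::real. {..x})"
  show "Int_stable ?E" by (auto simp: Int_stable_def)
  show "?E \<subseteq> Pow UNIV" by simp
  show "sets (distr lborel borel (\<lambda>z::complex. (norm z)\<^sup>2)) = sigma_sets UNIV ?E"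
    "sets (density lborel (\<lambda>u. ennreal (pi * indicator {0..} u))) = sigma_sets UNIV ?E"
    by (simp_all add: borel_eq_atMost)
  show "range (\<lambda>n::nat. {..real n}) \<subseteq> ?E" by auto
  show "(\<Union>i::nat. {..real i}) = UNIV" using real_arch_simple by blast
  have *: "emeasure (distr lborel borel (\<lambda>z::complex. (norm z)\<^sup>2)) {..x} = ennreal (pi * max 0 x)" for x :: real
  proof (cases "x \<ge> 0")
    case True
    have "(\<lambda>z::complex. (norm z)\<^sup>2) -` {..x} = cball 0 (sqrt x)"
      using True by (auto simp: real_le_rsqrt real_le_lsqrt dist_norm sqrt_ge_absD)
    then show ?thesis using True
      by (simp add: emeasure_distr emeasure_cball unit_ball_vol_numeral)
  next
    case False
    then have "(\<lambda>z::complex. (norm z)\<^sup>2) -` {..x} = {}"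
      by auto (metis zero_le_power2 order_trans)
    then show ?thesis using False by (simp add: emeasure_distr)
  qed
  show "emeasure (distr lborel borel (\<lambda>z::complex. (norm z)\<^sup>2)) {..real i} \<noteq> \<infinity>" for i
    unfolding * by simp
  fix X assume "X \<in> ?E"
  then obtain x where X: "X = {..x}" by auto
  have "emeasure (density lborel (\<lambda>u. ennreal (pi * indicator {0..} u))) {..x}
     = (\<integral>\<^sup>+u. ennreal pi * indicator {0..x} u \<partial>lborel)"
    by (subst emeasure_density) (auto intro!: nn_integral_cong simp: indicator_def)
  also have "\<dots> = ennreal (pi * max 0 x)"
    by (cases "x \<ge> 0") (simp_all add: nn_integral_cmult ennreal_mult)
  finally show "emeasure (distr lborel borel (\<lambda>z::complex. (norm z)\<^sup>2)) X =
     emeasure (density lborel (\<lambda>u. ennreal (pi * indicator {0..} u))) X"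
    unfolding X * by simp
qed

text \<open>In the variable u = |z|^2 the integral over the plane becomes pi times the integral of w
  (sqrt (s^2 + u)) over u > 0, and the assumption on \<Phi> says exactly that - \<Phi> (sqrt (s^2 +
  u)) is a primitive of this integrand. The condition on s keeps the slice away from the origin,
  where \<Phi> need not be differentiable.\<close>

lemma integral_slice:
  fixes w \<Phi> :: "real \<Rightarrow> real"
  assumes [measurable]: "w \<in> borel_measurable borel"
    and int: "integrable lborel (\<lambda>z::complex. w (sqrt (s\<^sup>2 + (norm z)\<^sup>2)))"
    and deriv: "\<And>r. r > 0 \<Longrightarrow> (\<Phi> has_real_derivative - (2 * pi * r * w r)) (at r)"
    and cont: "\<And>r. r > 0 \<Longrightarrow> isCont w r"
    and lim: "(\<Phi> \<longlongrightarrow> 0) at_top" and "s \<noteq> 0"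
  shows "(\<integral>z. w (sqrt (s\<^sup>2 + (norm z)\<^sup>2)) \<partial>(lborel :: complex measure)) = \<Phi> \<bar>s\<bar>"
proof -
  let ?g = "\<lambda>u. w (sqrt (s\<^sup>2 + u))"
  have spos: "s\<^sup>2 > 0" using \<open>s \<noteq> 0\<close> by simp
  have "integrable (distr lborel borel (\<lambda>z::complex. (norm z)\<^sup>2)) ?g"
    using int by (subst integrable_distr_eq) auto
  then have int2: "integrable lborel (\<lambda>u. (pi * indicator {0..} u) *\<^sub>R ?g u)"
    unfolding distr_lborel_norm_squared_complex
    by (subst (asm) integrable_density) auto
  have "(\<integral>z. ?g ((norm z)\<^sup>2) \<partial>(lborel :: complex measure))
      = (\<integral>u. ?g u \<partial>distr lborel borel (\<lambda>z::complex. (norm z)\<^sup>2))"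
    by (subst integral_distr) auto
  also have "\<dots> = (\<integral>u. (pi * indicator {0..} u) *\<^sub>R ?g u \<partial>lborel)"
    unfolding distr_lborel_norm_squared_complex by (subst integral_density) auto
  also have "\<dots> = (LBINT u=0..\<infinity>. pi * ?g u)"
  proof -
    have "AE u in lborel. (pi * indicator {0..} u) *\<^sub>R ?g u = indicator (einterval 0 \<infinity>) u *\<^sub>R (pi * ?g u)"
      using AE_lborel_singleton[of "0::real"]
      by eventually_elim (auto simp: indicator_def einterval_def)
    then show ?thesis
      unfolding interval_lebesgue_integral_def set_lebesgue_integral_def
      by (simp, intro integral_cong_AE) (auto simp: einterval_def)
  qed
  also have "\<dots> = 0 - (- \<Phi> \<bar>s\<bar>)"
  proof (rule interval_integral_FTC_integrable[where F = "\<lambda>u. - \<Phi> (sqrt (s\<^sup>2 + u))"])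
    have csq: "isCont (\<lambda>u. sqrt (s\<^sup>2 + u)) x" for x by (intro continuous_intros)
    have pos: "s\<^sup>2 + x > 0" if "0 < ereal x" for x
      using that spos by (auto intro: add_pos_pos)
    show "((\<lambda>u. - \<Phi> (sqrt (s\<^sup>2 + u))) has_vector_derivative pi * ?g x) (at x)" if "0 < ereal x" for x
    proof -
      have r: "sqrt (s\<^sup>2 + x) > 0" using pos[OF that] by simp
      have "((\<lambda>u. - \<Phi> (sqrt (s\<^sup>2 + u))) has_real_derivative
          - (- (2 * pi * sqrt (s\<^sup>2 + x) * ?g x) * (inverse (sqrt (s\<^sup>2 + x)) / 2))) (at x)"
      proof (intro DERIV_minus DERIV_chain2[where f=\<Phi> and g="\<lambda>u. sqrt (s\<^sup>2 + u)", OF deriv[OF r]])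
        have "((\<lambda>u. s\<^sup>2 + u) has_real_derivative 1) (at x)"
          using DERIV_add[OF DERIV_const[of "s\<^sup>2"] DERIV_ident] by simp
        from DERIV_chain2[where f=sqrt, OF DERIV_real_sqrt[OF pos[OF that]] this]
        show "((\<lambda>u. sqrt (s\<^sup>2 + u)) has_real_derivative inverse (sqrt (s\<^sup>2 + x)) / 2) (at x)" by simp
      qed
      moreover have "- (- (2 * pi * sqrt (s\<^sup>2 + x) * ?g x) * (inverse (sqrt (s\<^sup>2 + x)) / 2)) = pi * ?g x"
        using r by (simp add: field_simps)
      ultimately show ?thesis
        by (simp only: has_real_derivative_iff_has_vector_derivative)
    qed
    show "isCont (\<lambda>x. pi * ?g x) x" if "0 < ereal x" for x
    proof -
      have "isCont w (sqrt (s\<^sup>2 + x))" using cont pos[OF that] by simp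
      from isCont_o2[OF csq this] show ?thesis by (rule continuous_mult[OF continuous_const])
    qed
    show "set_integrable lborel (einterval 0 \<infinity>) (\<lambda>x. pi * ?g x)"
    proof -
      have "AE u in lborel. (pi * indicator {0..} u) *\<^sub>R ?g u = indicator (einterval 0 \<infinity>) u *\<^sub>R (pi * ?g u)"
        using AE_lborel_singleton[of "0::real"]
        by eventually_elim (auto simp: indicator_def einterval_def)
      from integrable_cong_AE_imp[OF int2 _ this] show ?thesis
        unfolding set_integrable_def by (auto simp: einterval_def)
    qed
    have c: "isCont \<Phi> \<bar>s\<bar>" using deriv[of "\<bar>s\<bar>"] \<open>s \<noteq> 0\<close> by (auto intro: DERIV_isCont)
    then have "isCont (\<lambda>u. \<Phi> (sqrt (s\<^sup>2 + u))) 0"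
      by (intro isCont_o2[where g=\<Phi>, OF csq]) simp
    then have "isCont (\<lambda>u. - \<Phi> (sqrt (s\<^sup>2 + u))) 0" by (rule continuous_minus)
    then have "((\<lambda>u. - \<Phi> (sqrt (s\<^sup>2 + u))) \<longlongrightarrow> - \<Phi> \<bar>s\<bar>) (at_right 0)"
      by (simp add: isCont_def filterlim_at_split)
    then show "(((\<lambda>u. - \<Phi> (sqrt (s\<^sup>2 + u))) \<circ> real_of_ereal) \<longlongrightarrow> - \<Phi> \<bar>s\<bar>) (at_right 0)"
      using ereal_tendsto_simps1(2)[of "\<lambda>u. - \<Phi> (sqrt (s\<^sup>2 + u))" "- \<Phi> \<bar>s\<bar>" 0] by (simp only: zero_ereal_def)
    have "filterlim (\<lambda>u. sqrt (s\<^sup>2 + u)) at_top at_top"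
      by (intro filterlim_compose[OF sqrt_at_top] filterlim_tendsto_add_at_top[OF tendsto_const] filterlim_ident)
    then have "((\<lambda>u. - \<Phi> (sqrt (s\<^sup>2 + u))) \<longlongrightarrow> - 0) at_top"
      by (intro tendsto_minus filterlim_compose[OF lim])
    then show "(((\<lambda>u. - \<Phi> (sqrt (s\<^sup>2 + u))) \<circ> real_of_ereal) \<longlongrightarrow> 0) (at_left \<infinity>)"
      by (simp add: ereal_tendsto_simps)
  qed auto
  finally show ?thesis by simp
qed

text \<open>After a rotation the phase depends on one coordinate only, and integrating w over the
  planes orthogonal to it leaves \<Phi>. Thus w = - \<Phi>' / (2 pi r) has in three dimensions the
  transform that \<Phi> has in one, which allows a kernel to be built from a one-dimensional
  profile.\<close>

theorem radial_fourier_integral: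
  fixes w \<Phi> :: "real \<Rightarrow> real" and \<xi> :: "real^3"
  assumes w[measurable]: "w \<in> borel_measurable borel"
    and int: "integrable lborel (\<lambda>y::real^3. w (norm y))"
    and deriv: "\<And>r. r > 0 \<Longrightarrow> (\<Phi> has_real_derivative - (2 * pi * r * w r)) (at r)"
    and cont: "\<And>r. r > 0 \<Longrightarrow> isCont w r"
    and lim: "(\<Phi> \<longlongrightarrow> 0) at_top" and even: "\<And>s. \<Phi> (- s) = \<Phi> s"
    and [measurable]: "\<Phi> \<in> borel_measurable borel"
  shows "(\<integral>y. of_real (w (norm y)) * cis (\<xi> \<bullet> y) \<partial>lborel) = (\<integral>s. of_real (\<Phi> s) * cis (norm \<xi> * s) \<partial>lborel)"
proof -
  have [measurable]: "cis \<in> borel_measurable borel"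
    by (intro borel_measurable_continuous_onI continuous_intros)
  have [measurable]: "fst \<in> borel_measurable (borel :: (real \<times> complex) measure)"
    by (intro borel_measurable_continuous_onI continuous_intros)
  obtain f :: "real^3 \<Rightarrow> real^3" where f: "orthogonal_transformation f" "f (norm \<xi> *\<^sub>R axis 1 1) = \<xi>"
  proof (rule orthogonal_transformation_exists)
    show "norm (norm \<xi> *\<^sub>R axis (1::3) (1::real)) = norm \<xi>" by simp
  qed blast
  have [measurable]: "f \<in> borel_measurable borel"
    using f(1) by (intro borel_measurable_continuous_onI) (simp add: linear_continuous_on linear_linear orthogonal_transformation_linear)
  have "(\<integral>y. of_real (w (norm y)) * cis (\<xi> \<bullet> y) \<partial>lborel)
     = (\<integral>y. of_real (w (norm y)) * cis (\<xi> \<bullet> y) \<partial>distr lborel borel f)"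
    by (simp add: distr_lborel_orthogonal_transformation[OF f(1)])
  also have "\<dots> = (\<integral>y. of_real (w (norm y)) * cis (norm \<xi> * y $ 1) \<partial>(lborel :: (real^3) measure))"
  proof (subst integral_distr)
    have "\<xi> \<bullet> f y = norm \<xi> * y $ 1" for y :: "real^3"
    proof -
      have "\<xi> \<bullet> f y = f (norm \<xi> *\<^sub>R axis 1 1) \<bullet> f y" using f(2) by simp
      also have "\<dots> = (norm \<xi> *\<^sub>R axis 1 1) \<bullet> y" using f(1) by (simp add: orthogonal_transformation_def)
      finally show ?thesis by (simp add: inner_axis inner_commute)
    qed
    moreover have "norm (f y) = norm y" for y using f(1) by (simp add: orthogonal_transformation_norm)
    ultimately show "(\<integral>y. of_real (w (norm (f y))) * cis (\<xi> \<bullet> f y) \<partial>lborel) = (\<integral>y. of_real (w (norm y)) * cis (norm \<xi> * y $ 1) \<partial>(lborel :: (real^3) measure))"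
      by simp
  qed measurable
  also have "\<dots> = (\<integral>y. of_real (w (norm y)) * cis (norm \<xi> * y $ 1) \<partial>distr lborel borel cart3)"
    by (simp add: distr_lborel_cart3)
  also have "\<dots> = (\<integral>p. of_real (w (norm (cart3 p))) * cis (norm \<xi> * cart3 p $ 1) \<partial>lborel)"
    by (subst integral_distr) measurable
  also have "\<dots> = (\<integral>p. (case p of (s, z) \<Rightarrow> of_real (w (sqrt (s\<^sup>2 + (norm z)\<^sup>2))) * cis (norm \<xi> * s)) \<partial>(lborel \<Otimes>\<^sub>M (lborel :: complex measure)))"
    by (simp add: lborel_prod case_prod_beta norm_cart3)
  also have "\<dots> = (\<integral>s. (\<integral>z. of_real (w (sqrt (s\<^sup>2 + (norm z)\<^sup>2))) * cis (norm \<xi> * s) \<partial>(lborel :: complex measure)) \<partial>lborel)"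
  proof -
    have "integrable (distr lborel borel cart3) (\<lambda>y. w (norm y))"
      using int by (simp add: distr_lborel_cart3)
    then have i0: "integrable (lborel \<Otimes>\<^sub>M lborel) (\<lambda>p. w (norm (cart3 p)))"
      by (subst (asm) integrable_distr_eq) (auto simp: lborel_prod)
    then have "integrable (lborel \<Otimes>\<^sub>M lborel) (\<lambda>p. of_real (w (norm (cart3 p))) * cis (norm \<xi> * cart3 p $ 1))"
      by (rule Bochner_Integration.integrable_bound) (auto simp: lborel_prod norm_mult)
    then show ?thesis
      by (subst lborel_pair.integral_fst[symmetric]) (auto simp: case_prod_beta' norm_cart3)
  qed
  also have "\<dots> = (\<integral>s. of_real (\<Phi> s) * cis (norm \<xi> * s) \<partial>lborel)"
  proof (rule integral_cong_AE)
    have "integrable (distr lborel borel cart3) (\<lambda>y. w (norm y))"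
      using int by (simp add: distr_lborel_cart3)
    then have "integrable (lborel \<Otimes>\<^sub>M lborel) (\<lambda>p. w (norm (cart3 p)))"
      by (subst (asm) integrable_distr_eq) (auto simp: lborel_prod)
    then have "integrable (lborel \<Otimes>\<^sub>M lborel) (\<lambda>(s, z::complex). w (sqrt (s\<^sup>2 + (norm z)\<^sup>2)))"
      by (simp add: case_prod_beta' norm_cart3)
    \<comment> \<open>By Fubini almost every slice is integrable; the value s = 0, to which
      \<open>integral_slice\<close> does not apply, is a null set.\<close>
    then have "AE s in lborel. integrable lborel (\<lambda>z::complex. w (sqrt (s\<^sup>2 + (norm z)\<^sup>2)))"
      using lborel_pair.AE_integrable_fst by fastforce
    with AE_lborel_singleton[of "0::real"]
    show "AE s in lborel. (\<integral>z. of_real (w (sqrt (s\<^sup>2 + (norm z)\<^sup>2))) * cis (norm \<xi> * s) \<partial>(lborel :: complex measure)) = of_real (\<Phi> s) * cis (norm \<xi> * s)"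
    proof eventually_elim
      case (elim s)
      have "(\<integral>z. w (sqrt (s\<^sup>2 + (norm z)\<^sup>2)) \<partial>(lborel :: complex measure)) = \<Phi> \<bar>s\<bar>"
        by (rule integral_slice) (use elim deriv cont lim in auto)
      moreover have "\<Phi> \<bar>s\<bar> = \<Phi> s" using even[of s] by (auto simp: abs_if)
      ultimately show ?case by simp
    qed
  qed measurable
  finally show ?thesis .
qed

section \<open>Lebesgue norms and duality\<close>

lemma Young_powr:
  fixes a b :: real
  assumes "0 < \<alpha>" "0 < \<beta>" "\<alpha> + \<beta> = 1" "a \<ge> 0" "b \<ge> 0"
  shows "a powr \<alpha> * b powr \<beta> \<le> \<alpha> * a + \<beta> * b"
  using Youngs_inequality_0[of \<alpha> \<beta> a b] assms by (cases "a = 0 \<or> b = 0") auto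

lemma Holder_powr:
  fixes u v :: "'a \<Rightarrow> real"
  assumes [measurable]: "u \<in> borel_measurable M" "v \<in> borel_measurable M"
    and nn: "\<And>x. u x \<ge> 0" "\<And>x. v x \<ge> 0"
    and int: "integrable M (\<lambda>x. u x powr pa)" "integrable M (\<lambda>x. v x powr pb)"
    and pos: "0 < r" "0 < pa" "0 < pb" and eq: "r / pa + r / pb = 1"
  shows "integrable M (\<lambda>x. (u x * v x) powr r)"
    and "(\<integral>x. (u x * v x) powr r \<partial>M)
      \<le> (\<integral>x. u x powr pa \<partial>M) powr (r / pa) * (\<integral>x. v x powr pb \<partial>M) powr (r / pb)"
proof -
  let ?\<alpha> = "r / pa" and ?\<beta> = "r / pb"
  have ab: "?\<alpha> > 0" "?\<beta> > 0" using pos by auto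
  \<comment> \<open>Young's inequality with free normalisations A and B. It is used twice: A = B = 1
    gives integrability, and the two integrals themselves give the sharp inequality.\<close>
  have bound: "(u x * v x) powr r \<le> (A powr ?\<alpha> * B powr ?\<beta>) * (?\<alpha> * (u x powr pa / A) + ?\<beta> * (v x powr pb / B))"
    if "A > 0" "B > 0" for A B x
  proof -
    have "(u x * v x) powr r = (u x powr pa) powr ?\<alpha> * (v x powr pb) powr ?\<beta>"
      using nn pos by (simp add: powr_powr powr_mult)
    also have "\<dots> = (A powr ?\<alpha> * B powr ?\<beta>) * ((u x powr pa / A) powr ?\<alpha> * (v x powr pb / B) powr ?\<beta>)"
      using that by (simp add: powr_divide)
    also have "\<dots> \<le> (A powr ?\<alpha> * B powr ?\<beta>) * (?\<alpha> * (u x powr pa / A) + ?\<beta> * (v x powr pb / B))"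
      by (intro mult_left_mono Young_powr) (use ab eq that in auto)
    finally show ?thesis .
  qed
  show I: "integrable M (\<lambda>x. (u x * v x) powr r)"
  proof (rule Bochner_Integration.integrable_bound)
    show "integrable M (\<lambda>x. ?\<alpha> * u x powr pa + ?\<beta> * v x powr pb)" using int by simp
    show "AE x in M. norm ((u x * v x) powr r) \<le> norm (?\<alpha> * u x powr pa + ?\<beta> * v x powr pb)"
      using bound[of 1 1] by (intro AE_I2) (auto intro: order_trans[OF _ abs_ge_self])
  qed measurable
  let ?A = "\<integral>x. u x powr pa \<partial>M" and ?B = "\<integral>x. v x powr pb \<partial>M"
  have A0: "?A \<ge> 0" "?B \<ge> 0" by (auto intro: integral_nonneg_AE)
  show "(\<integral>x. (u x * v x) powr r \<partial>M) \<le> ?A powr ?\<alpha> * ?B powr ?\<beta>"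
  proof (cases "?A = 0 \<or> ?B = 0")
    case True
    have "AE x in M. (u x * v x) powr r = 0"
    proof (cases "?A = 0")
      case True
      then have "AE x in M. u x powr pa = 0"
        using integral_nonneg_eq_0_iff_AE[OF int(1)] by auto
      then show ?thesis by eventually_elim (use pos in auto)
    next
      case False
      then have "AE x in M. v x powr pb = 0"
        using True integral_nonneg_eq_0_iff_AE[OF int(2)] by auto
      then show ?thesis by eventually_elim (use pos in auto)
    qed
    then have "(\<integral>x. (u x * v x) powr r \<partial>M) = (\<integral>x. 0 \<partial>M)"
      by (intro integral_cong_AE) auto
    then show ?thesis by simp
  next
    case False
    then have AB: "?A > 0" "?B > 0" using A0 by (simp_all only: less_le) auto
    have "(\<integral>x. (u x * v x) powr r \<partial>M)
      \<le> (\<integral>x. (?A powr ?\<alpha> * ?B powr ?\<beta>) * (?\<alpha> * (u x powr pa / ?A) + ?\<beta> * (v x powr pb / ?B)) \<partial>M)"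
      by (intro integral_mono I bound AB integrable_mult_right Bochner_Integration.integrable_add integrable_divide_zero) (use int in auto)
    also have "\<dots> = (?A powr ?\<alpha> * ?B powr ?\<beta>) * (?\<alpha> * (?A / ?A) + ?\<beta> * (?B / ?B))"
      using int by simp
    also have "\<dots> = ?A powr ?\<alpha> * ?B powr ?\<beta>" using AB eq by simp
    finally show ?thesis .
  qed
qed

text \<open>A real-valued norm: the integral of a nonintegrable function is 0 by default, so the
  inequalities below carry integrability assumptions.\<close>

definition lpnorm :: "'a measure \<Rightarrow> real \<Rightarrow> ('a \<Rightarrow> 'b::real_normed_vector) \<Rightarrow> real" where
  "lpnorm M r f = (\<integral>x. norm (f x) powr r \<partial>M) powr (1 / r)"

lemma lpnorm_nonneg [simp]: "lpnorm M r f \<ge> 0"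
  by (simp add: lpnorm_def)

lemma lpnorm_powr: "r > 0 \<Longrightarrow> lpnorm M r f powr r = (\<integral>x. norm (f x) powr r \<partial>M)"
  by (simp add: lpnorm_def powr_powr integral_nonneg_AE)

lemma lpnorm_norm [simp]: "lpnorm M r (\<lambda>x. norm (f x)) = lpnorm M r f"
  by (simp add: lpnorm_def)

lemma lpnorm_mono:
  assumes "\<And>x. x \<in> space M \<Longrightarrow> norm (f x) \<le> norm (g x)" "r > 0"
    and "integrable M (\<lambda>x. norm (g x) powr r)" and "(\<lambda>x. norm (f x)) \<in> borel_measurable M"
  shows "lpnorm M r f \<le> lpnorm M r g"
  unfolding lpnorm_def
proof (intro powr_mono2 integral_mono)
  show "integrable M (\<lambda>x. norm (f x) powr r)"
    by (rule Bochner_Integration.integrable_bound[OF assms(3)]) (use assms in \<open>auto intro!: AE_I2 powr_mono2\<close>)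
qed (use assms in \<open>auto intro!: powr_mono2 integral_nonneg_AE\<close>)

lemma lpnorm_mult_le:
  fixes u v :: "'a \<Rightarrow> 'b::real_normed_algebra"
  assumes [measurable]: "(\<lambda>x. norm (u x)) \<in> borel_measurable M" "(\<lambda>x. norm (v x)) \<in> borel_measurable M"
      "(\<lambda>x. norm (u x * v x)) \<in> borel_measurable M"
    and int: "integrable M (\<lambda>x. norm (u x) powr pa)" "integrable M (\<lambda>x. norm (v x) powr pb)"
    and pos: "0 < r" "0 < pa" "0 < pb" and eq: "1 / pa + 1 / pb = 1 / r"
  shows "lpnorm M r (\<lambda>x. u x * v x) \<le> lpnorm M pa u * lpnorm M pb v"
proof -
  have eq': "r / pa + r / pb = 1" using arg_cong[OF eq, of "\<lambda>x. r * x"] pos by (simp add: distrib_left)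
  note H = Holder_powr[OF assms(1,2) _ _ int pos eq']
  have "(\<integral>x. norm (u x * v x) powr r \<partial>M) \<le> (\<integral>x. (norm (u x) * norm (v x)) powr r \<partial>M)"
  proof (rule integral_mono)
    show I: "integrable M (\<lambda>x. (norm (u x) * norm (v x)) powr r)" by (rule H(1)) auto
    show le: "norm (u x * v x) powr r \<le> (norm (u x) * norm (v x)) powr r" for x
      using pos by (intro powr_mono2 norm_mult_ineq) auto
    show "integrable M (\<lambda>x. norm (u x * v x) powr r)"
      by (rule Bochner_Integration.integrable_bound[OF I]) (use le in auto)
  qed
  also have "\<dots> \<le> (\<integral>x. norm (u x) powr pa \<partial>M) powr (r / pa) * (\<integral>x. norm (v x) powr pb \<partial>M) powr (r / pb)"
    by (rule H(2)) auto
  finally have "(\<integral>x. norm (u x * v x) powr r \<partial>M) powr (1 / r)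
    \<le> ((\<integral>x. norm (u x) powr pa \<partial>M) powr (r / pa) * (\<integral>x. norm (v x) powr pb \<partial>M) powr (r / pb)) powr (1 / r)"
    using pos by (intro powr_mono2) (auto intro: integral_nonneg_AE)
  also have "\<dots> = lpnorm M pa u * lpnorm M pb v"
    using pos by (simp add: lpnorm_def powr_mult powr_powr integral_nonneg_AE)
  finally show ?thesis by (simp add: lpnorm_def)
qed

lemma lpnorm_sum_le:
  fixes w :: "'i \<Rightarrow> 'a \<Rightarrow> real"
  assumes "finite J" and meas[measurable]: "\<And>j. j \<in> J \<Longrightarrow> w j \<in> borel_measurable M"
    and nn: "\<And>j x. j \<in> J \<Longrightarrow> w j x \<ge> 0"
    and int: "\<And>j. j \<in> J \<Longrightarrow> integrable M (\<lambda>x. w j x powr r)"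
    and intS: "integrable M (\<lambda>x. (\<Sum>j\<in>J. w j x) powr r)"
    and r: "r \<ge> 1"
  shows "lpnorm M r (\<lambda>x. \<Sum>j\<in>J. w j x) \<le> (\<Sum>j\<in>J. lpnorm M r (w j))"
\<comment> \<open>For r = 1 there is no finite conjugate exponent, and the claim is additivity of
  the integral.\<close>
proof (cases "r = 1")
  case True
  have nS: "(\<Sum>j\<in>J. w j x) \<ge> 0" for x using nn by (intro sum_nonneg) auto
  have eq: "w j x powr r = w j x" if "j \<in> J" for j x using True nn[OF that] by simp
  have "(\<integral>x. (\<Sum>j\<in>J. w j x) \<partial>M) = (\<Sum>j\<in>J. \<integral>x. w j x \<partial>M)"
    using int eq by (intro Bochner_Integration.integral_sum) (auto simp: eq cong: integrable_cong)
  moreover have "lpnorm M r (w j) = (\<integral>x. w j x \<partial>M)" if "j \<in> J" for j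
    using True nn[OF that] by (simp add: lpnorm_def integral_nonneg_AE)
  moreover have "lpnorm M r (\<lambda>x. \<Sum>j\<in>J. w j x) = (\<integral>x. (\<Sum>j\<in>J. w j x) \<partial>M)"
    using True nS by (simp add: lpnorm_def integral_nonneg_AE)
  ultimately show ?thesis by simp
next
  case False
  with r have r: "r > 1" by simp
  let ?W = "\<lambda>x. \<Sum>j\<in>J. w j x" and ?q = "r / (r - 1)"
  have nS: "?W x \<ge> 0" for x using nn by (intro sum_nonneg) auto
  have W[measurable]: "?W \<in> borel_measurable M" by measurable
  have q: "?q > 0" "1 / r + 1 / ?q = 1" using r by (auto simp: field_simps)
  have int2: "integrable M (\<lambda>x. (?W x powr (r - 1)) powr ?q)"
    using intS r by (simp add: powr_powr)
  have *: "integrable M (\<lambda>x. w j x * ?W x powr (r - 1)) \<and>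
    (\<integral>x. w j x * ?W x powr (r - 1) \<partial>M) \<le> lpnorm M r (w j) * (\<integral>x. ?W x powr r \<partial>M) powr (1 / ?q)"
    if j: "j \<in> J" for j
  proof -
    have "integrable M (\<lambda>x. (max 0 (w j x) * ?W x powr (r - 1)) powr 1)"
      "(\<integral>x. (max 0 (w j x) * ?W x powr (r - 1)) powr 1 \<partial>M) \<le> (\<integral>x. max 0 (w j x) powr r \<partial>M) powr (1 / r) * (\<integral>x. (?W x powr (r - 1)) powr ?q \<partial>M) powr (1 / ?q)"
      by (rule Holder_powr[where pa=r and pb="?q"]; use j nn[OF j] int[OF j] int2 q r in \<open>simp add: max_absorb2\<close>)+
    then show ?thesis using r nn[OF j] by (simp add: powr_powr lpnorm_def max_absorb2)
  qed
  let ?X = "\<integral>x. ?W x powr r \<partial>M"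
  have X0: "?X \<ge> 0" by (auto intro: integral_nonneg_AE)
  have "?X = (\<integral>x. (\<Sum>j\<in>J. w j x * ?W x powr (r - 1)) \<partial>M)"
  proof (rule Bochner_Integration.integral_cong)
    fix x
    show "?W x powr r = (\<Sum>j\<in>J. w j x * ?W x powr (r - 1))"
      using powr_mult_base[OF nS[of x], of "r - 1"] by (simp add: sum_distrib_right[symmetric])
  qed simp
  also have "\<dots> = (\<Sum>j\<in>J. \<integral>x. w j x * ?W x powr (r - 1) \<partial>M)"
    using * by (intro Bochner_Integration.integral_sum) auto
  also have "\<dots> \<le> (\<Sum>j\<in>J. lpnorm M r (w j)) * ?X powr (1 / ?q)"
    unfolding sum_distrib_right using * by (intro sum_mono) auto
  finally have le: "?X \<le> (\<Sum>j\<in>J. lpnorm M r (w j)) * ?X powr (1 / ?q)" .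
  have L: "lpnorm M r ?W = ?X powr (1 / r)" using nS by (simp add: lpnorm_def)
  show ?thesis
  proof (cases "?X = 0")
    case True
    then show ?thesis unfolding L by (simp add: sum_nonneg)
  next
    case False
    then have X: "?X > 0" using X0 by (simp only: less_le) simp
    have "?X powr (1 / r) * ?X powr (1 / ?q) = ?X"
      using X q by (simp flip: powr_add)
    with le have "?X powr (1 / r) * ?X powr (1 / ?q) \<le> (\<Sum>j\<in>J. lpnorm M r (w j)) * ?X powr (1 / ?q)" by simp
    then show ?thesis unfolding L using X by (simp add: mult_le_cancel_right_pos)
  qed
qed

section \<open>Discrete Hardy--Littlewood--Sobolev inequality\<close>

text \<open>Each summand is at most the increment of x^(1 - \<alpha>) / (1 - \<alpha>) over the unit
  interval to its left, by the mean value theorem.\<close>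

lemma sum_powr_neg_le:
  fixes \<alpha> :: real
  assumes "0 < \<alpha>" "\<alpha> < 1"
  shows "(\<Sum>j=1..M. real j powr (-\<alpha>)) \<le> real M powr (1 - \<alpha>) / (1 - \<alpha>)"
proof (induction M)
  case (Suc M)
  have "real (Suc M) powr (-\<alpha>) \<le> (real (Suc M) powr (1 - \<alpha>) - real M powr (1 - \<alpha>)) / (1 - \<alpha>)"
  proof (cases "M = 0")
    case True
    then show ?thesis using assms by (simp add: field_simps)
  next
    case False
    have "\<exists>z>real M. z < real (Suc M) \<and> real (Suc M) powr (1 - \<alpha>) - real M powr (1 - \<alpha>)
        = (real (Suc M) - real M) * ((1 - \<alpha>) * z powr (1 - \<alpha> - 1))"
      by (rule MVT2) (use False in \<open>auto intro!: derivative_eq_intros\<close>)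
    then obtain z where z: "z > real M" "z < real (Suc M)" and
      eq: "real (Suc M) powr (1 - \<alpha>) - real M powr (1 - \<alpha>) = (1 - \<alpha>) * z powr (-\<alpha>)" by auto
    have "real (Suc M) powr (-\<alpha>) \<le> z powr (-\<alpha>)"
      using z assms by (intro powr_mono2') auto
    then show ?thesis unfolding eq using assms by simp
  qed
  then show ?case using Suc.IH by (simp add: diff_divide_distrib)
qed (use assms in simp)

text \<open>Comparison with the telescoping differences 1/n - 1/(n + 1).\<close>

lemma sum_inverse_squares_tail_le:
  assumes "a \<ge> 1"
  shows "(\<Sum>j\<in>{a<..b}. 1 / (real j)\<^sup>2) \<le> 1 / real a"
proof -
  have "(\<Sum>j\<in>{a<..b}. 1 / (real j)\<^sup>2) \<le> 1 / real a - 1 / real b" if "a \<le> b"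
    using that
  proof (induction b rule: dec_induct)
    case (step n)
    have "{a<..Suc n} = insert (Suc n) {a<..n}" using step by auto
    moreover have "1 / (real (Suc n))\<^sup>2 \<le> 1 / real n - 1 / real (Suc n)"
    proof -
      have "1 / real n - 1 / real (Suc n) = 1 / (real n * real (Suc n))"
        using step assms by (simp add: field_simps)
      also have "\<dots> \<ge> 1 / (real (Suc n))\<^sup>2"
        unfolding power2_eq_square using step assms by (intro divide_left_mono mult_right_mono) auto
      finally show ?thesis .
    qed
    ultimately show ?case using step by simp
  qed simp
  moreover have "1 / real b \<ge> 0" by simp
  moreover have "(\<Sum>j\<in>{a<..b}. 1 / (real j)\<^sup>2) = 0" if "\<not> a \<le> b" using that by simp
  moreover have "1 / real a \<ge> 0" by simp
  ultimately show ?thesis by (cases "a \<le> b") linarith+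
qed

text \<open>A positive distance to n is attained by at most two integers, one on either side. The
  boolean in the proof records the side and makes the map injective.\<close>

lemma sum_int_distance_le:
  fixes g :: "nat \<Rightarrow> real"
  assumes "finite I" and g: "\<And>j. g j \<ge> 0" and "finite J"
    and J: "\<And>m. m \<in> I \<Longrightarrow> m \<noteq> n \<and> nat \<bar>n - m\<bar> \<in> J"
  shows "(\<Sum>m\<in>I. g (nat \<bar>n - m\<bar>)) \<le> 2 * (\<Sum>j\<in>J. g j)"
proof -
  let ?f = "\<lambda>m. (nat \<bar>n - m\<bar>, n < m)"
  have inj: "inj_on ?f I" by (auto simp: inj_on_def)
  have "(\<Sum>m\<in>I. g (nat \<bar>n - m\<bar>)) = (\<Sum>p\<in>?f ` I. g (fst p))"
    by (simp add: sum.reindex[OF inj])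
  also have "\<dots> \<le> (\<Sum>p\<in>J \<times> (UNIV :: bool set). g (fst p))"
  proof (rule sum_mono2)
    show "finite (J \<times> (UNIV :: bool set))" using assms by simp
  qed (use g J in auto)
  also have "\<dots> = 2 * (\<Sum>j\<in>J. g j)"
    by (simp add: sum.cartesian_product' UNIV_bool sum_distrib_left)
  finally show ?thesis .
qed

text \<open>The sum over the smaller neighbours of a point is split at the distance \<open>R = h\<^sub>n powr - p'\<close>.\<close>

lemma discrete_HLS_pointwise:
  fixes h :: "int \<Rightarrow> real"
  assumes p: "p > 2"
    and "finite I" and h: "\<And>m. h m \<ge> 0" and sum1: "(\<Sum>m\<in>I. h m powr (p / (p - 1))) \<le> 1"
    and n: "n \<in> I" "h n > 0"
  shows "(\<Sum>m\<in>{m\<in>I. m \<noteq> n \<and> h m \<le> h n}. \<bar>real_of_int (n - m)\<bar> powr (- 2 / p) * h m)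
    \<le> (2 / (1 - 2 / p) + 4 powr (1 / p)) * h n powr (1 / (p - 1))"
proof -
  let ?\<alpha> = "2 / p" and ?p' = "p / (p - 1)"
  have \<alpha>: "0 < ?\<alpha>" "?\<alpha> < 1" using p by auto
  define R where "R = h n powr (- ?p')"
  have "h n powr ?p' \<le> (\<Sum>m\<in>I. h m powr ?p')"
    using n \<open>finite I\<close> by (intro member_le_sum) auto
  then have hn1: "h n powr ?p' \<le> 1" using sum1 by simp
  \<comment> \<open>The normalisation of the sum forces h n \<le> 1. Hence R \<ge> 1, and its
    integer part A is comparable with R.\<close>
  have R: "R \<ge> 1" using hn1 n by (simp add: R_def powr_minus one_le_inverse_iff)
  define A where "A = nat \<lfloor>R\<rfloor>"
  have A: "A \<ge> 1" "real A \<le> R" "R \<le> 2 * real A"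
  proof -
    have "\<lfloor>R\<rfloor> \<ge> 1" using R by linarith
    then have "real A = real_of_int \<lfloor>R\<rfloor>" "A \<ge> 1" unfolding A_def by linarith+
    moreover have "R < real_of_int \<lfloor>R\<rfloor> + 1" "real_of_int \<lfloor>R\<rfloor> \<le> R" by linarith+
    ultimately show "A \<ge> 1" "real A \<le> R" "R \<le> 2 * real A" using \<open>\<lfloor>R\<rfloor> \<ge> 1\<close> by linarith+
  qed
  let ?S = "{m\<in>I. m \<noteq> n \<and> h m \<le> h n}"
  let ?N = "{m\<in>?S. nat \<bar>n - m\<bar> \<le> A}" and ?F = "{m\<in>?S. nat \<bar>n - m\<bar> > A}"
  have fin: "finite ?S" "finite ?N" "finite ?F" using \<open>finite I\<close> by auto
  have split: "?S = ?N \<union> ?F" by auto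
  have rn: "\<bar>real_of_int (n - m)\<bar> = real (nat \<bar>n - m\<bar>)" for m by simp
  let ?t = "\<lambda>m. \<bar>real_of_int (n - m)\<bar> powr (- 2 / p) * h m"
  \<comment> \<open>Up to distance R the bound h m \<le> h n is used and the kernel is summed. The
    choice of R turns R^(1 - \<alpha>) * h n into the power 1/(p - 1) of h n.\<close>
  have near: "(\<Sum>m\<in>?N. ?t m) \<le> 2 / (1 - 2 / p) * h n powr (1 / (p - 1))"
  proof -
    have "(\<Sum>m\<in>?N. ?t m) \<le> (\<Sum>m\<in>?N. real (nat \<bar>n - m\<bar>) powr (- ?\<alpha>) * h n)"
      unfolding rn by (intro sum_mono mult_mono) (auto simp: h)
    also have "\<dots> = (\<Sum>m\<in>?N. real (nat \<bar>n - m\<bar>) powr (- ?\<alpha>)) * h n"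
      by (simp add: sum_distrib_right)
    also have "\<dots> \<le> (2 * (\<Sum>j\<in>{1..A}. real j powr (- ?\<alpha>))) * h n"
      using fin h by (intro mult_right_mono sum_int_distance_le[where g="\<lambda>j. real j powr (- ?\<alpha>)"]) auto
    also have "\<dots> \<le> (2 * (real A powr (1 - ?\<alpha>) / (1 - ?\<alpha>))) * h n"
      using sum_powr_neg_le[OF \<alpha>, of A] h by (intro mult_right_mono) auto
    also have "\<dots> \<le> (2 * (R powr (1 - ?\<alpha>) / (1 - ?\<alpha>))) * h n"
      using A \<alpha> h by (intro mult_right_mono mult_left_mono divide_right_mono powr_mono2) auto
    also have "\<dots> = 2 / (1 - ?\<alpha>) * (R powr (1 - ?\<alpha>) * h n)" by simp
    also have "R powr (1 - ?\<alpha>) * h n = h n powr (1 + - ?p' * (1 - ?\<alpha>))"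
      unfolding R_def powr_powr using powr_mult_base[OF h, of n "- ?p' * (1 - ?\<alpha>)"] by (simp only: mult.commute)
    also have "1 + - ?p' * (1 - ?\<alpha>) = 1 / (p - 1)" using p by (simp add: field_simps)
    finally show ?thesis .
  qed
  have far: "(\<Sum>m\<in>?F. ?t m) \<le> 4 powr (1 / p) * h n powr (1 / (p - 1))"
  proof -
    let ?M = "count_space ?F"
    have sumF: "(\<integral>m. f m \<partial>?M) = (\<Sum>m\<in>?F. f m)" for f :: "int \<Rightarrow> real"
      by (rule lebesgue_integral_count_space_finite[OF fin(3)])
    have "(\<integral>m. (\<bar>real_of_int (n - m)\<bar> powr (- ?\<alpha>) * h m) powr 1 \<partial>?M)
      \<le> (\<integral>m. (\<bar>real_of_int (n - m)\<bar> powr (- ?\<alpha>)) powr p \<partial>?M) powr (1 / p) * (\<integral>m. h m powr ?p' \<partial>?M) powr (1 / ?p')"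
      by (rule Holder_powr) (use p h fin in \<open>auto simp: field_simps intro!: integrable_count_space\<close>)
    then have "(\<Sum>m\<in>?F. ?t m) \<le> (\<Sum>m\<in>?F. (\<bar>real_of_int (n - m)\<bar> powr (- ?\<alpha>)) powr p) powr (1 / p) * (\<Sum>m\<in>?F. h m powr ?p') powr (1 / ?p')"
      unfolding sumF using h by simp
    also have "\<dots> \<le> (4 / R) powr (1 / p) * 1"
    proof (intro mult_mono powr_mono2)
      have "(\<Sum>m\<in>?F. (\<bar>real_of_int (n - m)\<bar> powr (- ?\<alpha>)) powr p) = (\<Sum>m\<in>?F. 1 / (real (nat \<bar>n - m\<bar>))\<^sup>2)"
      proof (intro sum.cong refl)
        fix m assume "m \<in> ?F"
        then have "(real (nat \<bar>n - m\<bar>) powr (- ?\<alpha>)) powr p = real (nat \<bar>n - m\<bar>) powr (- 2)"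
          using p by (simp add: powr_powr)
        also have "\<dots> = 1 / (real (nat \<bar>n - m\<bar>))\<^sup>2"
          using \<open>m \<in> ?F\<close> by (simp add: powr_minus divide_inverse)
        finally show "(\<bar>real_of_int (n - m)\<bar> powr (- ?\<alpha>)) powr p = 1 / (real (nat \<bar>n - m\<bar>))\<^sup>2"
          unfolding rn .
      qed
      also have "\<dots> \<le> 2 * (\<Sum>j\<in>{A<..Max ((\<lambda>m. nat \<bar>n - m\<bar>) ` I)}. 1 / (real j)\<^sup>2)"
        using fin \<open>finite I\<close> by (intro sum_int_distance_le[where g="\<lambda>j. 1 / (real j)\<^sup>2"]) auto
      also have "\<dots> \<le> 2 * (1 / real A)"
        by (intro mult_left_mono sum_inverse_squares_tail_le A) simp
      also have "\<dots> \<le> 4 / R" using A R by (simp add: field_simps)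
      finally show "(\<Sum>m\<in>?F. (\<bar>real_of_int (n - m)\<bar> powr (- ?\<alpha>)) powr p) \<le> 4 / R" .
      have "(\<Sum>m\<in>?F. h m powr ?p') \<le> (\<Sum>m\<in>I. h m powr ?p')"
        using \<open>finite I\<close> by (intro sum_mono2) auto
      then have "(\<Sum>m\<in>?F. h m powr ?p') powr (1 / ?p') \<le> 1 powr (1 / ?p')"
        using sum1 p by (intro powr_mono2) (auto intro: sum_nonneg)
      then show "(\<Sum>m\<in>?F. h m powr ?p') powr (1 / ?p') \<le> 1" by simp
    qed (use p in \<open>auto intro: sum_nonneg\<close>)
    also have "\<dots> = 4 powr (1 / p) * h n powr (?p' * (1 / p))"
      unfolding R_def by (simp add: powr_mult powr_powr powr_minus divide_inverse)
    also have "?p' * (1 / p) = 1 / (p - 1)" using p by (simp add: field_simps)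
    finally show ?thesis .
  qed
  have "(\<Sum>m\<in>?S. ?t m) = (\<Sum>m\<in>?N. ?t m) + (\<Sum>m\<in>?F. ?t m)"
    by (subst split, rule sum.union_disjoint) (use fin in auto)
  then show ?thesis using near far by (simp add: distrib_right)
qed

text \<open>In each pair (n, m) one value is the larger. Summing over its smaller partners with
  \<open>discrete_HLS_pointwise\<close> leaves h n * h n^(1/(p-1)), which is the power p' of h n; by
  symmetry the other pairs contribute the same. Homogeneity reduces to the case that the powers sum
  to 1.\<close>

lemma discrete_HLS:
  fixes h :: "int \<Rightarrow> real"
  assumes p: "p > 2" and "finite I" and h: "\<And>m. h m \<ge> 0"
  shows "(\<Sum>n\<in>I. \<Sum>m\<in>I - {n}. \<bar>real_of_int (n - m)\<bar> powr (- 2 / p) * (h n * h m))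
    \<le> 2 * (2 / (1 - 2 / p) + 4 powr (1 / p)) * (\<Sum>m\<in>I. h m powr (p / (p - 1))) powr (2 * (p - 1) / p)"
proof -
  let ?p' = "p / (p - 1)" and ?K = "2 / (1 - 2 / p) + 4 powr (1 / p)"
  have K: "?K \<ge> 0" using p by simp
  have normalized: "(\<Sum>n\<in>I. \<Sum>m\<in>I - {n}. \<bar>real_of_int (n - m)\<bar> powr (- 2 / p) * (g n * g m)) \<le> 2 * ?K"
    if g: "\<And>m. g m \<ge> 0" and sum1: "(\<Sum>m\<in>I. g m powr ?p') = 1" for g :: "int \<Rightarrow> real"
  proof -
    let ?t = "\<lambda>n m. \<bar>real_of_int (n - m)\<bar> powr (- 2 / p) * (g n * g m)"
    have half: "(\<Sum>n\<in>I. \<Sum>m\<in>{m\<in>I. m \<noteq> n \<and> g m \<le> g n}. ?t n m) \<le> ?K"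
    proof -
      have "(\<Sum>m\<in>{m\<in>I. m \<noteq> n \<and> g m \<le> g n}. ?t n m) \<le> ?K * g n powr ?p'" if "n \<in> I" for n
      proof (cases "g n = 0")
        case False
        then have gn: "g n > 0" using g[of n] by simp
        have "(\<Sum>m\<in>{m\<in>I. m \<noteq> n \<and> g m \<le> g n}. ?t n m)
          = g n * (\<Sum>m\<in>{m\<in>I. m \<noteq> n \<and> g m \<le> g n}. \<bar>real_of_int (n - m)\<bar> powr (- 2 / p) * g m)"
          by (simp add: sum_distrib_left mult_ac)
        also have "\<dots> \<le> g n * (?K * g n powr (1 / (p - 1)))"
          using discrete_HLS_pointwise[where h=g, OF p \<open>finite I\<close> g _ that gn] sum1 gn by (intro mult_left_mono) auto
        also have "\<dots> = ?K * (g n * g n powr (1 / (p - 1)))" by simp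
        also have "g n * g n powr (1 / (p - 1)) = g n powr (1 + 1 / (p - 1))"
          using powr_mult_base[OF g] .
        also have "1 + 1 / (p - 1) = ?p'" using p by (simp add: field_simps)
        finally show ?thesis .
      qed simp
      then have "(\<Sum>n\<in>I. \<Sum>m\<in>{m\<in>I. m \<noteq> n \<and> g m \<le> g n}. ?t n m) \<le> (\<Sum>n\<in>I. ?K * g n powr ?p')"
        by (rule sum_mono)
      also have "\<dots> = ?K" by (simp only: sum_distrib_left[symmetric] sum1 mult_1_right)
      finally show ?thesis .
    qed
    \<comment> \<open>Pairs with equal values occur in both halves, which only increases the
      right-hand side.\<close>
    have "(\<Sum>n\<in>I. \<Sum>m\<in>I - {n}. ?t n m) \<le> (\<Sum>n\<in>I. (\<Sum>m\<in>{m\<in>I. m \<noteq> n \<and> g m \<le> g n}. ?t n m) + (\<Sum>m\<in>{m\<in>I. m \<noteq> n \<and> g n \<le> g m}. ?t n m))"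
    proof (rule sum_mono)
      fix n assume "n \<in> I"
      have "(\<Sum>m\<in>I - {n}. ?t n m) \<le> (\<Sum>m\<in>{m\<in>I. m \<noteq> n \<and> g m \<le> g n} \<union> {m\<in>I. m \<noteq> n \<and> g n \<le> g m}. ?t n m)"
        using \<open>finite I\<close> g by (intro sum_mono2) auto
      also have "\<dots> \<le> (\<Sum>m\<in>{m\<in>I. m \<noteq> n \<and> g m \<le> g n}. ?t n m) + (\<Sum>m\<in>{m\<in>I. m \<noteq> n \<and> g n \<le> g m}. ?t n m)"
        using \<open>finite I\<close> g by (subst sum_Un) (auto intro!: sum_nonneg)
      finally show "(\<Sum>m\<in>I - {n}. ?t n m) \<le> \<dots>" .
    qed
    also have "\<dots> = (\<Sum>n\<in>I. \<Sum>m\<in>{m\<in>I. m \<noteq> n \<and> g m \<le> g n}. ?t n m) + (\<Sum>n\<in>I. \<Sum>m\<in>{m\<in>I. m \<noteq> n \<and> g n \<le> g m}. ?t n m)"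
      by (rule sum.distrib)
    also have "(\<Sum>n\<in>I. \<Sum>m\<in>{m\<in>I. m \<noteq> n \<and> g n \<le> g m}. ?t n m) = (\<Sum>m\<in>I. \<Sum>n\<in>{n\<in>I. n \<noteq> m \<and> g n \<le> g m}. ?t m n)"
    proof -
      have "(\<Sum>n\<in>I. \<Sum>m\<in>{m\<in>I. m \<noteq> n \<and> g n \<le> g m}. ?t n m) = (\<Sum>m\<in>I. \<Sum>n\<in>{n\<in>I. m \<noteq> n \<and> g n \<le> g m}. ?t n m)"
        by (rule sum.swap_restrict) (use \<open>finite I\<close> in auto)
      also have "\<dots> = (\<Sum>m\<in>I. \<Sum>n\<in>{n\<in>I. n \<noteq> m \<and> g n \<le> g m}. ?t m n)"
        by (intro sum.cong) (auto simp: abs_minus_commute mult.commute)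
      finally show ?thesis .
    qed
    also have "(\<Sum>n\<in>I. \<Sum>m\<in>{m\<in>I. m \<noteq> n \<and> g m \<le> g n}. ?t n m) + \<dots> \<le> 2 * ?K"
      using half by simp
    finally show ?thesis .
  qed
  let ?A = "\<Sum>m\<in>I. h m powr ?p'"
  have A0: "?A \<ge> 0" by (intro sum_nonneg) auto
  show ?thesis
  proof (cases "?A = 0")
    case True
    then have "h m = 0" if "m \<in> I" for m
      using that \<open>finite I\<close> by (subst (asm) sum_nonneg_eq_0_iff) auto
    then show ?thesis using True by simp
  next
    case False
    then have A: "?A > 0" using A0 by simp
    \<comment> \<open>The norm of h in the exponent p'; both sides of the claim scale with its
      square.\<close>
    define s where "s = ?A powr ((p - 1) / p)"
    have s: "s > 0" using A by (simp add: s_def)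
    have sp: "s powr ?p' = ?A" using p A by (simp add: s_def powr_powr)
    have "(\<Sum>m\<in>I. (h m / s) powr ?p') = 1"
      using h s sp A by (simp add: powr_divide sum_divide_distrib[symmetric])
    from normalized[of "\<lambda>m. h m / s", OF _ this] h s
    have "(\<Sum>n\<in>I. \<Sum>m\<in>I - {n}. \<bar>real_of_int (n - m)\<bar> powr (- 2 / p) * ((h n / s) * (h m / s))) \<le> 2 * ?K"
      by simp
    then have "(\<Sum>n\<in>I. \<Sum>m\<in>I - {n}. \<bar>real_of_int (n - m)\<bar> powr (- 2 / p) * (h n * h m)) / (s * s) \<le> 2 * ?K"
      by (simp add: sum_divide_distrib)
    then have "(\<Sum>n\<in>I. \<Sum>m\<in>I - {n}. \<bar>real_of_int (n - m)\<bar> powr (- 2 / p) * (h n * h m)) \<le> 2 * ?K * (s * s)"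
      using s by (simp add: divide_le_eq)
    also have "s * s = ?A powr (2 * (p - 1) / p)"
      unfolding s_def by (simp add: powr_add[symmetric])
    finally show ?thesis .
  qed
qed

section \<open>Real interpolation\<close>

lemma nn_integral_powr_interval:
  fixes r b :: real
  assumes "r > 0" "b \<ge> 0"
  shows "(\<integral>\<^sup>+\<mu>. ennreal (indicator {0..b} \<mu> * \<mu> powr (r - 1)) \<partial>lborel) = ennreal (b powr r / r)"
proof -
  have "((\<lambda>x. x powr (r - 1)) has_integral (b powr (r - 1 + 1) / (r - 1 + 1))) {0..b}"
    by (rule has_integral_powr_from_0) (use assms in auto)
  then have "(\<integral>\<^sup>+\<mu>. ennreal (indicator {0..b} \<mu> * \<mu> powr (r - 1)) \<partial>lborel) = ennreal (b powr (r - 1 + 1) / (r - 1 + 1))"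
    by (rule nn_integral_has_integral_lebesgue[rotated]) simp
  then show ?thesis by simp
qed

text \<open>On a finite measure space these functions have finite norms for all exponents, and
  truncation stays inside the set. This permits real interpolation without extending operators to
  larger spaces.\<close>

definition bounded_measurable :: "'a measure \<Rightarrow> ('a \<Rightarrow> complex) set" where
  "bounded_measurable M = {f \<in> borel_measurable M. \<exists>c. \<forall>x. norm (f x) \<le> c}"

lemma bounded_measurableI:
  "f \<in> borel_measurable M \<Longrightarrow> (\<And>x. norm (f x) \<le> c) \<Longrightarrow> f \<in> bounded_measurable M"
  by (auto simp: bounded_measurable_def)

lemma bounded_measurable_measurable: "f \<in> bounded_measurable M \<Longrightarrow> f \<in> borel_measurable M"
  by (auto simp: bounded_measurable_def)

lemma (in finite_measure) integrable_norm_powr: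
  assumes "f \<in> bounded_measurable M" "r \<ge> 0"
  shows "integrable M (\<lambda>x. norm (f x) powr r)"
proof -
  obtain c where c: "\<And>x. norm (f x) \<le> c" and [measurable]: "f \<in> borel_measurable M"
    using assms(1) by (auto simp: bounded_measurable_def)
  show ?thesis
    by (rule integrable_const_bound[where B = "c powr r"])
       (use c assms in \<open>auto intro!: powr_mono2\<close>)
qed

text \<open>
  The real interpolation method for an operator bounded from \<open>L\<^sup>2\<close> to \<open>L\<^sup>2\<close> and from \<open>L\<^sup>1\<close> to
  \<open>L\<^sup>\<infinity>\<close>: at height \<open>\<mu>\<close> the function is truncated so that the large values contribute at most
  \<open>\<mu> / 2\<close>, and the rest is estimated by Chebyshev's inequality.
\<close>

lemma (in finite_measure) interpolation_L2_Linfinity: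
  fixes A :: "('a \<Rightarrow> complex) \<Rightarrow> 'a \<Rightarrow> complex"
  assumes q: "q > 2" and \<alpha>: "\<alpha> \<ge> 0" and \<beta>: "\<beta> > 0"
    and meas: "\<And>f. f \<in> bounded_measurable M \<Longrightarrow> A f \<in> borel_measurable M"
    and add: "\<And>f g x. f \<in> bounded_measurable M \<Longrightarrow> g \<in> bounded_measurable M \<Longrightarrow>
      A (\<lambda>x. f x + g x) x = A f x + A g x"
    and sup: "\<And>f x. f \<in> bounded_measurable M \<Longrightarrow> norm (A f x) \<le> \<beta> * (\<integral>x. norm (f x) \<partial>M)"
    and L2: "\<And>f. f \<in> bounded_measurable M \<Longrightarrow>
      (\<integral>x. (norm (A f x))\<^sup>2 \<partial>M) \<le> \<alpha> * (\<integral>x. (norm (f x))\<^sup>2 \<partial>M)"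
    and f: "f \<in> bounded_measurable M"
  shows "(\<integral>x. norm (A f x) powr q \<partial>M)
    \<le> (4 * q / (q - 2) * 2 powr (q - 2)) * \<alpha> * \<beta> powr (q - 2) * (\<integral>x. norm (f x) powr (q / (q - 1)) \<partial>M) powr (q - 1)"
proof -
  let ?q' = "q / (q - 1)"
  obtain B where B: "\<And>x. norm (f x) \<le> B" using f by (auto simp: bounded_measurable_def)
  have fm[measurable]: "f \<in> borel_measurable M" using f by (rule bounded_measurable_measurable)
  have Afm[measurable]: "A f \<in> borel_measurable M" using f by (rule meas)
  let ?S = "\<integral>x. norm (f x) powr ?q' \<partial>M"
  have intf: "integrable M (\<lambda>x. norm (f x) powr ?q')"
    using q f by (intro integrable_norm_powr) auto
  have S0: "?S \<ge> 0" by (auto intro: integral_nonneg_AE)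
  show ?thesis
  proof (cases "?S = 0")
    case True
    then have "AE x in M. norm (f x) powr ?q' = 0"
      using integral_nonneg_eq_0_iff_AE[OF intf] by auto
    then have ae: "AE x in M. norm (f x) = 0" by eventually_elim simp
    have "(\<integral>x. norm (f x) \<partial>M) = (\<integral>x. 0 \<partial>M)" by (rule integral_cong_AE) (use ae in auto)
    then have "norm (A f x) = 0" for x using sup[OF f, of x] by simp
    then have "(\<integral>x. norm (A f x) powr q \<partial>M) = 0" using q by simp
    then show ?thesis using True by simp
  next
    case False
    then have S: "?S > 0" using S0 by (simp only: less_le) simp
    \<comment> \<open>Chosen so that the part of f above the height \<open>s \<mu>\<close> has image
      at most \<mu>/2. This c is the origin of the factor 2^(q - 2) in the constant; the 4 comes
      from Chebyshev's inequality at height \<mu>/2 and q/(q - 2) from the two integrals in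
      \<mu>.\<close>
    define c where "c = 2 * \<beta> * ?S"
    have c: "c > 0" using S \<beta> by (simp add: c_def)
    define s where "s \<mu> = (\<mu> / c) powr (- (q - 1))" for \<mu>
    have s[measurable]: "s \<in> borel_measurable borel" unfolding s_def by measurable
    have level: "emeasure M {x\<in>space M. \<mu> \<le> norm (A f x)}
        \<le> ennreal (4 * \<alpha> / \<mu>\<^sup>2) * (\<integral>\<^sup>+x. ennreal ((norm (f x))\<^sup>2 * indicator {..s \<mu>} (norm (f x))) \<partial>M)"
      if \<mu>: "\<mu> > 0" for \<mu>
    proof -
      have s0: "s \<mu> > 0" using \<mu> c by (simp add: s_def)
      let ?f1 = "\<lambda>x. if norm (f x) \<le> s \<mu> then 0 else f x" and ?f2 = "\<lambda>x. if norm (f x) \<le> s \<mu> then f x else 0"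
      have B0: "0 \<le> B" using B[of undefined] norm_ge_zero[of "f undefined"] by linarith
      have f1: "?f1 \<in> bounded_measurable M" and f2: "?f2 \<in> bounded_measurable M"
        by (rule bounded_measurableI[where c=B]; use B B0 in \<open>auto simp: \<close>)+
      have [measurable]: "A ?f2 \<in> borel_measurable M" using f2 by (rule meas)
      have "A f x = A ?f1 x + A ?f2 x" for x
        using add[OF f1 f2, of x] by (simp add: if_distrib cong: if_cong)
      have i1: "(\<integral>x. norm (?f1 x) \<partial>M) \<le> (\<integral>x. norm (f x) powr ?q' * (\<mu> / c) \<partial>M)"
      proof (rule integral_mono)
        show "integrable M (\<lambda>x. norm (?f1 x))"
          using integrable_norm_powr[OF f1, of 1] by simp
        show "integrable M (\<lambda>x. norm (f x) powr ?q' * (\<mu> / c))"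
          by (rule integrable_mult_left) (rule intf)
        fix x
        show "norm (?f1 x) \<le> norm (f x) powr ?q' * (\<mu> / c)"
        proof (cases "norm (f x) \<le> s \<mu>")
          case False
          then have n: "norm (f x) > s \<mu>" by simp
          \<comment> \<open>The exponent 1 - q' is negative. So above the truncation height the
            power 1 - q' of |f| is at most \<mu>/c, and the L1 norm of the large part is controlled
            by the integral of the q'-th power.\<close>
          have "\<mu> / c = s \<mu> powr (1 - ?q')"
          proof -
            have "- (q - 1) * (1 - ?q') = 1" using q by (simp add: field_simps)
            then show ?thesis using \<mu> c by (simp add: s_def powr_powr del: minus_diff_eq)
          qed
          also have "\<dots> \<ge> norm (f x) powr (1 - ?q')"
            using n s0 q by (intro powr_mono2') (auto simp: field_simps)
          finally have "norm (f x) powr ?q' * norm (f x) powr (1 - ?q') \<le> norm (f x) powr ?q' * (\<mu> / c)"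
            by (intro mult_left_mono) auto
          moreover have "norm (f x) powr ?q' * norm (f x) powr (1 - ?q') = norm (f x)"
            using n s0 by (simp add: powr_add[symmetric])
          ultimately show ?thesis using False by simp
        qed (use \<mu> c in auto)
      qed
      also have "\<dots> = ?S * (\<mu> / c)" using intf by simp
      also have "\<dots> = \<mu> / (2 * \<beta>)" using S by (simp add: c_def)
      finally have "\<beta> * (\<integral>x. norm (?f1 x) \<partial>M) \<le> \<beta> * (\<mu> / (2 * \<beta>))"
        using \<beta> by (intro mult_left_mono) auto
      then have small: "norm (A ?f1 x) \<le> \<mu> / 2" for x
        using sup[OF f1, of x] \<beta> by simp
      \<comment> \<open>The large part accounts for at most \<mu>/2, so the image of the small part
        is at least \<mu>/2 on this set.\<close>
      have "{x\<in>space M. \<mu> \<le> norm (A f x)} \<subseteq> {x\<in>space M. 1 \<le> ennreal (4 / \<mu>\<^sup>2) * ennreal ((norm (A ?f2 x))\<^sup>2)}"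
      proof clarsimp
        fix x assume "\<mu> \<le> norm (A f x)"
        then have "\<mu> / 2 \<le> norm (A ?f2 x)"
          using \<open>\<And>x. A f x = A ?f1 x + A ?f2 x\<close>[of x] small[of x] norm_triangle_ineq[of "A ?f1 x" "A ?f2 x"] by simp
        then have "(\<mu> / 2)\<^sup>2 \<le> (norm (A ?f2 x))\<^sup>2" using \<mu> by (intro power_mono) auto
        then have "1 \<le> 4 / \<mu>\<^sup>2 * (norm (A ?f2 x))\<^sup>2" using \<mu> by (simp add: field_simps)
        then show "1 \<le> ennreal (4 / \<mu>\<^sup>2) * ennreal ((norm (A ?f2 x))\<^sup>2)"
          by (simp add: ennreal_mult[symmetric] del: ennreal_mult)
      qed
      then have "emeasure M {x\<in>space M. \<mu> \<le> norm (A f x)}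
        \<le> emeasure M {x\<in>space M. 1 \<le> ennreal (4 / \<mu>\<^sup>2) * ennreal ((norm (A ?f2 x))\<^sup>2)}"
        by (intro emeasure_mono) measurable
      also have "\<dots> \<le> ennreal (4 / \<mu>\<^sup>2) * (\<integral>\<^sup>+x. ennreal ((norm (A ?f2 x))\<^sup>2) * indicator (space M) x \<partial>M)"
        using nn_integral_Markov_inequality[where u="\<lambda>x. ennreal ((norm (A ?f2 x))\<^sup>2)" and A="space M" and M=M and c="ennreal (4 / \<mu>\<^sup>2)"] by simp
      also have "(\<integral>\<^sup>+x. ennreal ((norm (A ?f2 x))\<^sup>2) * indicator (space M) x \<partial>M) = (\<integral>\<^sup>+x. ennreal ((norm (A ?f2 x))\<^sup>2) \<partial>M)"
        by (intro nn_integral_cong) auto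
      also have "\<dots> = ennreal (\<integral>x. (norm (A ?f2 x))\<^sup>2 \<partial>M)"
      proof (rule nn_integral_eq_integral)
        have "A ?f2 \<in> borel_measurable M" by measurable
        then show "integrable M (\<lambda>x. (norm (A ?f2 x))\<^sup>2)"
          using sup[OF f2] by (intro integrable_const_bound[where B="(\<beta> * (\<integral>x. norm (?f2 x) \<partial>M))\<^sup>2"]) (auto intro!: AE_I2 power_mono)
      qed auto
      also have "\<dots> \<le> ennreal (\<alpha> * (\<integral>x. (norm (?f2 x))\<^sup>2 \<partial>M))"
        by (intro ennreal_leI L2 f2)
      also have "\<dots> = ennreal \<alpha> * (\<integral>\<^sup>+x. ennreal ((norm (?f2 x))\<^sup>2) \<partial>M)"
      proof -
        have "integrable M (\<lambda>x. norm (?f2 x) powr 2)" using f2 by (intro integrable_norm_powr) auto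
        then have "integrable M (\<lambda>x. (norm (?f2 x))\<^sup>2)" by simp
        then show ?thesis using \<alpha> by (subst nn_integral_eq_integral) (auto simp: ennreal_mult)
      qed
      also have "(\<integral>\<^sup>+x. ennreal ((norm (?f2 x))\<^sup>2) \<partial>M) = (\<integral>\<^sup>+x. ennreal ((norm (f x))\<^sup>2 * indicator {..s \<mu>} (norm (f x))) \<partial>M)"
        by (intro nn_integral_cong) (auto simp: indicator_def)
      also have "ennreal (4 / \<mu>\<^sup>2) * (ennreal \<alpha> * \<dots>) = ennreal (4 * \<alpha> / \<mu>\<^sup>2) * \<dots>"
        using \<alpha> by (simp add: mult.assoc[symmetric] ennreal_mult[symmetric])
      finally show ?thesis by (simp add: mult_left_mono)
    qed
    have sf: "sigma_finite_measure M" by unfold_locales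
    interpret P: pair_sigma_finite M lborel
      using sf by (simp add: pair_sigma_finite_def sigma_finite_lborel)
    \<comment> \<open>The layer-cake formula: the q-th power is an integral over heights \<mu>, so
      the level set estimate can be inserted after exchanging the integrals.\<close>
    have "(\<integral>\<^sup>+x. ennreal (norm (A f x) powr q) \<partial>M)
      = (\<integral>\<^sup>+x. (\<integral>\<^sup>+\<mu>. ennreal (q * (indicator {0..norm (A f x)} \<mu> * \<mu> powr (q - 1))) \<partial>lborel) \<partial>M)"
    proof (rule nn_integral_cong)
      fix x
      have "(\<integral>\<^sup>+\<mu>. ennreal (q * (indicator {0..norm (A f x)} \<mu> * \<mu> powr (q - 1))) \<partial>lborel)
        = ennreal q * ennreal (norm (A f x) powr q / q)"
        using q by (subst nn_integral_powr_interval[symmetric], simp, simp, subst nn_integral_cmult[symmetric]) (auto intro!: nn_integral_cong simp: ennreal_mult)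
      then show "ennreal (norm (A f x) powr q) = (\<integral>\<^sup>+\<mu>. ennreal (q * (indicator {0..norm (A f x)} \<mu> * \<mu> powr (q - 1))) \<partial>lborel)"
        using q by (simp add: ennreal_mult[symmetric])
    qed
    also have "\<dots> = (\<integral>\<^sup>+\<mu>. (\<integral>\<^sup>+x. ennreal (q * (indicator {0..norm (A f x)} \<mu> * \<mu> powr (q - 1))) \<partial>M) \<partial>lborel)"
      by (rule P.Fubini'[symmetric]) (measurable, simp add: indicator_def, measurable)
    also have "\<dots> \<le> (\<integral>\<^sup>+\<mu>. (\<integral>\<^sup>+x. ennreal (4 * \<alpha> * q * (norm (f x))\<^sup>2 * indicator {..s \<mu>} (norm (f x)) * (if \<mu> > 0 then \<mu> powr (q - 3) else 0)) \<partial>M) \<partial>lborel)"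
    proof (rule nn_integral_mono_AE)
      show "AE \<mu> in lborel. (\<integral>\<^sup>+x. ennreal (q * (indicator {0..norm (A f x)} \<mu> * \<mu> powr (q - 1))) \<partial>M)
        \<le> (\<integral>\<^sup>+x. ennreal (4 * \<alpha> * q * (norm (f x))\<^sup>2 * indicator {..s \<mu>} (norm (f x)) * (if \<mu> > 0 then \<mu> powr (q - 3) else 0)) \<partial>M)"
        using AE_lborel_singleton[of "0::real"]
      proof eventually_elim
        case (elim \<mu>)
        show ?case
        proof (cases "\<mu> > 0")
          case True
          have "(\<integral>\<^sup>+x. ennreal (q * (indicator {0..norm (A f x)} \<mu> * \<mu> powr (q - 1))) \<partial>M)
            = (\<integral>\<^sup>+x. ennreal (q * \<mu> powr (q - 1)) * indicator {x\<in>space M. \<mu> \<le> norm (A f x)} x \<partial>M)"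
            using True by (intro nn_integral_cong) (auto simp: indicator_def)
          also have "\<dots> = ennreal (q * \<mu> powr (q - 1)) * emeasure M {x\<in>space M. \<mu> \<le> norm (A f x)}"
            by (subst nn_integral_cmult_indicator) measurable
          also have "\<dots> \<le> ennreal (q * \<mu> powr (q - 1)) * (ennreal (4 * \<alpha> / \<mu>\<^sup>2) * (\<integral>\<^sup>+x. ennreal ((norm (f x))\<^sup>2 * indicator {..s \<mu>} (norm (f x))) \<partial>M))"
            by (intro mult_left_mono level True) simp
          also have "\<dots> = ennreal (q * \<mu> powr (q - 1) * (4 * \<alpha> / \<mu>\<^sup>2)) * (\<integral>\<^sup>+x. ennreal ((norm (f x))\<^sup>2 * indicator {..s \<mu>} (norm (f x))) \<partial>M)"
            by (subst ennreal_mult[of "q * \<mu> powr (q - 1)" "4 * \<alpha> / \<mu>\<^sup>2"])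
               (use q \<alpha> in simp, use \<alpha> in simp, rule mult.assoc[symmetric])
          also have "q * \<mu> powr (q - 1) * (4 * \<alpha> / \<mu>\<^sup>2) = 4 * \<alpha> * q * \<mu> powr (q - 3)"
          proof -
            have eq: "\<mu> powr (q - 1) / \<mu>\<^sup>2 = \<mu> powr (q - 3)"
              using True powr_diff[of \<mu> "q - 1" 2] by simp
            have "q * \<mu> powr (q - 1) * (4 * \<alpha> / \<mu>\<^sup>2) = 4 * \<alpha> * q * (\<mu> powr (q - 1) / \<mu>\<^sup>2)" by simp
            then show ?thesis unfolding eq .
          qed
          also have "ennreal (4 * \<alpha> * q * \<mu> powr (q - 3)) * (\<integral>\<^sup>+x. ennreal ((norm (f x))\<^sup>2 * indicator {..s \<mu>} (norm (f x))) \<partial>M)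
            = (\<integral>\<^sup>+x. ennreal (4 * \<alpha> * q * \<mu> powr (q - 3)) * ennreal ((norm (f x))\<^sup>2 * indicator {..s \<mu>} (norm (f x))) \<partial>M)"
            by (subst nn_integral_cmult) measurable
          also have "\<dots> = (\<integral>\<^sup>+x. ennreal (4 * \<alpha> * q * (norm (f x))\<^sup>2 * indicator {..s \<mu>} (norm (f x)) * (if \<mu> > 0 then \<mu> powr (q - 3) else 0)) \<partial>M)"
            using True q \<alpha> by (intro nn_integral_cong) (simp add: ennreal_mult[symmetric] mult_ac)
          finally show ?thesis .
        next
          case False
          then have "\<mu> < 0" using elim by simp
          then show ?thesis by simp
        qed
      qed
    qed
    also have "\<dots> = (\<integral>\<^sup>+x. (\<integral>\<^sup>+\<mu>. ennreal (4 * \<alpha> * q * (norm (f x))\<^sup>2 * indicator {..s \<mu>} (norm (f x)) * (if \<mu> > 0 then \<mu> powr (q - 3) else 0)) \<partial>lborel) \<partial>M)"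
      by (rule P.Fubini') (measurable, simp add: indicator_def, measurable)
    also have "\<dots> \<le> (\<integral>\<^sup>+x. ennreal (4 * \<alpha> * q / (q - 2) * c powr (q - 2) * norm (f x) powr ?q') \<partial>M)"
    proof (rule nn_integral_mono)
      fix x
      show "(\<integral>\<^sup>+\<mu>. ennreal (4 * \<alpha> * q * (norm (f x))\<^sup>2 * indicator {..s \<mu>} (norm (f x)) * (if \<mu> > 0 then \<mu> powr (q - 3) else 0)) \<partial>lborel)
        \<le> ennreal (4 * \<alpha> * q / (q - 2) * c powr (q - 2) * norm (f x) powr ?q')"
      proof (cases "f x = 0")
        case False
        let ?n = "norm (f x)"
        let ?b = "c * ?n powr (- 1 / (q - 1))"
        have n: "?n > 0" using False by simp
        have "(\<integral>\<^sup>+\<mu>. ennreal (4 * \<alpha> * q * ?n\<^sup>2 * indicator {..s \<mu>} ?n * (if \<mu> > 0 then \<mu> powr (q - 3) else 0)) \<partial>lborel)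
          \<le> (\<integral>\<^sup>+\<mu>. ennreal (4 * \<alpha> * q * ?n\<^sup>2) * ennreal (indicator {0..?b} \<mu> * \<mu> powr (q - 2 - 1)) \<partial>lborel)"
        proof (rule nn_integral_mono)
          fix \<mu> :: real
          \<comment> \<open>Inverts the decreasing function s: for fixed x only heights up to
            \<open>?b\<close> remain, and the integral of \<mu>^(q - 3) over them converges at 0
            because q > 2.\<close>
          have "\<mu> \<le> ?b" if "\<mu> > 0" "?n \<le> s \<mu>"
          proof -
            have "(s \<mu>) powr (- 1 / (q - 1)) \<le> ?n powr (- 1 / (q - 1))"
              using that n q by (intro powr_mono2') auto
            moreover have "(s \<mu>) powr (- 1 / (q - 1)) = \<mu> / c"
            proof -
              have e: "- (q - 1) * (- 1 / (q - 1)) = 1" using q by (simp add: field_simps)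
              show ?thesis unfolding s_def powr_powr e using that c by simp
            qed
            ultimately have "\<mu> / c \<le> ?n powr (- 1 / (q - 1))" by (simp only:)
            then show ?thesis using c by (simp only: pos_divide_le_eq mult.commute)
          qed
          then have "indicator {..s \<mu>} ?n * (if \<mu> > 0 then \<mu> powr (q - 3) else 0) \<le> indicator {0..?b} \<mu> * \<mu> powr (q - 2 - 1)"
            by (auto simp: indicator_def)
          then have "4 * \<alpha> * q * ?n\<^sup>2 * (indicator {..s \<mu>} ?n * (if \<mu> > 0 then \<mu> powr (q - 3) else 0)) \<le> 4 * \<alpha> * q * ?n\<^sup>2 * (indicator {0..?b} \<mu> * \<mu> powr (q - 2 - 1))"
            using \<alpha> q by (intro mult_left_mono) auto
          then show "ennreal (4 * \<alpha> * q * ?n\<^sup>2 * indicator {..s \<mu>} ?n * (if \<mu> > 0 then \<mu> powr (q - 3) else 0))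
            \<le> ennreal (4 * \<alpha> * q * ?n\<^sup>2) * ennreal (indicator {0..?b} \<mu> * \<mu> powr (q - 2 - 1))"
            using \<alpha> q by (subst ennreal_mult[symmetric]) (auto intro!: ennreal_leI simp: mult.assoc)
        qed
        also have "\<dots> = ennreal (4 * \<alpha> * q * ?n\<^sup>2) * ennreal (?b powr (q - 2) / (q - 2))"
          using q c by (subst nn_integral_cmult, simp, subst nn_integral_powr_interval) auto
        also have "\<dots> = ennreal (4 * \<alpha> * q * ?n\<^sup>2 * (?b powr (q - 2) / (q - 2)))"
          using \<alpha> q by (intro ennreal_mult[symmetric]) auto
        also have "4 * \<alpha> * q * ?n\<^sup>2 * (?b powr (q - 2) / (q - 2)) = 4 * \<alpha> * q / (q - 2) * c powr (q - 2) * (?n powr 2 * ?n powr (- 1 / (q - 1) * (q - 2)))"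
          using c n by (simp add: powr_mult powr_powr)
        also have "?n powr 2 * ?n powr (- 1 / (q - 1) * (q - 2)) = ?n powr ?q'"
        proof -
          have "2 + - 1 / (q - 1) * (q - 2) = ?q'" using q by (simp add: field_simps)
          then show ?thesis by (simp only: powr_add[symmetric])
        qed
        finally show ?thesis .
      qed simp
    qed
    also have "\<dots> = ennreal (4 * \<alpha> * q / (q - 2) * c powr (q - 2) * ?S)"
      using intf \<alpha> q by (subst nn_integral_eq_integral) auto
    finally have "(\<integral>\<^sup>+x. ennreal (norm (A f x) powr q) \<partial>M) \<le> ennreal (4 * \<alpha> * q / (q - 2) * c powr (q - 2) * ?S)" .
    moreover have "integrable M (\<lambda>x. norm (A f x) powr q)"
      using sup[OF f] q by (intro integrable_const_bound[where B="(\<beta> * (\<integral>x. norm (f x) \<partial>M)) powr q"]) (auto intro!: AE_I2 powr_mono2)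
    ultimately have "(\<integral>x. norm (A f x) powr q \<partial>M) \<le> 4 * \<alpha> * q / (q - 2) * c powr (q - 2) * ?S"
      using \<alpha> q S0 by (subst (asm) nn_integral_eq_integral) (auto simp: ennreal_le_iff)
    also have "c powr (q - 2) = 2 powr (q - 2) * \<beta> powr (q - 2) * ?S powr (q - 2)"
      unfolding c_def using \<beta> S by (simp add: powr_mult)
    also have "4 * \<alpha> * q / (q - 2) * (2 powr (q - 2) * \<beta> powr (q - 2) * ?S powr (q - 2)) * ?S
      = (4 * q / (q - 2) * 2 powr (q - 2)) * \<alpha> * \<beta> powr (q - 2) * (?S * ?S powr (q - 2))"
      by (simp add: mult_ac)
    also have "?S * ?S powr (q - 2) = ?S powr (q - 1)"
      using powr_mult_base[OF S0, of "q - 2"] by simp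
    finally show ?thesis .
  qed
qed

section \<open>A radial kernel for the wave propagator\<close>

lemma borel_measurable_cis [measurable]: "cis \<in> borel_measurable borel"
  by (intro borel_measurable_continuous_onI continuous_intros)

lemma integrable_exp_minus_abs:
  fixes a :: real
  assumes "a > 0"
  shows "integrable lborel (\<lambda>s::real. exp (- a * \<bar>s\<bar>))"
    and "(\<integral>s. indicator {0<..} s *\<^sub>R (exp (- a * s) * cis (\<rho> * s)) \<partial>lborel) = 1 / (a - \<i> * \<rho>)"
    and "integrable lborel (\<lambda>s. indicator {0<..} s *\<^sub>R (exp (- a * s) * cis (\<rho> * s)))"
proof -
  have eint: "einterval 0 \<infinity> = {0<..}" by (auto simp: einterval_def)
  have lim: "((\<lambda>s. exp (- a * s)) \<longlongrightarrow> 0) at_top"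
    using assms by real_asymp
  have 1: "set_integrable lborel (einterval 0 \<infinity>) (\<lambda>s. exp (- a * s))"
  proof (rule interval_integral_FTC_nonneg(1))
    show "((\<lambda>s. - exp (- a * s) / a) has_real_derivative exp (- a * x)) (at x)" for x
      using assms by (auto intro!: derivative_eq_intros)
    have "((\<lambda>s. - exp (- a * s) / a) \<longlongrightarrow> - exp (- a * 0) / a) (at_right 0)"
      by (intro tendsto_intros) (use assms in auto)
    then show "(((\<lambda>s. - exp (- a * s) / a) \<circ> real_of_ereal) \<longlongrightarrow> - exp (- a * 0) / a) (at_right 0)"
      using ereal_tendsto_simps1(2)[of "\<lambda>s. - exp (- a * s) / a" "- exp (- a * 0) / a" 0]
      by (simp only: zero_ereal_def)
    have "((\<lambda>s. - exp (- a * s) / a) \<longlongrightarrow> - 0 / a) at_top"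
      by (intro tendsto_intros lim) (use assms in auto)
    then show "(((\<lambda>s. - exp (- a * s) / a) \<circ> real_of_ereal) \<longlongrightarrow> - 0 / a) (at_left \<infinity>)"
      by (simp only: ereal_tendsto_simps1)
  qed (auto intro!: continuous_intros)
  then have 2: "integrable lborel (\<lambda>s. indicator {0<..} s *\<^sub>R exp (- a * s))"
    unfolding set_integrable_def eint .
  have 3: "integrable lborel (\<lambda>s. indicator {0<..} (- s) *\<^sub>R exp (- a * (- s)))"
    using lborel_integrable_real_affine[OF 2, of "-1" 0] by simp
  show "integrable lborel (\<lambda>s::real. exp (- a * \<bar>s\<bar>))"
  proof (rule integrable_cong_AE_imp[OF Bochner_Integration.integrable_add[OF 2 3]])
    show "AE s in lborel. indicator {0<..} s *\<^sub>R exp (- a * s) + indicator {0<..} (- s) *\<^sub>R exp (- a * - s) = exp (- a * \<bar>s\<bar>)"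
      using AE_lborel_singleton[of "0::real"] by eventually_elim (auto simp: indicator_def)
  qed auto
  show 4: "integrable lborel (\<lambda>s. indicator {0<..} s *\<^sub>R (exp (- a * s) * cis (\<rho> * s)))"
    by (rule Bochner_Integration.integrable_bound[OF 2]) (auto simp: norm_mult)
  define z where "z = complex_of_real a - \<i> * \<rho>"
  have z: "z \<noteq> 0" using assms by (auto simp: z_def complex_eq_iff)
  have ez: "exp (- z * of_real s) = exp (- a * s) * cis (\<rho> * s)" for s
    by (simp add: z_def cis_conv_exp exp_of_real[symmetric] exp_add[symmetric] algebra_simps)
  have "(LBINT s=0..\<infinity>. exp (- a * s) * cis (\<rho> * s)) = 0 - (- 1 / z)"
  proof (rule interval_integral_FTC_integrable[where F="\<lambda>s. - exp (- z * of_real s) / z"])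
    show "((\<lambda>s. - exp (- z * of_real s) / z) has_vector_derivative exp (- a * x) * cis (\<rho> * x)) (at x)" for x
      unfolding ez[symmetric]
      using z by (auto intro!: derivative_eq_intros has_vector_derivative_real_field)
    show "set_integrable lborel (einterval 0 \<infinity>) (\<lambda>s. exp (- a * s) * cis (\<rho> * s))"
      unfolding set_integrable_def eint by (rule 4)
    show "isCont (\<lambda>s. exp (- a * s) * cis (\<rho> * s)) x" for x
      unfolding ez[symmetric] by (intro continuous_intros)
    have "((\<lambda>s. - exp (- z * complex_of_real s) / z) \<longlongrightarrow> - exp (- z * of_real 0) / z) (at_right 0)"
      by (intro tendsto_intros z)
    then have "((\<lambda>s. - exp (- z * complex_of_real s) / z) \<longlongrightarrow> - 1 / z) (at_right 0)"
      by simp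
    then show "(((\<lambda>s. - exp (- z * complex_of_real s) / z) \<circ> real_of_ereal) \<longlongrightarrow> - 1 / z) (at_right 0)"
      using ereal_tendsto_simps1(2)[of "\<lambda>s. - exp (- z * complex_of_real s) / z" "- 1 / z" 0]
      by (simp only: zero_ereal_def)
    have "((\<lambda>s. exp (- z * complex_of_real s)) \<longlongrightarrow> 0) at_top"
      unfolding ez by (rule tendsto_norm_zero_cancel) (use lim in \<open>simp add: norm_mult\<close>)
    then have "((\<lambda>s. - exp (- z * complex_of_real s) / z) \<longlongrightarrow> - 0 / z) at_top"
      by (intro tendsto_minus tendsto_divide tendsto_const z)
    then show "(((\<lambda>s. - exp (- z * complex_of_real s) / z) \<circ> real_of_ereal) \<longlongrightarrow> 0) (at_left \<infinity>)"
      by (simp add: ereal_tendsto_simps1)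
  qed (auto intro!: continuous_intros)
  then show "(\<integral>s. indicator {0<..} s *\<^sub>R (exp (- a * s) * cis (\<rho> * s)) \<partial>lborel) = 1 / (a - \<i> * \<rho>)"
    by (simp add: interval_lebesgue_integral_def set_lebesgue_integral_def eint z_def)
qed

text \<open>The integrand at -s is the conjugate of the integrand at s, so the transform is the
  half-line integral plus its conjugate.\<close>

lemma fourier_exp_minus_abs:
  fixes a \<rho> :: real
  assumes a: "a > 0"
  shows "(\<integral>s. of_real (exp (- a * \<bar>s\<bar>)) * cis (\<rho> * s) \<partial>lborel) = of_real (2 * a / (a\<^sup>2 + \<rho>\<^sup>2))"
proof -
  let ?g = "\<lambda>s. indicator {0<..} s *\<^sub>R (exp (- a * s) * cis (\<rho> * s))"
  note g = integrable_exp_minus_abs(2,3)[OF a, of \<rho>]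
  have "integrable lborel (\<lambda>s. ?g (0 + - 1 * s))"
    by (rule lborel_integrable_real_affine[OF g(2)]) simp
  then have g'': "integrable lborel (\<lambda>s. ?g (- s))" by simp
  then have g': "integrable lborel (\<lambda>s. cnj (?g (- s)))" by (rule integrable_cnj)
  have "(\<integral>s. of_real (exp (- a * \<bar>s\<bar>)) * cis (\<rho> * s) \<partial>lborel) = (\<integral>s. ?g s + cnj (?g (- s)) \<partial>lborel)"
  proof (rule integral_cong_AE)
    show "AE s in lborel. of_real (exp (- a * \<bar>s\<bar>)) * cis (\<rho> * s) = ?g s + cnj (?g (- s))"
      using AE_lborel_singleton[of "0::real"]
      by eventually_elim (auto simp: indicator_def cis_cnj exp_of_real)
    show "(\<lambda>s. ?g s + cnj (?g (- s))) \<in> borel_measurable lborel"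
      by (intro borel_measurable_add borel_measurable_integrable g(2) g')
  qed measurable
  also have "\<dots> = (\<integral>s. ?g s \<partial>lborel) + cnj (\<integral>s. ?g (- s) \<partial>lborel)"
    by (simp only: Bochner_Integration.integral_add[OF g(2) g'] integral_bounded_linear[OF bounded_linear_cnj g''])
  also have "(\<integral>s. ?g (- s) \<partial>lborel) = (\<integral>s. ?g s \<partial>lborel)"
    using lborel_integral_real_affine[of "-1" ?g 0] by simp
  also have "(\<integral>s. ?g s \<partial>lborel) + cnj (\<integral>s. ?g s \<partial>lborel) = of_real (2 * a / (a\<^sup>2 + \<rho>\<^sup>2))"
    unfolding g(1) by (simp add: complex_eq_iff Re_divide Im_divide power2_eq_square)
  finally show ?thesis .
qed

section \<open>The explicit wave kernel and its pointwise bound\<close>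

definition exp_diff :: "real \<Rightarrow> real \<Rightarrow> real \<Rightarrow> real" where
  "exp_diff a b x = exp (- a * max x 0) - exp (- b * max x 0)"

text \<open>The radial profile of the fundamental solution: up to a factor, minus the derivative of the
  even function \<open>profile\<close>.\<close>

definition odd_profile :: "real \<Rightarrow> real \<Rightarrow> real \<Rightarrow> real" where
  "odd_profile a b s = exp_diff a b s - exp_diff a b (- s)"

text \<open>By partial fractions this is the function with one-dimensional Fourier integral b^2 /
  ((a^2 + \<rho>^2) (b^2 + \<rho>^2)). The kinks of the two exponentials at the origin cancel, so it
  is differentiable there.\<close>

definition profile :: "real \<Rightarrow> real \<Rightarrow> real \<Rightarrow> real" where
  "profile a b s = b\<^sup>2 / (2 * (b\<^sup>2 - a\<^sup>2)) * (exp (- a * \<bar>s\<bar>) / a - exp (- b * \<bar>s\<bar>) / b)"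

text \<open>This is - \<Phi>' / (2 pi r) for the average \<Phi> of the two translates of
  \<open>profile\<close> by t and -t; the translates produce the factor cos (t \<rho>) in the
  transform. At r = 0 the value is 0 by division by zero.\<close>

definition wave_kernel :: "real \<Rightarrow> real \<Rightarrow> real \<Rightarrow> real \<Rightarrow> real" where
  "wave_kernel a b t r = b\<^sup>2 / (b\<^sup>2 - a\<^sup>2) / (8 * pi * r) * (odd_profile a b (r + t) + odd_profile a b (r - t))"

text \<open>The factor b x gains over the second bound below the scale 1/b, where it will compensate
  the division by r. The rate c may be smaller than a: c = a serves for integrability, and c = 1
  gives a decay that is uniform in a \<ge> 1.\<close>

lemma exp_diff_bounds:
  assumes "0 \<le> c" "c \<le> a" "a \<le> b" "x \<ge> 0"
  shows "0 \<le> exp_diff a b x" "exp_diff a b x \<le> exp (- c * x)" "exp_diff a b x \<le> exp (- c * x) * (b * x)"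
proof -
  have "c * x \<le> a * x" using assms by (intro mult_right_mono) auto
  then have e: "exp (- a * x) \<le> exp (- c * x)" by simp
  have eq: "exp_diff a b x = exp (- a * x) - exp (- b * x)"
    using assms by (simp add: exp_diff_def max_def)
  have "a * x \<le> b * x" using assms by (intro mult_right_mono) auto
  then have "exp (- b * x) \<le> exp (- a * x)" by simp
  then show "0 \<le> exp_diff a b x" unfolding eq by linarith
  show "exp_diff a b x \<le> exp (- c * x)" using e exp_gt_zero[of "- b * x"] unfolding eq by linarith
  have "exp_diff a b x = exp (- a * x) * (1 - exp (- (b - a) * x))"
    by (simp add: eq right_diff_distrib exp_add[symmetric] left_diff_distrib)
  also have "1 - exp (- (b - a) * x) \<le> (b - a) * x"
    using exp_ge_add_one_self[of "- (b - a) * x"] by linarith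
  also have "(b - a) * x \<le> b * x" using assms by (simp add: mult_right_mono)
  also have "exp (- a * x) * (b * x) \<le> exp (- c * x) * (b * x)"
    using e assms by (intro mult_right_mono) auto
  finally show "exp_diff a b x \<le> exp (- c * x) * (b * x)" by (simp add: mult_left_mono)
qed

lemma odd_profile_nonneg: "s \<ge> 0 \<Longrightarrow> odd_profile a b s = exp_diff a b s"
  and odd_profile_nonpos: "s \<le> 0 \<Longrightarrow> odd_profile a b s = - exp_diff a b (- s)"
  by (simp_all add: odd_profile_def exp_diff_def)

text \<open>Decay in t has to come from the division by r. Outside the light cone 1/r is at most
  1/t. Inside it the two odd profiles have opposite signs, and their difference is at most 4 r / t.
  The scale 1/b enters because the sum is also bounded by a multiple of b r, so that there is no
  singularity at t = 0.\<close>

lemma odd_profile_sum_bound: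
  assumes c: "0 \<le> c" "c \<le> a" and ab: "0 < a" "a \<le> b" and r: "r > 0" and t: "t \<ge> 0"
  shows "\<bar>odd_profile a b (r + t) + odd_profile a b (r - t)\<bar> / r \<le> 6 * exp (c * (t - r)) / (t + 1 / b)"
proof -
  have b: "b > 0" using ab by simp
  let ?X = "\<bar>odd_profile a b (r + t) + odd_profile a b (r - t)\<bar>"
  \<comment> \<open>The 6 is 4 + 2: the products with t and with 1/b are bounded by 4 and 2 in one
    order or the other.\<close>
  have goal: "?X / r \<le> 6 * exp (c * (t - r)) / (t + 1 / b)"
    if "?X / r * t \<le> 4 * exp (c * (t - r))" "?X / r * (1 / b) \<le> 2 * exp (c * (t - r)) \<or> ?X / r * t \<le> 2 * exp (c * (t - r)) \<and> ?X / r * (1 / b) \<le> 4 * exp (c * (t - r))"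
  proof -
    have "?X / r * (t + 1 / b) \<le> 6 * exp (c * (t - r))"
      using that by (auto simp: distrib_left)
    moreover have "t + 1 / b > 0" using t b by (simp add: add_nonneg_pos)
    ultimately show ?thesis by (simp add: pos_le_divide_eq)
  qed
  show ?thesis
  proof (cases "t \<le> r")
    case True
    have X: "?X = exp_diff a b (r + t) + exp_diff a b (r - t)"
      using True r t exp_diff_bounds(1)[OF c ab(2)] by (simp add: odd_profile_nonneg)
    have e: "exp (- c * (r + t)) \<le> exp (c * (t - r))" "exp (- c * (r - t)) = exp (c * (t - r))"
      using c t by (auto simp: algebra_simps)
    have 1: "?X \<le> 2 * exp (c * (t - r))"
      using exp_diff_bounds(2)[OF c ab(2), of "r + t"] exp_diff_bounds(2)[OF c ab(2), of "r - t"] True r t e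
      unfolding X by linarith
    have 2: "?X \<le> exp (c * (t - r)) * (b * (r + t)) + exp (c * (t - r)) * (b * (r - t))"
    proof -
      have "exp_diff a b (r + t) \<le> exp (c * (t - r)) * (b * (r + t))"
        using r t b by (intro order_trans[OF exp_diff_bounds(3)[OF c ab(2)] mult_right_mono[OF e(1)]]) auto
      then show ?thesis using exp_diff_bounds(3)[OF c ab(2), of "r - t"] True e(2) unfolding X by simp
    qed
    have "?X * t \<le> 2 * exp (c * (t - r)) * r"
      using mult_mono[OF 1 True] t by simp
    then have A: "?X / r * t \<le> 2 * exp (c * (t - r))" using r by (simp add: field_simps)
    have "?X \<le> 2 * exp (c * (t - r)) * (b * r)" using 2 by (simp add: algebra_simps)
    then have B: "?X / r * (1 / b) \<le> 4 * exp (c * (t - r))"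
      using r b by (simp add: field_simps)
    have "?X / r * t \<le> 4 * exp (c * (t - r))" using A exp_ge_zero[of "c * (t - r)"] by linarith
    then show ?thesis using A B by (intro goal) blast+
  next
    case False
    then have rt: "r < t" by simp
    have X: "?X = \<bar>exp_diff a b (t + r) - exp_diff a b (t - r)\<bar>"
      using rt r t by (simp add: odd_profile_nonneg odd_profile_nonpos add.commute)
    \<comment> \<open>Inside the cone the exponential on the right is at least 1, so plain numerical
      bounds suffice.\<close>
    have e: "1 \<le> exp (c * (t - r))" using c rt by simp
    \<comment> \<open>Groups the four exponentials by their decay rate. Both \<open>d a\<close> and
      \<open>d b\<close> are nonnegative, so the absolute value of their difference is at most the
      larger one.\<close>
    define d where "d z = exp (- z * (t - r)) * (1 - exp (- (2 * z * r)))" for z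
    have Xd: "exp_diff a b (t + r) - exp_diff a b (t - r) = d b - d a"
      using rt r by (simp add: exp_diff_def d_def right_diff_distrib exp_add[symmetric] algebra_simps)
    have d0: "0 \<le> d z" "d z \<le> 1" "d z \<le> 2 * z * r" "d z \<le> exp (- z * (t - r)) * (2 * z * r)" if "z \<ge> 0" for z
    proof -
      have f: "0 \<le> 1 - exp (- (2 * z * r))" "1 - exp (- (2 * z * r)) \<le> 2 * z * r" "1 - exp (- (2 * z * r)) \<le> 1"
        using that r exp_ge_add_one_self[of "- (2 * z * r)"] by auto
      have g: "exp (- z * (t - r)) \<le> 1" using that rt by simp
      show "0 \<le> d z" unfolding d_def using f by simp
      show "d z \<le> 1" unfolding d_def using f g by (intro mult_le_one) auto
      show h: "d z \<le> exp (- z * (t - r)) * (2 * z * r)" unfolding d_def using f by (intro mult_left_mono) auto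
      show "d z \<le> 2 * z * r" using h mult_right_mono[OF g, of "2 * z * r"] that r by simp
    qed
    have a0: "a \<ge> 0" and b0: "b \<ge> 0" using ab by auto
    have X1: "?X \<le> 1" using d0(1,2)[OF a0] d0(1,2)[OF b0] unfolding X Xd by linarith
    have ar: "2 * a * r \<le> 2 * b * r" using ab r by simp
    have X2: "?X \<le> 2 * b * r" using d0(1,3)[OF a0] d0(1,3)[OF b0] ar unfolding X Xd by linarith
    \<comment> \<open>Near the cone, r \<ge> t/2, the bound \<open>X1\<close> is enough. Away from
      it t - r \<ge> t/2, and y exp (-y) \<le> 1 with y = z (t - r) trades the rate z for 1/(t -
      r).\<close>
    have X3: "?X * t \<le> 4 * r"
    proof (cases "r \<ge> t / 2")
      case True
      then show ?thesis using mult_right_mono[OF X1 t] r by simp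
    next
      case False
      have dz: "d z * (t - r) \<le> 2 * r" if "z \<ge> 0" for z
      proof -
        have "z * (t - r) * exp (- (z * (t - r))) \<le> 1"
        proof -
          have "y * exp (- y) \<le> 1" for y :: real
          proof -
            have "y \<le> exp y" using exp_ge_add_one_self[of y] by linarith
            from mult_right_mono[OF this, of "exp (- y)"] show ?thesis by (simp add: exp_add[symmetric])
          qed
          then show ?thesis .
        qed
        then have "(z * (t - r) * exp (- (z * (t - r)))) * (2 * r) \<le> 1 * (2 * r)"
          using r by (intro mult_right_mono) auto
        moreover have "d z * (t - r) \<le> exp (- z * (t - r)) * (2 * z * r) * (t - r)"
          using d0(4)[OF that] rt by (intro mult_right_mono) auto
        ultimately show ?thesis by (simp add: mult_ac)
      qed
      have "?X * (t - r) \<le> 2 * r"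
      proof -
        have "?X \<le> max (d a) (d b)" using d0(1)[OF a0] d0(1)[OF b0] unfolding X Xd by linarith
        then have "?X * (t - r) \<le> max (d a) (d b) * (t - r)" using rt by (intro mult_right_mono) auto
        also have "\<dots> \<le> 2 * r" using dz[of a] dz[of b] ab by (simp add: max_def)
        finally show ?thesis .
      qed
      moreover have "?X * (t / 2) \<le> ?X * (t - r)" using False by (intro mult_left_mono) auto
      ultimately show ?thesis by simp
    qed
    have "?X / r * t \<le> 4" "?X / r * (1 / b) \<le> 2"
      using X2 X3 r b by (simp_all add: field_simps)
    then have "?X / r * t \<le> 4 * exp (c * (t - r))" "?X / r * (1 / b) \<le> 2 * exp (c * (t - r))"
      using e by linarith+
    then show ?thesis by (intro goal) blast+
  qed
qed

text \<open>A vanishing slope removes the kink of |s| at the origin; \<open>profile\<close> is of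
  this form.\<close>

lemma DERIV_even_extension_zero:
  fixes g :: "real \<Rightarrow> real"
  assumes "(g has_real_derivative 0) (at 0)"
  shows "((\<lambda>s. g \<bar>s\<bar>) has_real_derivative 0) (at 0)"
proof -
  have lim: "((\<lambda>y. (g y - g 0) / y) \<longlongrightarrow> 0) (at 0)"
    using assms by (simp add: has_field_derivative_iff)
  have abs: "filterlim (\<lambda>y::real. \<bar>y\<bar>) (at 0) (at 0)"
    unfolding filterlim_at by (auto intro!: tendsto_eq_intros simp: eventually_at_filter)
  have "((\<lambda>y. \<bar>(g \<bar>y\<bar> - g 0) / \<bar>y\<bar>\<bar>) \<longlongrightarrow> 0) (at 0)"
    using filterlim_compose[OF lim abs] by (rule tendsto_rabs_zero)
  then have "((\<lambda>y. \<bar>(g \<bar>y\<bar> - g 0) / y\<bar>) \<longlongrightarrow> 0) (at 0)" by (simp add: abs_divide)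
  from tendsto_rabs_zero_cancel[OF this] show ?thesis by (simp add: has_field_derivative_iff)
qed

lemma DERIV_profile:
  assumes "0 < a" "a < b"
  shows "(profile a b has_real_derivative - (b\<^sup>2 / (2 * (b\<^sup>2 - a\<^sup>2)) * odd_profile a b s)) (at s)"
proof -
  define g where "g x = b\<^sup>2 / (2 * (b\<^sup>2 - a\<^sup>2)) * (exp (- a * x) / a - exp (- b * x) / b)" for x
  have g: "(g has_real_derivative - (b\<^sup>2 / (2 * (b\<^sup>2 - a\<^sup>2)) * (exp (- a * x) - exp (- b * x)))) (at x)" for x
  proof -
    have e: "((\<lambda>x. exp (- c * x) / c) has_real_derivative - exp (- c * x)) (at x)" if "c > 0" for c
      using that by (auto intro!: derivative_eq_intros)
    have "b > 0" using assms by simp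
    from DERIV_cmult[OF DERIV_diff[OF e[OF assms(1)] e[OF this]], of "b\<^sup>2 / (2 * (b\<^sup>2 - a\<^sup>2))"]
    show ?thesis unfolding g_def by (simp only: mult_minus_right[symmetric] minus_diff_minus)
  qed
  have p: "profile a b = (\<lambda>s. g \<bar>s\<bar>)" by (auto simp: profile_def g_def)
  consider "s = 0" | "s > 0" | "s < 0" by linarith
  then show ?thesis
  proof cases
    case 1
    then show ?thesis using DERIV_even_extension_zero[of g] g[of 0] by (simp add: p odd_profile_def)
  next
    case 2
    have "(profile a b has_real_derivative - (b\<^sup>2 / (2 * (b\<^sup>2 - a\<^sup>2)) * (exp (- a * s) - exp (- b * s)))) (at s)"
    proof (rule has_field_derivative_transform_within_open[OF g])
      show "open {0::real<..}" "s \<in> {0<..}" using 2 by auto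
    qed (auto simp: p)
    then show ?thesis using 2 by (simp add: odd_profile_nonneg exp_diff_def)
  next
    case 3
    have "((\<lambda>s. g (- s)) has_real_derivative - (b\<^sup>2 / (2 * (b\<^sup>2 - a\<^sup>2)) * (exp (- a * - s) - exp (- b * - s))) * - 1) (at s)"
      by (rule DERIV_chain2[OF g]) (auto intro!: derivative_eq_intros)
    then have "(profile a b has_real_derivative - (b\<^sup>2 / (2 * (b\<^sup>2 - a\<^sup>2)) * (exp (- a * - s) - exp (- b * - s))) * - 1) (at s)"
    proof (rule has_field_derivative_transform_within_open)
      show "open {..<0::real}" "s \<in> {..<0}" using 3 by auto
    qed (auto simp: p)
    moreover have "odd_profile a b s = - (exp (- a * - s) - exp (- b * - s))"
      using 3 by (simp add: odd_profile_nonpos exp_diff_def)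
    ultimately show ?thesis by (simp only: mult_minus_right mult_minus_left minus_minus mult_1_right)
  qed
qed

lemma continuous_odd_profile [continuous_intros]: "continuous_on A (odd_profile a b)"
  unfolding odd_profile_def exp_diff_def by (intro continuous_intros)

lemma measurable_odd_profile [measurable]: "odd_profile a b \<in> borel_measurable borel"
  by (rule borel_measurable_continuous_onI) (rule continuous_odd_profile)

lemma measurable_wave_kernel [measurable]: "wave_kernel a b t \<in> borel_measurable borel"
  unfolding wave_kernel_def[abs_def] by measurable

lemma measurable_profile [measurable]: "profile a b \<in> borel_measurable borel"
  unfolding profile_def[abs_def] by measurable

lemma wave_kernel_bound:
  assumes c: "0 \<le> c" "c \<le> a" and ab: "0 < a" "2 * a \<le> b" and r: "r \<ge> 0" and t: "t \<ge> 0"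
  shows "\<bar>wave_kernel a b t r\<bar> \<le> exp (c * (t - r)) / (t + 1 / b)"
proof (cases "r = 0")
  case True
  then show ?thesis using t ab by (simp add: wave_kernel_def)
next
  case False
  with r have r: "r > 0" by simp
  have b: "b > 0" "a < b" using ab by auto
  have "(2 * a)\<^sup>2 \<le> b\<^sup>2" using ab by (intro power_mono) auto
  then have b2: "4 * a\<^sup>2 \<le> b\<^sup>2" by (simp add: power_mult_distrib)
  have "a\<^sup>2 > 0" using ab by simp
  then have D: "b\<^sup>2 - a\<^sup>2 > 0" using b2 by linarith
  then have k: "0 \<le> b\<^sup>2 / (b\<^sup>2 - a\<^sup>2)" "b\<^sup>2 / (b\<^sup>2 - a\<^sup>2) \<le> 4 / 3"
    using b2 by (simp, simp only: pos_divide_le_eq) simp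
  let ?X = "\<bar>odd_profile a b (r + t) + odd_profile a b (r - t)\<bar>"
  have "\<bar>wave_kernel a b t r\<bar> = b\<^sup>2 / (b\<^sup>2 - a\<^sup>2) / (8 * pi) * (?X / r)"
    using k r D by (simp add: wave_kernel_def abs_mult abs_divide)
  \<comment> \<open>The assumption 2 a \<le> b gives the ratio 4/3, and pi is estimated below by 1.
    The product (4/3) / 8 * 6 equals 1, hence the clean constant in the statement.\<close>
  also have "\<dots> \<le> (4 / 3) / (8 * 1) * (6 * exp (c * (t - r)) / (t + 1 / b))"
  proof (rule mult_mono)
    show "b\<^sup>2 / (b\<^sup>2 - a\<^sup>2) / (8 * pi) \<le> (4 / 3) / (8 * 1)"
      using k pi_ge_two by (rule_tac frac_le) simp_all
    show "?X / r \<le> 6 * exp (c * (t - r)) / (t + 1 / b)"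
      using c ab b r t by (intro odd_profile_sum_bound) auto
  qed (use r in auto)
  also have "\<dots> = exp (c * (t - r)) / (t + 1 / b)" by simp
  finally show ?thesis .
qed

section \<open>Integrability and Fourier transform of the wave kernel\<close>

lemma integrable_exp_minus_norm:
  assumes "c > 0"
  shows "integrable lborel (\<lambda>y::real^3. exp (- c * norm y))"
proof (rule integrableI_bounded)
  have meas: "(\<lambda>y::real^3. exp (- c * norm y)) \<in> borel_measurable borel" by measurable
  then show "(\<lambda>y::real^3. exp (- c * norm y)) \<in> borel_measurable lborel" by simp
  \<comment> \<open>The sum of the absolute coordinates is at most three times the norm, so the
    exponential lies below a product of one-dimensional ones.\<close>
  have le: "exp (- c * norm y) \<le> (\<Prod>b\<in>Basis. exp (- (c / 3) * \<bar>y \<bullet> b\<bar>))" for y :: "real^3"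
  proof -
    have "(\<Sum>b\<in>Basis. \<bar>y \<bullet> b\<bar>) \<le> (\<Sum>b\<in>(Basis :: (real^3) set). norm y)"
      by (intro sum_mono Basis_le_norm)
    then have "(\<Sum>b\<in>Basis. \<bar>y \<bullet> b\<bar>) \<le> 3 * norm y" by simp
    then have "c * (\<Sum>b\<in>Basis. \<bar>y \<bullet> b\<bar>) \<le> c * (3 * norm y)" using assms by (intro mult_left_mono) auto
    then have "- c * norm y \<le> (\<Sum>b\<in>Basis. - (c / 3) * \<bar>y \<bullet> b\<bar>)"
      unfolding sum_distrib_left[symmetric] by simp
    then have "exp (- c * norm y) \<le> exp (\<Sum>b\<in>Basis. - (c / 3) * \<bar>y \<bullet> b\<bar>)" by simp
    then show ?thesis by (simp add: exp_sum)
  qed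
  have "(\<integral>\<^sup>+y. ennreal (norm (exp (- c * norm (y::real^3)))) \<partial>lborel)
    \<le> (\<integral>\<^sup>+y. (\<Prod>b\<in>Basis. ennreal (exp (- (c / 3) * \<bar>(y::real^3) \<bullet> b\<bar>))) \<partial>lborel)"
    using le by (intro nn_integral_mono) (simp add: prod_ennreal ennreal_leI)
  also have "\<dots> = (\<Prod>b\<in>(Basis::(real^3) set). \<integral>\<^sup>+x. ennreal (exp (- (c / 3) * \<bar>x\<bar>)) \<partial>lborel)"
    by (rule nn_integral_lborel_prod) auto
  also have "\<dots> < \<infinity>"
  proof -
    have "(\<integral>\<^sup>+x. ennreal (exp (- (c / 3) * \<bar>x\<bar>)) \<partial>lborel) < \<infinity>"
      using integrable_exp_minus_abs(1)[of "c / 3"] assms by (auto simp: integrable_iff_bounded)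
    then show ?thesis by (simp add: power_eq_top_ennreal flip: less_top)
  qed
  finally show "(\<integral>\<^sup>+y. ennreal (norm (exp (- c * norm (y::real^3)))) \<partial>lborel) < \<infinity>" .
qed

lemma integrable_wave_kernel:
  assumes "0 < a" "2 * a \<le> b" "t \<ge> 0"
  shows "integrable lborel (\<lambda>y::real^3. wave_kernel a b t (norm y))"
proof (rule Bochner_Integration.integrable_bound)
  show "integrable lborel (\<lambda>y::real^3. exp (a * t) / (t + 1 / b) * exp (- a * norm y))"
    by (intro integrable_mult_right integrable_exp_minus_norm assms)
  show "AE y::real^3 in lborel. norm (wave_kernel a b t (norm y)) \<le> norm (exp (a * t) / (t + 1 / b) * exp (- a * norm y))"
  proof (rule AE_I2)
    fix y :: "real^3"
    have "\<bar>wave_kernel a b t (norm y)\<bar> \<le> exp (a * (t - norm y)) / (t + 1 / b)"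
      by (rule wave_kernel_bound) (use assms in auto)
    also have "\<dots> = exp (a * t) / (t + 1 / b) * exp (- a * norm y)"
      by (simp add: exp_add[symmetric] right_diff_distrib)
    finally show "norm (wave_kernel a b t (norm y)) \<le> norm (exp (a * t) / (t + 1 / b) * exp (- a * norm y))"
      unfolding real_norm_def by (rule order_trans[OF _ abs_ge_self])
  qed
qed measurable

lemma fourier_profile:
  assumes ab: "0 < a" "a < b"
  shows "(\<integral>s. of_real (profile a b s) * cis (\<rho> * s) \<partial>lborel) = of_real (b\<^sup>2 / ((a\<^sup>2 + \<rho>\<^sup>2) * (b\<^sup>2 + \<rho>\<^sup>2)))"
    and "integrable lborel (\<lambda>s. of_real (profile a b s) * cis (\<rho> * s))"
proof -
  let ?k = "b\<^sup>2 / (2 * (b\<^sup>2 - a\<^sup>2))"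
  have b: "b > 0" using ab by simp
  have int: "integrable lborel (\<lambda>s. complex_of_real (exp (- c * \<bar>s\<bar>)) * cis (\<rho> * s))" if "c > 0" for c
    by (rule Bochner_Integration.integrable_bound[OF integrable_exp_minus_abs(1)[OF that]]) (auto simp: norm_mult)
  have eq: "complex_of_real (profile a b s) * cis (\<rho> * s) =
     of_real (?k / a) * (of_real (exp (- a * \<bar>s\<bar>)) * cis (\<rho> * s)) - of_real (?k / b) * (of_real (exp (- b * \<bar>s\<bar>)) * cis (\<rho> * s))" for s
  proof -
    have "k * (x / a - y / b) = k / a * x - k / b * y" for k x y by (simp add: right_diff_distrib)
    then show ?thesis unfolding profile_def by (simp only: of_real_diff of_real_mult left_diff_distrib mult.assoc)
  qed
  show "integrable lborel (\<lambda>s. of_real (profile a b s) * cis (\<rho> * s))"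
    unfolding eq by (intro Bochner_Integration.integrable_diff integrable_mult_right int ab b)
  have "(\<integral>s. of_real (profile a b s) * cis (\<rho> * s) \<partial>lborel)
    = of_real (?k / a) * of_real (2 * a / (a\<^sup>2 + \<rho>\<^sup>2)) - of_real (?k / b) * of_real (2 * b / (b\<^sup>2 + \<rho>\<^sup>2))"
    unfolding eq by (subst Bochner_Integration.integral_diff) (intro integrable_mult_right int ab b, intro integrable_mult_right int ab b,
      simp only: integral_mult_right_zero fourier_exp_minus_abs[OF ab(1)] fourier_exp_minus_abs[OF b])
  also have "\<dots> = of_real (?k / a * (2 * a / (a\<^sup>2 + \<rho>\<^sup>2)) - ?k / b * (2 * b / (b\<^sup>2 + \<rho>\<^sup>2)))"
    by simp
  also have "?k / a * (2 * a / (a\<^sup>2 + \<rho>\<^sup>2)) - ?k / b * (2 * b / (b\<^sup>2 + \<rho>\<^sup>2)) = b\<^sup>2 / ((a\<^sup>2 + \<rho>\<^sup>2) * (b\<^sup>2 + \<rho>\<^sup>2))"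
  proof -
    have "a\<^sup>2 < b\<^sup>2" using ab by (intro power_strict_mono) auto
    moreover have "a\<^sup>2 + \<rho>\<^sup>2 > 0" "b\<^sup>2 + \<rho>\<^sup>2 > 0" using ab b by (auto intro: add_pos_nonneg)
    moreover have "?k / a * (2 * a / x) - ?k / b * (2 * b / y) = b\<^sup>2 / (x * y)"
      if "y - x = b\<^sup>2 - a\<^sup>2" "x > 0" "y > 0" "b\<^sup>2 - a\<^sup>2 > 0" for x y
    proof -
      have "\<kappa> / 2 / a * (2 * a / x) - \<kappa> / 2 / b * (2 * b / y) = \<kappa> * (1 / x - 1 / y)" for \<kappa>
        using ab b by (simp add: right_diff_distrib)
      moreover have "?k = b\<^sup>2 / (b\<^sup>2 - a\<^sup>2) / 2" by simp
      ultimately have "?k / a * (2 * a / x) - ?k / b * (2 * b / y) = b\<^sup>2 / (b\<^sup>2 - a\<^sup>2) * (1 / x - 1 / y)"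
        by (simp only:)
      also have "1 / x - 1 / y = (b\<^sup>2 - a\<^sup>2) / (x * y)" using that by (simp add: field_simps)
      finally show ?thesis using that by simp
    qed
    ultimately show ?thesis by simp
  qed
  finally show "(\<integral>s. of_real (profile a b s) * cis (\<rho> * s) \<partial>lborel) = of_real (b\<^sup>2 / ((a\<^sup>2 + \<rho>\<^sup>2) * (b\<^sup>2 + \<rho>\<^sup>2)))" .
qed

text \<open>Through \<open>radial_fourier_integral\<close> only the one-dimensional transform of the
  averaged translates is needed. Each translate multiplies the transform of \<open>profile\<close>
  by a phase, and the two phases average to the cosine.\<close>

theorem fourier_wave_kernel:
  fixes \<xi> :: "real^3"
  assumes a: "0 < a" "2 * a \<le> b" and t: "t \<ge> 0"
  shows "(\<integral>y. of_real (wave_kernel a b t (norm y)) * cis (\<xi> \<bullet> y) \<partial>lborel)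
    = of_real (b\<^sup>2 / ((a\<^sup>2 + (norm \<xi>)\<^sup>2) * (b\<^sup>2 + (norm \<xi>)\<^sup>2)) * cos (t * norm \<xi>))"
proof -
  let ?\<rho> = "norm \<xi>" and ?k = "b\<^sup>2 / (2 * (b\<^sup>2 - a\<^sup>2))"
  have ab: "0 < a" "a < b" "0 < b" using a by auto
  let ?\<Phi> = "\<lambda>s. (profile a b (s + t) + profile a b (s - t)) / 2"
  have "(\<integral>y. of_real (wave_kernel a b t (norm y)) * cis (\<xi> \<bullet> y) \<partial>lborel) = (\<integral>s. of_real (?\<Phi> s) * cis (?\<rho> * s) \<partial>lborel)"
  proof (rule radial_fourier_integral)
    show "integrable lborel (\<lambda>y::real^3. wave_kernel a b t (norm y))"
      by (rule integrable_wave_kernel[OF a t])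
    show "(?\<Phi> has_real_derivative - (2 * pi * r * wave_kernel a b t r)) (at r)" if "r > 0" for r
    proof -
      have "((\<lambda>s. profile a b (s + t)) has_real_derivative - (?k * odd_profile a b (r + t)) * 1) (at r)"
        by (rule DERIV_chain2[OF DERIV_profile[OF ab(1,2)]]) (auto intro!: derivative_eq_intros)
      moreover have "((\<lambda>s. profile a b (s - t)) has_real_derivative - (?k * odd_profile a b (r - t)) * 1) (at r)"
        by (rule DERIV_chain2[OF DERIV_profile[OF ab(1,2)]]) (auto intro!: derivative_eq_intros)
      ultimately have "(?\<Phi> has_real_derivative (- (?k * odd_profile a b (r + t)) * 1 + - (?k * odd_profile a b (r - t)) * 1) / 2) (at r)"
        by (intro DERIV_cdivide DERIV_add)
      moreover have "(- (?k * odd_profile a b (r + t)) * 1 + - (?k * odd_profile a b (r - t)) * 1) / 2 = - (2 * pi * r * wave_kernel a b t r)"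
      proof -
        define \<kappa> where "\<kappa> = b\<^sup>2 / (b\<^sup>2 - a\<^sup>2)"
        have k: "?k = \<kappa> / 2" by (simp add: \<kappa>_def)
        show ?thesis unfolding k wave_kernel_def \<kappa>_def[symmetric] using that by (simp add: field_simps)
      qed
      ultimately show ?thesis by (simp only:)
    qed
    show "isCont (wave_kernel a b t) r" if "r > 0" for r
    proof -
      have "isCont (odd_profile a b) x" for x
        using continuous_odd_profile[of UNIV a b] by (simp add: continuous_on_eq_continuous_at)
      then have "isCont (\<lambda>r. odd_profile a b (r + t)) r" "isCont (\<lambda>r. odd_profile a b (r - t)) r"
        using isCont_o2[where f="\<lambda>r. r + t" and g="odd_profile a b" and a=r] isCont_o2[where f="\<lambda>r. r - t" and g="odd_profile a b" and a=r]
        by simp_all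
      then show ?thesis unfolding wave_kernel_def[abs_def] using that by (intro continuous_intros) auto
    qed
    have lim: "(profile a b \<longlongrightarrow> 0) at_top"
    proof -
      have "((\<lambda>s. ?k * (exp (- a * s) / a - exp (- b * s) / b)) \<longlongrightarrow> 0) at_top"
        using ab by real_asymp
      moreover have "eventually (\<lambda>s. ?k * (exp (- a * s) / a - exp (- b * s) / b) = profile a b s) at_top"
        using eventually_ge_at_top[of 0] by eventually_elim (simp add: profile_def)
      ultimately show ?thesis by (rule Lim_transform_eventually)
    qed
    have "((\<lambda>s. profile a b (s + t)) \<longlongrightarrow> 0) at_top"
      by (rule filterlim_compose[OF lim]) real_asymp
    moreover have "((\<lambda>s. profile a b (s - t)) \<longlongrightarrow> 0) at_top"
      by (rule filterlim_compose[OF lim]) real_asymp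
    ultimately show "(?\<Phi> \<longlongrightarrow> 0) at_top" by (auto intro!: tendsto_eq_intros)
    show "?\<Phi> (- s) = ?\<Phi> s" for s
    proof -
      have "profile a b (- s + t) = profile a b (s - t)" "profile a b (- s - t) = profile a b (s + t)"
        by (simp_all add: profile_def abs_minus_commute) (metis abs_minus_cancel minus_diff_eq diff_minus_eq_add add.commute)+
      then show ?thesis by simp
    qed
  qed measurable
  also have "\<dots> = (\<integral>s. 1 / 2 * (of_real (profile a b (t + 1 * s)) * cis (?\<rho> * s)) + 1 / 2 * (of_real (profile a b (- t + 1 * s)) * cis (?\<rho> * s)) \<partial>lborel)"
    by (intro Bochner_Integration.integral_cong) (auto simp: algebra_simps)
  also have "\<dots> = 1 / 2 * (cis (- ?\<rho> * t) * of_real (b\<^sup>2 / ((a\<^sup>2 + ?\<rho>\<^sup>2) * (b\<^sup>2 + ?\<rho>\<^sup>2)))) +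
      1 / 2 * (cis (- ?\<rho> * - t) * of_real (b\<^sup>2 / ((a\<^sup>2 + ?\<rho>\<^sup>2) * (b\<^sup>2 + ?\<rho>\<^sup>2))))"
  proof -
    \<comment> \<open>The factor 1 in \<open>1 * s\<close> matches the affine change of
      variables.\<close>
    have shift: "(\<integral>s. of_real (profile a b (u + 1 * s)) * cis (?\<rho> * s) \<partial>lborel) = cis (- ?\<rho> * u) * of_real (b\<^sup>2 / ((a\<^sup>2 + ?\<rho>\<^sup>2) * (b\<^sup>2 + ?\<rho>\<^sup>2)))"
      "integrable lborel (\<lambda>s. of_real (profile a b (u + 1 * s)) * cis (?\<rho> * s))" for u
    proof -
      have c: "cis (?\<rho> * s) = cis (- ?\<rho> * u) * cis (?\<rho> * (u + 1 * s))" for s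
        by (simp add: cis_mult algebra_simps)
      have e: "of_real (profile a b (u + 1 * s)) * cis (?\<rho> * s) = cis (- ?\<rho> * u) * (of_real (profile a b (u + 1 * s)) * cis (?\<rho> * (u + 1 * s)))" for s
        by (subst c) simp
      have i: "integrable lborel (\<lambda>s. of_real (profile a b (u + 1 * s)) * cis (?\<rho> * (u + 1 * s)))"
        using lborel_integrable_real_affine[OF fourier_profile(2)[OF ab(1,2), of ?\<rho>], of 1 u] by simp
      show "integrable lborel (\<lambda>s. of_real (profile a b (u + 1 * s)) * cis (?\<rho> * s))"
        unfolding e by (rule integrable_mult_right[OF i])
      have "(\<integral>s. of_real (profile a b (u + 1 * s)) * cis (?\<rho> * (u + 1 * s)) \<partial>lborel) = (\<integral>s. of_real (profile a b s) * cis (?\<rho> * s) \<partial>lborel)"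
        using lborel_integral_real_affine[of 1 "\<lambda>s. of_real (profile a b s) * cis (?\<rho> * s)" u] by simp
      then show "(\<integral>s. of_real (profile a b (u + 1 * s)) * cis (?\<rho> * s) \<partial>lborel) = cis (- ?\<rho> * u) * of_real (b\<^sup>2 / ((a\<^sup>2 + ?\<rho>\<^sup>2) * (b\<^sup>2 + ?\<rho>\<^sup>2)))"
        unfolding e by (simp only: integral_mult_right_zero fourier_profile(1)[OF ab(1,2)])
    qed
    show ?thesis
      by (subst Bochner_Integration.integral_add) (intro integrable_mult_right shift(2), intro integrable_mult_right shift(2),
        simp only: integral_mult_right_zero shift(1))
  qed
  also have "\<dots> = of_real (b\<^sup>2 / ((a\<^sup>2 + ?\<rho>\<^sup>2) * (b\<^sup>2 + ?\<rho>\<^sup>2)) * cos (t * ?\<rho>))"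
    by (simp add: complex_eq_iff mult.commute)
  finally show ?thesis .
qed

section \<open>Transference to the torus\<close>

definition fourier_mode :: "int^3 \<Rightarrow> real^3 \<Rightarrow> complex" where
  "fourier_mode k x = cis (freq k \<bullet> x)"

lemma freq_diff: "freq (k - l) = freq k - freq l"
  and freq_uminus: "freq (- k) = - freq k"
  and freq_zero [simp]: "freq 0 = 0"
  by (simp_all add: freq_def vec_eq_iff)

lemma norm_fourier_mode [simp]: "norm (fourier_mode k x) = 1"
  by (simp add: fourier_mode_def)

lemma fourier_mode_diff: "fourier_mode (k - l) x = fourier_mode k x * cnj (fourier_mode l x)"
  by (simp add: fourier_mode_def freq_diff inner_diff_left cis_cnj cis_mult)

lemma fourier_mode_diff_right: "fourier_mode k (x - y) = fourier_mode k x * cnj (fourier_mode k y)"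
  by (simp add: fourier_mode_def inner_diff_right cis_cnj cis_mult)

lemma measurable_fourier_mode [measurable]: "fourier_mode k \<in> borel_measurable borel"
  unfolding fourier_mode_def[abs_def] by measurable

lemma vec_box_bij: "bij_betw vec_lambda (PiE UNIV A) {k. \<forall>i. k $ i \<in> A i}"
  by (rule bij_betwI[where g=vec_nth]) auto

lemma finite_vec_box:
  fixes A :: "'n::finite \<Rightarrow> 'a set"
  assumes "\<And>i. finite (A i)"
  shows "finite {k. \<forall>i. k $ i \<in> A i}"
proof -
  have "finite (PiE (UNIV :: 'n set) A)" using assms by (intro finite_PiE) auto
  then show ?thesis using bij_betw_finite[OF vec_box_bij[of A]] by simp
qed

lemma sum_vec_box:
  fixes g :: "'n::finite \<Rightarrow> 'a \<Rightarrow> real"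
  assumes "\<And>i. finite (A i)"
  shows "(\<Sum>k | \<forall>i. k $ i \<in> A i. \<Prod>i\<in>UNIV. g i (k $ i)) = (\<Prod>i\<in>UNIV. \<Sum>j\<in>A i. g i j)"
proof -
  have "(\<Prod>i\<in>UNIV. \<Sum>j\<in>A i. g i j) = (\<Sum>h\<in>PiE UNIV A. \<Prod>i\<in>UNIV. g i (h i))"
    using assms by (intro prod_sum_PiE) auto
  also have "\<dots> = (\<Sum>h\<in>PiE UNIV A. \<Prod>i\<in>UNIV. g i (vec_lambda h $ i))" by simp
  also have "\<dots> = (\<Sum>k | \<forall>i. k $ i \<in> A i. \<Prod>i\<in>UNIV. g i (k $ i))"
    by (rule sum.reindex_bij_betw[OF vec_box_bij])
  finally show ?thesis by simp
qed

lemma card_vec_box: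
  fixes A :: "'n::finite \<Rightarrow> 'a set"
  assumes "\<And>i. finite (A i)"
  shows "real (card {k. \<forall>i. k $ i \<in> A i}) = (\<Prod>i\<in>UNIV. real (card (A i)))"
  using sum_vec_box[where A=A and g="\<lambda>_ _. 1"] assms by simp

section \<open>Cubes of frequencies and Fejer weights\<close>

definition freq_box :: "nat \<Rightarrow> (int^3) set" where
  "freq_box n = {k. \<forall>i. k $ i \<in> {- int n..int n}}"

lemma finite_freq_box [simp]: "finite (freq_box n)"
  unfolding freq_box_def by (rule finite_vec_box) simp

lemma card_freq_box: "real (card (freq_box n)) = (2 * real n + 1) ^ 3"
  unfolding freq_box_def by (subst card_vec_box) simp_all

text \<open>The autocorrelation of the indicator of the cube, normalised to 1 at d = 0. As
  coefficients of a trigonometric polynomial these weights give the squared modulus of the sum of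
  the modes in the cube.\<close>

definition fejer_weight :: "nat \<Rightarrow> int^3 \<Rightarrow> real" where
  "fejer_weight n d = real (card {l \<in> freq_box n. l + d \<in> freq_box n}) / real (card (freq_box n))"

lemma fejer_weight_nonneg: "fejer_weight n d \<ge> 0"
  by (simp add: fejer_weight_def)

lemma fejer_weight_le_1: "fejer_weight n d \<le> 1"
proof -
  have "card {l \<in> freq_box n. l + d \<in> freq_box n} \<le> card (freq_box n)"
    by (intro card_mono) auto
  moreover have "real (card (freq_box n)) > 0" unfolding card_freq_box by simp
  ultimately show ?thesis unfolding fejer_weight_def by (simp only: divide_le_eq_1) simp
qed

text \<open>In each coordinate the half {-n..0} or {0..n} is shifted by d into {-n..n}, according to
  the sign. This gives (n + 1)^3 admissible points out of fewer than (2 (n + 1))^3.\<close>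

lemma fejer_weight_ge:
  assumes "d \<in> freq_box n"
  shows "fejer_weight n d \<ge> 1 / 8"
proof -
  let ?A = "\<lambda>i. if d $ i \<ge> 0 then {- int n..0} else {0..int n}"
  have sub: "{l. \<forall>i. l $ i \<in> ?A i} \<subseteq> {l \<in> freq_box n. l + d \<in> freq_box n}"
  proof
    fix l assume l: "l \<in> {l. \<forall>i. l $ i \<in> ?A i}"
    have "l $ i \<in> {- int n..int n} \<and> l $ i + d $ i \<in> {- int n..int n}" for i
    proof -
      have "d $ i \<in> {- int n..int n}" "l $ i \<in> ?A i" using assms l by (auto simp: freq_box_def)
      then show ?thesis by (auto split: if_splits)
    qed
    then show "l \<in> {l \<in> freq_box n. l + d \<in> freq_box n}" by (simp add: freq_box_def)
  qed
  have "(real n + 1) ^ 3 = (\<Prod>i\<in>(UNIV::3 set). real (card (?A i)))"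
    by (subst prod.cong[where h="\<lambda>_. real n + 1", OF refl]) auto
  also have "\<dots> = real (card {l. \<forall>i. l $ i \<in> ?A i})"
    by (rule card_vec_box[symmetric]) auto
  also have "\<dots> \<le> real (card {l \<in> freq_box n. l + d \<in> freq_box n})"
    by (intro of_nat_mono card_mono sub) auto
  finally have 1: "(real n + 1) ^ 3 \<le> real (card {l \<in> freq_box n. l + d \<in> freq_box n})" .
  have "real (card (freq_box n)) \<le> (2 * (real n + 1)) ^ 3"
    unfolding card_freq_box by (intro power_mono) auto
  also have "\<dots> = 8 * (real n + 1) ^ 3" by (simp only: power_mult_distrib) simp
  finally have "real (card (freq_box n)) \<le> 8 * real (card {l \<in> freq_box n. l + d \<in> freq_box n})"
    using 1 by linarith
  moreover have "real (card (freq_box n)) > 0" unfolding card_freq_box by simp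
  ultimately show ?thesis unfolding fejer_weight_def by (simp only: pos_le_divide_eq)
qed

text \<open>The Fejer kernel is nonnegative, which is all that is needed of it.\<close>

lemma fejer_kernel:
  "(\<Sum>d\<in>freq_box (2 * n). of_real (fejer_weight n d) * fourier_mode d x)
    = of_real ((norm (\<Sum>k\<in>freq_box n. fourier_mode k x))\<^sup>2 / real (card (freq_box n)))"
proof -
  let ?Q = "freq_box n" and ?D = "freq_box (2 * n)"
  have c: "card {p \<in> ?Q \<times> ?Q. fst p - snd p = d} = card {l \<in> ?Q. l + d \<in> ?Q}" for d
    by (rule bij_betw_same_card[where f=snd], rule bij_betwI[where g="\<lambda>l. (l + d, l)"]) auto
  have "(\<Sum>p\<in>?Q \<times> ?Q. fourier_mode (fst p - snd p) x)
    = (\<Sum>d\<in>?D. \<Sum>p\<in>{p \<in> ?Q \<times> ?Q. fst p - snd p = d}. fourier_mode (fst p - snd p) x)"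
  proof (rule sum.group[symmetric])
    show "(\<lambda>p. fst p - snd p) ` (?Q \<times> ?Q) \<subseteq> ?D"
    proof clarify
      fix k l assume "k \<in> ?Q" "l \<in> ?Q"
      then have "k $ i \<in> {- int n..int n}" "l $ i \<in> {- int n..int n}" for i
        unfolding freq_box_def by blast+
      have "k $ i - l $ i \<in> {- int (2 * n)..int (2 * n)}" for i
        using \<open>\<And>i. k $ i \<in> {- int n..int n}\<close>[of i] \<open>\<And>i. l $ i \<in> {- int n..int n}\<close>[of i] unfolding atLeastAtMost_iff by linarith
      then show "fst (k, l) - snd (k, l) \<in> ?D" by (simp add: freq_box_def)
    qed
  qed auto
  also have "\<dots> = (\<Sum>d\<in>?D. of_nat (card {l \<in> ?Q. l + d \<in> ?Q}) * fourier_mode d x)"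
    by (intro sum.cong refl) (simp add: c[symmetric])
  finally have A: "(\<Sum>p\<in>?Q \<times> ?Q. fourier_mode (fst p - snd p) x)
    = (\<Sum>d\<in>?D. of_nat (card {l \<in> ?Q. l + d \<in> ?Q}) * fourier_mode d x)" .
  have "of_real ((norm (\<Sum>k\<in>?Q. fourier_mode k x))\<^sup>2) = (\<Sum>k\<in>?Q. fourier_mode k x) * cnj (\<Sum>l\<in>?Q. fourier_mode l x)"
    by (rule complex_norm_square)
  also have "\<dots> = (\<Sum>p\<in>?Q \<times> ?Q. fourier_mode (fst p - snd p) x)"
    by (simp add: sum_product sum.cartesian_product fourier_mode_diff case_prod_beta)
  finally show ?thesis unfolding A fejer_weight_def
    by (simp add: sum_divide_distrib)
qed

text \<open>Since 2 = 3 * (2/3) and 1 + |d|^2 dominates 1 + d_i^2 for each i, the summand is at most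
  a product over the three coordinates. Each one-dimensional factor decays with exponent 4/3 >
  1.\<close>

lemma sum_freq_box_bounded:
  "\<exists>S. \<forall>n. (\<Sum>d\<in>freq_box n. 1 / (1 + (norm (freq d))\<^sup>2)\<^sup>2) \<le> S"
proof -
  let ?g = "\<lambda>j::nat. real j powr (- 4 / 3)"
  have sum: "summable ?g" by (subst summable_real_powr_iff) simp
  let ?s = "1 + 2 * suminf ?g"
  have one: "(\<Sum>j\<in>{- int n..int n}. (1 + (real_of_int j)\<^sup>2) powr (- 2 / 3)) \<le> ?s" for n
  proof -
    have "(\<Sum>j\<in>{- int n..int n}. (1 + (real_of_int j)\<^sup>2) powr (- 2 / 3))
      = 1 + (\<Sum>j\<in>{- int n..int n} - {0}. (1 + (real_of_int j)\<^sup>2) powr (- 2 / 3))"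
      by (subst sum.remove[where x=0]) auto
    also have "(\<Sum>j\<in>{- int n..int n} - {0}. (1 + (real_of_int j)\<^sup>2) powr (- 2 / 3)) \<le> (\<Sum>j\<in>{- int n..int n} - {0}. ?g (nat \<bar>0 - j\<bar>))"
    proof (rule sum_mono)
      fix j assume j: "j \<in> {- int n..int n} - {0}"
      have "(1 + (real_of_int j)\<^sup>2) powr (- 2 / 3) \<le> ((real_of_int j)\<^sup>2) powr (- 2 / 3)"
        using j by (intro powr_mono2') auto
      also have "\<dots> = (\<bar>real_of_int j\<bar> powr 2) powr (- 2 / 3)" using j by simp
      also have "(\<bar>real_of_int j\<bar> powr 2) powr (- 2 / 3) = ?g (nat \<bar>0 - j\<bar>)"
        unfolding powr_powr by simp
      finally show "(1 + (real_of_int j)\<^sup>2) powr (- 2 / 3) \<le> ?g (nat \<bar>0 - j\<bar>)" .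
    qed
    also have "\<dots> \<le> 2 * (\<Sum>j\<in>{..n}. ?g j)"
      by (rule sum_int_distance_le[where g="?g"]) auto
    also have "\<dots> \<le> 2 * suminf ?g"
      using sum_le_suminf[OF sum, of "{..n}"] by simp
    finally show ?thesis by simp
  qed
  have "(\<Sum>d\<in>freq_box n. 1 / (1 + (norm (freq d))\<^sup>2)\<^sup>2) \<le> ?s ^ 3" for n
  proof -
    have "(\<Sum>d\<in>freq_box n. 1 / (1 + (norm (freq d))\<^sup>2)\<^sup>2)
      \<le> (\<Sum>d\<in>freq_box n. \<Prod>i\<in>UNIV. (1 + (real_of_int (d $ i))\<^sup>2) powr (- 2 / 3))"
    proof (rule sum_mono)
      fix d :: "int^3"
      let ?N = "1 + (norm (freq d))\<^sup>2"
      have N: "(norm (freq d))\<^sup>2 = (\<Sum>i\<in>UNIV. (real_of_int (d $ i))\<^sup>2)"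
        by (simp add: norm_vec_def L2_set_def freq_def sum_nonneg)
      have "(\<Prod>i\<in>(UNIV::3 set). ?N powr (- 2 / 3)) \<le> (\<Prod>i\<in>UNIV. (1 + (real_of_int (d $ i))\<^sup>2) powr (- 2 / 3))"
      proof (rule prod_mono)
        fix i :: 3
        have "(real_of_int (d $ i))\<^sup>2 \<le> (norm (freq d))\<^sup>2"
          unfolding N by (rule member_le_sum) auto
        then have "?N powr (- 2 / 3) \<le> (1 + (real_of_int (d $ i))\<^sup>2) powr (- 2 / 3)"
          by (intro powr_mono2') (auto intro: add_pos_nonneg)
        then show "0 \<le> ?N powr (- 2 / 3) \<and> ?N powr (- 2 / 3) \<le> (1 + (real_of_int (d $ i))\<^sup>2) powr (- 2 / 3)" by simp
      qed
      moreover have "(\<Prod>i\<in>(UNIV::3 set). ?N powr (- 2 / 3)) = 1 / ?N\<^sup>2"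
      proof -
        have "?N > 0" by (intro add_pos_nonneg) auto
        then have "(?N powr (- 2 / 3)) ^ 3 = ?N powr (- 2)" by (simp add: powr_power)
        also have "\<dots> = 1 / ?N\<^sup>2" using \<open>?N > 0\<close> by (simp add: powr_minus divide_inverse)
        finally show ?thesis by simp
      qed
      ultimately show "1 / ?N\<^sup>2 \<le> (\<Prod>i\<in>UNIV. (1 + (real_of_int (d $ i))\<^sup>2) powr (- 2 / 3))" by simp
    qed
    also have "\<dots> = (\<Prod>i\<in>(UNIV::3 set). \<Sum>j\<in>{- int n..int n}. (1 + (real_of_int j)\<^sup>2) powr (- 2 / 3))"
      unfolding freq_box_def by (rule sum_vec_box) simp
    also have "\<dots> \<le> ?s ^ 3"
      using one by (simp add: power_mono sum_nonneg)
    finally show ?thesis .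
  qed
  then show ?thesis by blast
qed

text \<open>A multiplier comparable to |d|^(-2) for frequencies between a and b and to b^2 |d|^(-4)
  above b.\<close>

definition wave_symbol :: "real \<Rightarrow> real \<Rightarrow> int^3 \<Rightarrow> real" where
  "wave_symbol a b d = b\<^sup>2 / ((a\<^sup>2 + (norm (freq d))\<^sup>2) * (b\<^sup>2 + (norm (freq d))\<^sup>2))"

lemma wave_symbol_nonneg: "wave_symbol a b d \<ge> 0"
  by (simp add: wave_symbol_def)

text \<open>Integrating a kernel on the whole of three-space against a translated mode returns the
  mode times the Fourier integral of the kernel at that frequency. A convolution with the Fejer
  polynomial therefore realises the multiplier on the torus.\<close>

lemma fejer_wave_kernel_integral:
  fixes n :: nat
  assumes a: "0 < a" "2 * a \<le> b" and t: "t \<ge> 0"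
    and F_def: "F = (\<lambda>x. (norm (\<Sum>k\<in>freq_box n. fourier_mode k x))\<^sup>2 / real (card (freq_box n)))"
  shows "integrable lborel (\<lambda>y. wave_kernel a b t (norm y) * F (x - y))"
    and "(\<Sum>d\<in>freq_box (2 * n). of_real (fejer_weight n d * wave_symbol a b d * cos (t * norm (freq d))) * fourier_mode d x)
      = of_real (\<integral>y. wave_kernel a b t (norm y) * F (x - y) \<partial>lborel)"
proof -
  let ?w = "\<lambda>y::real^3. wave_kernel a b t (norm y)"
  have iw: "integrable lborel ?w" by (rule integrable_wave_kernel[OF a t])
  have i1: "integrable lborel (\<lambda>y. of_real (?w y) * cis (- freq d \<bullet> y))" for d
    by (rule Bochner_Integration.integrable_bound[OF iw]) (auto simp: norm_mult)
  have Fc: "complex_of_real (?w y * F (x - y)) = (\<Sum>d\<in>freq_box (2 * n). of_real (fejer_weight n d) * fourier_mode d x * (of_real (?w y) * cis (- freq d \<bullet> y)))" for y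
  proof -
    have "complex_of_real (F (x - y)) = (\<Sum>d\<in>freq_box (2 * n). of_real (fejer_weight n d) * fourier_mode d (x - y))"
      unfolding F_def by (rule fejer_kernel[symmetric])
    moreover have "fourier_mode d (x - y) = fourier_mode d x * cis (- freq d \<bullet> y)" for d
      by (simp add: fourier_mode_diff_right) (simp add: fourier_mode_def cis_cnj)
    ultimately show ?thesis by (simp add: sum_distrib_left mult_ac)
  qed
  have ic: "integrable lborel (\<lambda>y. complex_of_real (?w y * F (x - y)))"
    unfolding Fc by (intro Bochner_Integration.integrable_sum integrable_mult_right i1)
  then show i: "integrable lborel (\<lambda>y. ?w y * F (x - y))"
    using integrable_Re by force
  have "complex_of_real (\<integral>y. ?w y * F (x - y) \<partial>lborel) = (\<integral>y. complex_of_real (?w y * F (x - y)) \<partial>lborel)"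
    by (rule integral_complex_of_real[symmetric])
  also have "\<dots> = (\<Sum>d\<in>freq_box (2 * n). of_real (fejer_weight n d) * fourier_mode d x * (\<integral>y. of_real (?w y) * cis (- freq d \<bullet> y) \<partial>lborel))"
    unfolding Fc by (subst Bochner_Integration.integral_sum) (intro integrable_mult_right i1, simp)
  also have "\<dots> = (\<Sum>d\<in>freq_box (2 * n). of_real (fejer_weight n d * wave_symbol a b d * cos (t * norm (freq d))) * fourier_mode d x)"
    unfolding fourier_wave_kernel[OF a t] by (simp add: wave_symbol_def mult_ac)
  finally show "(\<Sum>d\<in>freq_box (2 * n). of_real (fejer_weight n d * wave_symbol a b d * cos (t * norm (freq d))) * fourier_mode d x)
      = of_real (\<integral>y. ?w y * F (x - y) \<partial>lborel)" by simp
qed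

text \<open>
  The wave kernel at time \<open>t\<close> is dominated by the kernel with parameters \<open>1/2, 1\<close> at time \<open>0\<close>,
  whose Fourier coefficients are summable. This replaces the periodization of the kernel.
\<close>

theorem dispersive_estimate:
  assumes "T \<ge> 0"
  shows "\<exists>C>0. \<forall>n a b t x. 1 \<le> a \<longrightarrow> 2 * a \<le> b \<longrightarrow> 0 \<le> t \<longrightarrow> t \<le> T \<longrightarrow>
    norm (\<Sum>d\<in>freq_box (2 * n). of_real (fejer_weight n d * wave_symbol a b d * cos (t * norm (freq d))) * fourier_mode d x)
      \<le> C / (t + 1 / b)"
proof -
  obtain S where S: "\<And>n. (\<Sum>d\<in>freq_box n. 1 / (1 + (norm (freq d))\<^sup>2)\<^sup>2) \<le> S"
    using sum_freq_box_bounded by blast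
  have S0: "S \<ge> 0" by (rule order_trans[OF _ S[of 0]]) (auto intro!: sum_nonneg)
  let ?h = "wave_kernel (1/2) 1 0"
  \<comment> \<open>The comparison kernel is (exp (-r/2) - exp (-r)) / (3 pi r), and exp (r/2) - 1
    \<ge> r/2 bounds it from below.\<close>
  have h: "exp (- r) \<le> 6 * pi * ?h r" if "r > 0" for r
  proof -
    have "exp (- r) * (r / 2) \<le> exp (- r) * (exp (r / 2) - 1)"
      using exp_ge_add_one_self[of "r / 2"] by (intro mult_left_mono) (linarith, simp)
    also have "\<dots> = odd_profile (1/2) 1 r"
      using that by (simp add: odd_profile_nonneg exp_diff_def right_diff_distrib exp_add[symmetric])
    finally have o: "exp (- r) * (r / 2) \<le> odd_profile (1/2) 1 r" .
    have "6 * pi * ?h r = 2 / r * odd_profile (1/2) 1 r"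
      using that by (simp add: wave_kernel_def power2_eq_square)
    moreover have "2 / r * (exp (- r) * (r / 2)) \<le> 2 / r * odd_profile (1/2) 1 r"
      using that o by (intro mult_left_mono) auto
    ultimately show ?thesis using that by simp
  qed
  \<comment> \<open>The factor exp T comes from exp (t - r), the factor 6 pi from the comparison
    with \<open>?h\<close>, and 4 S from its Fourier series. The added 1 makes the constant
    positive.\<close>
  let ?C = "exp T * (6 * pi) * (4 * S) + 1"
  have "norm (\<Sum>d\<in>freq_box (2 * n). of_real (fejer_weight n d * wave_symbol a b d * cos (t * norm (freq d))) * fourier_mode d x) \<le> ?C / (t + 1 / b)"
    if a: "1 \<le> a" "2 * a \<le> b" and t: "0 \<le> t" "t \<le> T" for n a b t x
  proof -
    have a': "0 < a" using a by simp
    have tb: "t + 1 / b > 0" using a t by (intro add_nonneg_pos) auto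
    define F where "F = (\<lambda>x. (norm (\<Sum>k\<in>freq_box n. fourier_mode k x))\<^sup>2 / real (card (freq_box n)))"
    have F0: "F x \<ge> 0" for x by (simp add: F_def)
    note I = fejer_wave_kernel_integral[OF a' a(2) t(1) F_def, of x]
    have "0 < (1/2::real)" "2 * (1/2::real) \<le> 1" "(0::real) \<le> 0" by auto
    note J = fejer_wave_kernel_integral[OF this F_def, of x]
    let ?K = "exp T / (t + 1 / b) * (6 * pi)"
    have "norm (\<Sum>d\<in>freq_box (2 * n). of_real (fejer_weight n d * wave_symbol a b d * cos (t * norm (freq d))) * fourier_mode d x)
      = \<bar>\<integral>y. wave_kernel a b t (norm y) * F (x - y) \<partial>lborel\<bar>"
      unfolding I(2) by simp
    also have "\<dots> \<le> (\<integral>y. \<bar>wave_kernel a b t (norm y) * F (x - y)\<bar> \<partial>lborel)"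
      by (rule integral_abs_bound)
    also have "\<dots> \<le> (\<integral>y. ?K * (?h (norm y) * F (x - y)) \<partial>lborel)"
    proof (rule integral_mono_AE)
      show "integrable lborel (\<lambda>y. \<bar>wave_kernel a b t (norm y) * F (x - y)\<bar>)" using I(1) by (rule integrable_abs)
      show "integrable lborel (\<lambda>y. ?K * (?h (norm y) * F (x - y)))" using J(1) by (rule integrable_mult_right)
      show "AE y in lborel. \<bar>wave_kernel a b t (norm y) * F (x - y)\<bar> \<le> ?K * (?h (norm y) * F (x - y))"
        using AE_lborel_singleton[of "0::real^3"]
      proof eventually_elim
        case (elim y)
        then have y: "norm y > 0" by simp
        \<comment> \<open>The rate c = 1 is available because a \<ge> 1, and it makes the bound
          independent of a.\<close>
        have "\<bar>wave_kernel a b t (norm y)\<bar> \<le> exp (1 * (t - norm y)) / (t + 1 / b)"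
          by (rule wave_kernel_bound) (use a t in auto)
        also have "\<dots> \<le> exp (T + - norm y) / (t + 1 / b)"
          using t tb by (intro divide_right_mono) auto
        also have "\<dots> = exp T / (t + 1 / b) * exp (- norm y)" by (simp only: exp_add) simp
        also have "\<dots> \<le> exp T / (t + 1 / b) * (6 * pi * ?h (norm y))"
          using tb by (intro mult_left_mono h y) auto
        finally have "\<bar>wave_kernel a b t (norm y)\<bar> \<le> ?K * ?h (norm y)" by simp
        \<comment> \<open>Positivity of the Fejer kernel lets the pointwise domination of the
          kernels pass to the convolutions.\<close>
        then have "\<bar>wave_kernel a b t (norm y)\<bar> * F (x - y) \<le> ?K * ?h (norm y) * F (x - y)"
          using F0 by (rule mult_right_mono)
        then show ?case using F0[of "x - y"] by (simp add: abs_mult mult_ac)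
      qed
    qed
    also have "\<dots> = ?K * (\<integral>y. ?h (norm y) * F (x - y) \<partial>lborel)" by simp
    also have "?K * (\<integral>y. ?h (norm y) * F (x - y) \<partial>lborel) \<le> ?K * (4 * S)"
    proof (rule mult_left_mono)
      have "(\<integral>y. ?h (norm y) * F (x - y) \<partial>lborel) \<le> norm (complex_of_real (\<integral>y. ?h (norm y) * F (x - y) \<partial>lborel))"
        by simp
      also have "\<dots> \<le> (\<Sum>d\<in>freq_box (2 * n). norm (complex_of_real (fejer_weight n d * wave_symbol (1/2) 1 d * cos (0 * norm (freq d))) * fourier_mode d x))"
        unfolding J(2)[symmetric] by (rule norm_sum)
      also have "\<dots> \<le> (\<Sum>d\<in>freq_box (2 * n). 4 * (1 / (1 + (norm (freq d))\<^sup>2)\<^sup>2))"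
      proof (rule sum_mono)
        fix d :: "int^3"
        let ?r = "(norm (freq d))\<^sup>2"
        have "fejer_weight n d * wave_symbol (1/2) 1 d \<le> 1 * wave_symbol (1/2) 1 d"
          by (intro mult_right_mono fejer_weight_le_1 wave_symbol_nonneg)
        also have "\<dots> \<le> 4 * (1 / (1 + ?r)\<^sup>2)"
        proof -
          have "1 / ((1/4 + r) * (1 + r)) \<le> 1 / (((1 + r) / 4) * (1 + r))" if "r \<ge> 0" for r :: real
            using that by (intro divide_left_mono mult_right_mono mult_pos_pos) auto
          from this[of ?r] have "1 / ((1/4 + ?r) * (1 + ?r)) \<le> 4 / ((1 + ?r) * (1 + ?r))" by simp
          then show ?thesis by (simp add: wave_symbol_def power2_eq_square[of "1 + ?r"] power2_eq_square[of "1/2"])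
        qed
        finally show "norm (complex_of_real (fejer_weight n d * wave_symbol (1/2) 1 d * cos (0 * norm (freq d))) * fourier_mode d x) \<le> 4 * (1 / (1 + ?r)\<^sup>2)"
          using fejer_weight_nonneg[of n d] wave_symbol_nonneg[of "1/2" 1 d] by (simp add: norm_mult)
      qed
      also have "\<dots> \<le> 4 * S" unfolding sum_distrib_left[symmetric] using S by (intro mult_left_mono) auto
      finally show "(\<integral>y. ?h (norm y) * F (x - y) \<partial>lborel) \<le> 4 * S" .
    qed (use tb in simp)
    also have "?K * (4 * S) = exp T * (6 * pi) * (4 * S) / (t + 1 / b)" by simp
    also have "\<dots> \<le> ?C / (t + 1 / b)" using tb by (intro divide_right_mono) auto
    finally show ?thesis .
  qed
  moreover have "?C > 0" using S0 by (intro add_nonneg_pos) auto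
  ultimately show ?thesis by blast
qed

section \<open>Trigonometric polynomials on the torus\<close>

lemma borel_measurable_cnj [measurable]: "cnj \<in> borel_measurable borel"
  by (intro borel_measurable_continuous_onI continuous_intros)

lemma space_torus: "space torus = cbox (\<chi> i. - pi) (\<chi> i. pi)"
  by (simp add: torus_def)

lemma measurable_torus [measurable (raw)]:
  fixes f :: "real^3 \<Rightarrow> 'b::topological_space"
  assumes "f \<in> borel_measurable borel"
  shows "f \<in> borel_measurable torus"
proof -
  have "f \<in> borel_measurable lebesgue" using assms by (simp add: measurable_completion)
  then show ?thesis unfolding torus_def by (rule measurable_restrict_space1)
qed

lemma finite_measure_torus: "finite_measure torus"
proof (rule finite_measureI)
  show "emeasure torus (space torus) \<noteq> \<infinity>"
    unfolding torus_def by (simp add: emeasure_restrict_space emeasure_lborel_cbox_eq)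
qed

interpretation torus: finite_measure torus by (rule finite_measure_torus)

lemma integral_torus:
  fixes f :: "real^3 \<Rightarrow> complex"
  assumes [measurable]: "f \<in> borel_measurable borel"
  shows "(\<integral>x. f x \<partial>torus) = (\<integral>x. indicator (cbox (\<chi> i. - pi) (\<chi> i. pi)) x *\<^sub>R f x \<partial>lborel)"
proof -
  have "(\<integral>x. f x \<partial>torus) = (\<integral>x. indicator (cbox (\<chi> i. - pi) (\<chi> i. pi)) x *\<^sub>R f x \<partial>lebesgue)"
    unfolding torus_def by (subst integral_restrict_space) auto
  also have "\<dots> = (\<integral>x. indicator (cbox (\<chi> i. - pi) (\<chi> i. pi)) x *\<^sub>R f x \<partial>lborel)"
    by (rule integral_completion) measurable
  finally show ?thesis .
qed

lemma integral_cis_int: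
  fixes m :: int
  shows "(\<integral>s. indicator {- pi..pi} s *\<^sub>R cis (of_int m * s) \<partial>lborel) = (if m = 0 then 2 * pi else 0)"
proof (cases "m = 0")
  case True
  then show ?thesis by (simp add: complex_eq_iff)
next
  case False
  have "(\<integral>s. indicator {- pi..pi} s *\<^sub>R cis (of_int m * s) \<partial>lborel)
    = cis (of_int m * pi) / (\<i> * of_int m) - cis (of_int m * (- pi)) / (\<i> * of_int m)"
  proof (rule integral_FTC_atLeastAtMost[where F="\<lambda>s. cis (of_int m * s) / (\<i> * of_int m)"])
    fix x :: real
    have "((\<lambda>z. exp (\<i> * of_int m * z) / (\<i> * of_int m)) has_field_derivative exp (\<i> * of_int m * of_real x)) (at (of_real x))"
      using False by (auto intro!: derivative_eq_intros)
    then have "((\<lambda>s. exp (\<i> * of_int m * of_real s) / (\<i> * of_int m)) has_vector_derivative exp (\<i> * of_int m * of_real x)) (at x within {- pi..pi})"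
      by (rule has_vector_derivative_real_field)
    then show "((\<lambda>s. cis (of_int m * s) / (\<i> * of_int m)) has_vector_derivative cis (of_int m * x)) (at x within {- pi..pi})"
      by (simp add: cis_conv_exp mult.assoc)
  qed (auto intro!: continuous_intros)
  also have "cis (of_int m * pi) = cis (of_int m * (- pi))"
    using sin_npi_int[of m] by (simp add: complex_eq_iff mult.commute)
  also have "cis (of_int m * (- pi)) / (\<i> * of_int m) - cis (of_int m * (- pi)) / (\<i> * of_int m) = 0" by simp
  finally show ?thesis using False by simp
qed

lemma integral_torus_fourier_mode:
  "(\<integral>x. fourier_mode k x \<partial>torus) = (if k = 0 then of_real ((2 * pi) ^ 3) else 0)"
proof -
  let ?B = "Basis :: (real^3) set"
  interpret P: product_sigma_finite "\<lambda>_::real^3. lborel :: real measure"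
    by unfold_locales
  \<comment> \<open>\<open>Basis\<close> is a set of vectors while k is indexed by 3;
    \<open>m b\<close> is the coordinate of k that belongs to the basis vector b.\<close>
  define m where "m b = (THE j. \<exists>i. b = axis i 1 \<and> j = k $ i)" for b :: "real^3"
  have m: "m (axis i 1) = k $ i" for i :: 3
    unfolding m_def by (rule the_equality) (auto simp: axis_eq_axis)
  have fm: "freq k \<bullet> b = of_int (m b)" if "b \<in> ?B" for b
    using that m by (auto simp: Basis_vec_def inner_axis freq_def)
  let ?g = "\<lambda>b s. indicator {- pi..pi} s *\<^sub>R cis (of_int (m b) * s)"
  have int: "integrable lborel (?g b)" for b
    by (rule integrableI_bounded_set[where A="{- pi..pi}" and B=1]) (auto simp: norm_mult indicator_def)
  have prod: "indicator (cbox (\<chi> i. - pi) (\<chi> i. pi)) x *\<^sub>R fourier_mode k x = (\<Prod>b\<in>?B. ?g b (x \<bullet> b))" for x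
  proof -
    have "fourier_mode k x = (\<Prod>b\<in>?B. cis (of_int (m b) * (x \<bullet> b)))"
    proof -
      have "freq k \<bullet> x = (\<Sum>b\<in>?B. of_int (m b) * (x \<bullet> b))"
        by (subst euclidean_inner) (auto intro!: sum.cong simp: fm)
      then show ?thesis unfolding fourier_mode_def by (simp add: cis_conv_exp sum_distrib_left exp_sum)
    qed
    moreover have "x \<in> cbox (\<chi> i. - pi) (\<chi> i. pi) \<longleftrightarrow> (\<forall>b\<in>?B. x \<bullet> b \<in> {- pi..pi})"
      by (auto simp: mem_box Basis_vec_def inner_axis)
    ultimately show ?thesis
      by (cases "x \<in> cbox (\<chi> i. - pi) (\<chi> i. pi)") (auto simp: indicator_def intro!: prod_zero[symmetric])
  qed
  have "(\<integral>x. fourier_mode k x \<partial>torus) = (\<integral>x. (\<Prod>b\<in>?B. ?g b (x \<bullet> b)) \<partial>lborel)"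
    by (simp add: integral_torus prod)
  also have "\<dots> = (\<integral>f. (\<Prod>b\<in>?B. ?g b ((\<Sum>b\<in>?B. f b *\<^sub>R b) \<bullet> b)) \<partial>(\<Pi>\<^sub>M b\<in>?B. lborel))"
    by (subst lborel_eq, subst integral_distr) measurable
  also have "\<dots> = (\<integral>f. (\<Prod>b\<in>?B. ?g b (f b)) \<partial>(\<Pi>\<^sub>M b\<in>?B. lborel))"
    by (intro Bochner_Integration.integral_cong refl prod.cong) simp
  also have "\<dots> = (\<Prod>b\<in>?B. \<integral>s. ?g b s \<partial>lborel)"
    by (rule P.product_integral_prod) (auto intro: int)
  also have "\<dots> = (\<Prod>b\<in>?B. if m b = 0 then of_real (2 * pi) else 0)"
    by (intro prod.cong refl) (simp add: integral_cis_int)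
  also have "\<dots> = (if k = 0 then of_real ((2 * pi) ^ 3) else 0)"
  proof (cases "k = 0")
    case True
    have "(\<Prod>b\<in>?B. if m b = 0 then complex_of_real (2 * pi) else 0) = (\<Prod>b\<in>?B. complex_of_real (2 * pi))"
      by (rule prod.cong) (use True m in \<open>auto simp: Basis_vec_def\<close>)
    then show ?thesis using True by simp
  next
    case False
    then obtain i where "k $ i \<noteq> 0" by (auto simp: vec_eq_iff)
    then have "m (axis i 1) \<noteq> 0" "axis i 1 \<in> ?B" using m by auto
    then show ?thesis using False by (auto intro!: prod_zero)
  qed
  finally show ?thesis .
qed

section \<open>Orthogonality of the modes and multiplier bounds\<close>

definition torus_vol :: real where "torus_vol = (2 * pi) ^ 3"

lemma torus_vol_pos: "torus_vol > 0"
  by (simp add: torus_vol_def)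

lemma fourier_mode_orthogonal:
  "(\<integral>x. fourier_mode k x * cnj (fourier_mode l x) \<partial>torus) = (if k = l then of_real torus_vol else 0)"
  using integral_torus_fourier_mode[of "k - l"] by (simp add: fourier_mode_diff torus_vol_def)

definition trig_poly :: "(int^3) set \<Rightarrow> (int^3 \<Rightarrow> complex) \<Rightarrow> real^3 \<Rightarrow> complex" where
  "trig_poly Q c x = (\<Sum>k\<in>Q. c k * fourier_mode k x)"

lemma norm_trig_poly_le: "norm (trig_poly Q c x) \<le> (\<Sum>k\<in>Q. norm (c k))"
  unfolding trig_poly_def by (rule order_trans[OF norm_sum]) (simp add: norm_mult)

lemma measurable_trig_poly [measurable]: "trig_poly Q c \<in> borel_measurable borel"
  unfolding trig_poly_def[abs_def] by measurable

lemma bounded_measurable_trig_poly [simp]: "trig_poly Q c \<in> bounded_measurable torus"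
  by (rule bounded_measurableI[OF _ norm_trig_poly_le]) measurable

text \<open>The Fourier coefficient without its normalising factor; orthogonality relations then
  produce \<open>torus_vol\<close>.\<close>

definition mode_integral :: "(real^3 \<Rightarrow> complex) \<Rightarrow> int^3 \<Rightarrow> complex" where
  "mode_integral f k = (\<integral>x. f x * cnj (fourier_mode k x) \<partial>torus)"

lemma integrable_bounded_measurable_mult:
  assumes "f \<in> bounded_measurable torus" "g \<in> bounded_measurable torus"
  shows "integrable torus (\<lambda>x. f x * g x)"
proof -
  obtain c d where c: "\<And>x. norm (f x) \<le> c" and d: "\<And>x. norm (g x) \<le> d"
    using assms by (auto simp: bounded_measurable_def)
  have [measurable]: "f \<in> borel_measurable torus" "g \<in> borel_measurable torus"
    using assms by (auto simp: bounded_measurable_def)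
  show ?thesis
    by (rule torus.integrable_const_bound[where B="c * d"])
       (auto intro!: AE_I2 mult_mono c d order_trans[OF norm_ge_zero c] simp: norm_mult)
qed

lemma bounded_measurable_fourier_mode [simp]:
  "fourier_mode k \<in> bounded_measurable torus" "(\<lambda>x. cnj (fourier_mode k x)) \<in> bounded_measurable torus"
proof -
  show "fourier_mode k \<in> bounded_measurable torus" by (rule bounded_measurableI[where c=1]) auto
  have "(\<lambda>x. cnj (fourier_mode k x)) = fourier_mode (- k)"
    by (simp add: fun_eq_iff fourier_mode_def freq_uminus cis_cnj)
  then show "(\<lambda>x. cnj (fourier_mode k x)) \<in> bounded_measurable torus"
    using \<open>fourier_mode k \<in> _\<close> by (simp add: bounded_measurableI[where c=1])
qed

lemma integrable_mode:
  "f \<in> bounded_measurable torus \<Longrightarrow> integrable torus (\<lambda>x. f x * cnj (fourier_mode k x))"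
  by (intro integrable_bounded_measurable_mult) auto

lemma mode_integral_trig_poly:
  assumes "finite Q"
  shows "mode_integral (trig_poly Q c) k = (if k \<in> Q then of_real torus_vol * c k else 0)"
proof -
  have "mode_integral (trig_poly Q c) k = (\<integral>x. (\<Sum>l\<in>Q. c l * (fourier_mode l x * cnj (fourier_mode k x))) \<partial>torus)"
    by (simp add: mode_integral_def trig_poly_def sum_distrib_right mult.assoc)
  also have "\<dots> = (\<Sum>l\<in>Q. c l * (if l = k then of_real torus_vol else 0))"
    by (subst Bochner_Integration.integral_sum) (auto intro!: integrable_mult_right integrable_mode simp: fourier_mode_orthogonal)
  also have "\<dots> = (if k \<in> Q then of_real torus_vol * c k else 0)"
    using assms by (simp add: if_distrib sum.delta' cong: if_cong)
  finally show ?thesis .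
qed

lemma integral_mult_cnj_trig_poly:
  assumes "f \<in> bounded_measurable torus"
  shows "(\<integral>x. f x * cnj (trig_poly Q c x) \<partial>torus) = (\<Sum>k\<in>Q. cnj (c k) * mode_integral f k)"
proof -
  have "(\<integral>x. f x * cnj (trig_poly Q c x) \<partial>torus) = (\<integral>x. (\<Sum>k\<in>Q. cnj (c k) * (f x * cnj (fourier_mode k x))) \<partial>torus)"
    by (simp add: trig_poly_def sum_distrib_left mult_ac)
  also have "\<dots> = (\<Sum>k\<in>Q. cnj (c k) * mode_integral f k)"
    unfolding mode_integral_def
    by (subst Bochner_Integration.integral_sum) (auto intro!: integrable_mult_right integrable_mode assms)
  finally show ?thesis .
qed

lemma integrable_norm_squared:
  "f \<in> bounded_measurable torus \<Longrightarrow> integrable torus (\<lambda>x. (norm (f x))\<^sup>2)"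
  using torus.integrable_norm_powr[of f 2] by simp

lemma integral_norm_squared_trig_poly:
  assumes "finite Q"
  shows "(\<integral>x. (norm (trig_poly Q c x))\<^sup>2 \<partial>torus) = torus_vol * (\<Sum>k\<in>Q. (norm (c k))\<^sup>2)"
proof -
  have "complex_of_real (\<integral>x. (norm (trig_poly Q c x))\<^sup>2 \<partial>torus) = (\<integral>x. trig_poly Q c x * cnj (trig_poly Q c x) \<partial>torus)"
    by (simp only: complex_norm_square integral_complex_of_real[symmetric])
  also have "\<dots> = (\<Sum>k\<in>Q. of_real torus_vol * (c k * cnj (c k)))"
    by (simp add: integral_mult_cnj_trig_poly mode_integral_trig_poly[OF assms] mult_ac)
  also have "\<dots> = complex_of_real (torus_vol * (\<Sum>k\<in>Q. (norm (c k))\<^sup>2))"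
    by (simp only: complex_norm_square[symmetric] of_real_mult of_real_sum sum_distrib_left)
  finally show ?thesis by (simp only: of_real_eq_iff)
qed

text \<open>The squared distance from f to its projection on the modes in Q is nonnegative.\<close>

lemma Bessel_torus:
  assumes f: "f \<in> bounded_measurable torus" and Q: "finite Q"
  shows "(\<Sum>k\<in>Q. (norm (mode_integral f k))\<^sup>2) \<le> torus_vol * (\<integral>x. (norm (f x))\<^sup>2 \<partial>torus)"
proof -
  define c where "c k = mode_integral f k / of_real torus_vol" for k
  let ?P = "trig_poly Q c" and ?S = "\<Sum>k\<in>Q. (norm (mode_integral f k))\<^sup>2"
  note V = torus_vol_pos
  have cross: "(\<integral>x. f x * cnj (?P x) \<partial>torus) = of_real (?S / torus_vol)"
  proof -
    have "(\<integral>x. f x * cnj (?P x) \<partial>torus) = (\<Sum>k\<in>Q. (mode_integral f k * cnj (mode_integral f k)) / of_real torus_vol)"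
      by (simp add: integral_mult_cnj_trig_poly[OF f] c_def mult.commute)
    also have "\<dots> = of_real (?S / torus_vol)"
      by (simp only: complex_norm_square[symmetric] of_real_sum of_real_divide sum_divide_distrib)
    finally show ?thesis .
  qed
  have PP: "(\<integral>x. (norm (?P x))\<^sup>2 \<partial>torus) = ?S / torus_vol"
    unfolding integral_norm_squared_trig_poly[OF Q] using V
    by (simp add: c_def norm_divide power_divide sum_divide_distrib[symmetric] power2_eq_square)
  have ifP: "integrable torus (\<lambda>x. f x * cnj (?P x))"
  proof (rule integrable_bounded_measurable_mult[OF f])
    show "(\<lambda>x. cnj (?P x)) \<in> bounded_measurable torus"
      by (rule bounded_measurableI[where c="\<Sum>k\<in>Q. norm (c k)"]) (auto simp: norm_trig_poly_le, measurable)
  qed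
  have "0 \<le> (\<integral>x. (norm (f x - ?P x))\<^sup>2 \<partial>torus)" by (auto intro: integral_nonneg_AE)
  also have "\<dots> = (\<integral>x. (norm (f x))\<^sup>2 - 2 * Re (f x * cnj (?P x)) + (norm (?P x))\<^sup>2 \<partial>torus)"
    by (intro Bochner_Integration.integral_cong refl)
       (unfold cmod_power2, simp add: power2_eq_square algebra_simps)
  also have "\<dots> = (\<integral>x. (norm (f x))\<^sup>2 \<partial>torus) - 2 * Re (\<integral>x. f x * cnj (?P x) \<partial>torus) + (\<integral>x. (norm (?P x))\<^sup>2 \<partial>torus)"
  proof -
    have i2: "integrable torus (\<lambda>x. (norm (?P x))\<^sup>2)" by (rule integrable_norm_squared) simp
    have iR: "integrable torus (\<lambda>x. 2 * Re (f x * cnj (?P x)))"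
      using integrable_Re[OF ifP] by (rule integrable_mult_right)
    note i1 = integrable_norm_squared[OF f]
    show ?thesis
      by (simp only: Bochner_Integration.integral_add[OF Bochner_Integration.integrable_diff[OF i1 iR] i2]
        Bochner_Integration.integral_diff[OF i1 iR] integral_mult_right_zero integral_Re[OF ifP])
  qed
  finally have "?S / torus_vol \<le> (\<integral>x. (norm (f x))\<^sup>2 \<partial>torus)"
    unfolding cross PP by simp
  then show ?thesis using V by (simp add: pos_divide_le_eq mult.commute)
qed


text \<open>The multiplier is convolution with the kernel \<open>trig_poly Q \<nu>\<close>: bounded
  from L1 to the sup norm by \<beta>, and on L2 because |\<nu>| \<le> 1. Interpolation gives the
  power 1 - 2/q of \<beta>. The bilinear form of mode integrals is the shape in which the TT*
  argument uses it.\<close>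

lemma multiplier_form_bound:
  assumes q: "q > 2"
  shows "\<exists>C\<ge>0. \<forall>Q \<nu> \<beta> f g. finite Q \<longrightarrow> (\<forall>k\<in>Q. norm (\<nu> k) \<le> 1) \<longrightarrow> \<beta> > 0 \<longrightarrow>
    (\<forall>x. norm (trig_poly Q \<nu> x) \<le> \<beta>) \<longrightarrow> f \<in> bounded_measurable torus \<longrightarrow> g \<in> bounded_measurable torus \<longrightarrow>
    norm (\<Sum>k\<in>Q. \<nu> k * mode_integral f k * cnj (mode_integral g k))
      \<le> C * \<beta> powr (1 - 2 / q) * lpnorm torus (q / (q - 1)) f * lpnorm torus (q / (q - 1)) g"
proof -
  let ?K = "4 * q / (q - 2) * 2 powr (q - 2) * torus_vol\<^sup>2" and ?q' = "q / (q - 1)"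
  have K0: "?K \<ge> 0" using q torus_vol_pos by simp
  have "norm (\<Sum>k\<in>Q. \<nu> k * mode_integral f k * cnj (mode_integral g k))
      \<le> ?K powr (1 / q) * \<beta> powr (1 - 2 / q) * lpnorm torus ?q' f * lpnorm torus ?q' g"
    if Q: "finite Q" and \<nu>: "\<forall>k\<in>Q. norm (\<nu> k) \<le> 1" and \<beta>: "\<beta> > 0"
      and W: "\<forall>x. norm (trig_poly Q \<nu> x) \<le> \<beta>"
      and f: "f \<in> bounded_measurable torus" and g: "g \<in> bounded_measurable torus"
    for Q \<nu> \<beta> f g
  proof -
    define A where "A f = trig_poly Q (\<lambda>k. \<nu> k * mode_integral f k)" for f
    have Ab: "A f \<in> bounded_measurable torus" for f unfolding A_def by simp
    have bound: "(\<integral>x. norm (A f x) powr q \<partial>torus)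
      \<le> 4 * q / (q - 2) * 2 powr (q - 2) * torus_vol\<^sup>2 * \<beta> powr (q - 2) * (\<integral>x. norm (f x) powr ?q' \<partial>torus) powr (q - 1)"
    proof (rule torus.interpolation_L2_Linfinity[OF q _ \<beta> _ _ _ _ f])
      \<comment> \<open>One factor \<open>torus_vol\<close> comes from Plancherel for the image, the
        other from Bessel for the unnormalised mode integrals.\<close>
      show "torus_vol\<^sup>2 \<ge> 0" by simp
      show "A f \<in> borel_measurable torus" for f using Ab by (rule bounded_measurable_measurable)
      show "A (\<lambda>x. f x + g x) x = A f x + A g x"
        if "f \<in> bounded_measurable torus" "g \<in> bounded_measurable torus" for f g x
      proof -
        have "mode_integral (\<lambda>x. f x + g x) k = mode_integral f k + mode_integral g k" for k
          unfolding mode_integral_def using integrable_mode[OF that(1)] integrable_mode[OF that(2)]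
          by (simp add: distrib_right)
        then show ?thesis by (simp add: A_def trig_poly_def distrib_left distrib_right sum.distrib)
      qed
      show "norm (A f x) \<le> \<beta> * (\<integral>x. norm (f x) \<partial>torus)" if f: "f \<in> bounded_measurable torus" for f x
      proof -
        have "A f x = (\<Sum>k\<in>Q. \<nu> k * fourier_mode k x * (\<integral>y. f y * cnj (fourier_mode k y) \<partial>torus))"
          by (simp add: A_def trig_poly_def mode_integral_def mult_ac)
        also have "\<dots> = (\<integral>y. (\<Sum>k\<in>Q. \<nu> k * fourier_mode k x * (f y * cnj (fourier_mode k y))) \<partial>torus)"
          by (subst Bochner_Integration.integral_sum) (auto intro!: integrable_mult_right integrable_mode f)
        \<comment> \<open>The modes are characters, so the sum over Q collapses to the kernel at x -
          y.\<close>
        also have "\<dots> = (\<integral>y. trig_poly Q \<nu> (x - y) * f y \<partial>torus)"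
          by (simp add: trig_poly_def fourier_mode_diff_right sum_distrib_right sum_distrib_left mult_ac)
        finally have eq: "A f x = (\<integral>y. trig_poly Q \<nu> (x - y) * f y \<partial>torus)" .
        have [measurable]: "f \<in> borel_measurable torus" using f by (rule bounded_measurable_measurable)
        have "norm (A f x) \<le> (\<integral>y. norm (trig_poly Q \<nu> (x - y) * f y) \<partial>torus)"
          unfolding eq by (rule integral_norm_bound)
        also have "\<dots> \<le> (\<integral>y. \<beta> * norm (f y) \<partial>torus)"
        proof (rule integral_mono)
          have b: "(\<lambda>y. trig_poly Q \<nu> (x - y)) \<in> bounded_measurable torus"
            by (rule bounded_measurableI[where c=\<beta>]) (use W in auto)
          show "integrable torus (\<lambda>y. norm (trig_poly Q \<nu> (x - y) * f y))"
            using integrable_bounded_measurable_mult[OF b f] by (rule integrable_norm)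
          show "integrable torus (\<lambda>y. \<beta> * norm (f y))"
            using torus.integrable_norm_powr[OF f, of 1] by simp
          show "norm (trig_poly Q \<nu> (x - y) * f y) \<le> \<beta> * norm (f y)" for y
            unfolding norm_mult using W by (intro mult_right_mono) auto
        qed
        also have "\<dots> = \<beta> * (\<integral>x. norm (f x) \<partial>torus)" by simp
        finally show ?thesis .
      qed
      show "(\<integral>x. (norm (A f x))\<^sup>2 \<partial>torus) \<le> torus_vol\<^sup>2 * (\<integral>x. (norm (f x))\<^sup>2 \<partial>torus)"
        if f: "f \<in> bounded_measurable torus" for f
      proof -
        have "(\<integral>x. (norm (A f x))\<^sup>2 \<partial>torus) = torus_vol * (\<Sum>k\<in>Q. (norm (\<nu> k * mode_integral f k))\<^sup>2)"
          unfolding A_def by (rule integral_norm_squared_trig_poly[OF Q])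
        also have "\<dots> \<le> torus_vol * (\<Sum>k\<in>Q. (norm (mode_integral f k))\<^sup>2)"
          using \<nu> torus_vol_pos
          by (intro mult_left_mono sum_mono power_mono) (auto simp: norm_mult mult_left_le_one_le)
        also have "\<dots> \<le> torus_vol * (torus_vol * (\<integral>x. (norm (f x))\<^sup>2 \<partial>torus))"
          using torus_vol_pos by (intro mult_left_mono Bessel_torus[OF f Q]) auto
        finally show ?thesis by (simp add: power2_eq_square mult.assoc)
      qed
    qed
    have S0: "(\<integral>x. norm (f x) powr ?q' \<partial>torus) \<ge> 0" by (auto intro: integral_nonneg_AE)
    have "lpnorm torus q (A f) \<le> (?K * \<beta> powr (q - 2) * (\<integral>x. norm (f x) powr ?q' \<partial>torus) powr (q - 1)) powr (1 / q)"
      unfolding lpnorm_def using q bound by (intro powr_mono2) (auto intro: integral_nonneg_AE simp: mult_ac)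
    also have "\<dots> = ?K powr (1 / q) * \<beta> powr (1 - 2 / q) * lpnorm torus ?q' f"
    proof -
      have e: "(q - 2) * (1 / q) = 1 - 2 / q" "(q - 1) * (1 / q) = 1 / ?q'" using q by (auto simp: field_simps)
      show ?thesis using K0 S0 \<beta> by (simp only: powr_mult powr_powr e lpnorm_def powr_ge_zero mult_nonneg_nonneg)
    qed
    finally have Aq: "lpnorm torus q (A f) \<le> ?K powr (1 / q) * \<beta> powr (1 - 2 / q) * lpnorm torus ?q' f" .
    have gm[measurable]: "g \<in> borel_measurable torus" using g by (rule bounded_measurable_measurable)
    have Am[measurable]: "A f \<in> borel_measurable torus" using Ab by (rule bounded_measurable_measurable)
    have gc: "(\<lambda>x. cnj (g x)) \<in> bounded_measurable torus"
      using g unfolding bounded_measurable_def by auto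
    have "(\<Sum>k\<in>Q. \<nu> k * mode_integral f k * cnj (mode_integral g k)) = cnj (\<Sum>k\<in>Q. cnj (\<nu> k * mode_integral f k) * mode_integral g k)"
      by simp
    also have "\<dots> = cnj (\<integral>x. g x * cnj (A f x) \<partial>torus)"
      unfolding A_def integral_mult_cnj_trig_poly[OF g] ..
    finally have "norm (\<Sum>k\<in>Q. \<nu> k * mode_integral f k * cnj (mode_integral g k)) \<le> (\<integral>x. norm (g x * cnj (A f x)) \<partial>torus)"
      using integral_norm_bound[of torus "\<lambda>x. g x * cnj (A f x)"] by (simp only: complex_mod_cnj)
    also have "\<dots> = lpnorm torus 1 (\<lambda>x. g x * A f x)"
      by (simp add: lpnorm_def norm_mult integral_nonneg_AE)
    also have "\<dots> \<le> lpnorm torus ?q' g * lpnorm torus q (A f)"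
      using q by (intro lpnorm_mult_le torus.integrable_norm_powr g Ab) (auto simp: field_simps)
    also have "\<dots> \<le> lpnorm torus ?q' g * (?K powr (1 / q) * \<beta> powr (1 - 2 / q) * lpnorm torus ?q' f)"
      by (intro mult_left_mono Aq) auto
    finally show ?thesis by (simp add: mult_ac)
  qed
  then show ?thesis by (intro exI[of _ "?K powr (1 / q)"]) (auto intro!: powr_ge_zero)
qed

section \<open>Dyadic estimates\<close>

text \<open>The time sum is moved inside onto the dual coefficients c, and Cauchy-Schwarz over the
  frequencies is applied with weight \<mu>. As \<mu> is nonnegative on Q, the square sum over S may
  be enlarged to Q before it is expanded, so the kernels on the right no longer depend on S.\<close>

lemma TTstar_sum:
  fixes a :: "'k \<Rightarrow> complex" and \<mu> :: "'k \<Rightarrow> real" and \<phi> :: "'n \<Rightarrow> 'k \<Rightarrow> real"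
  assumes "finite Q" "S \<subseteq> Q" and pos: "\<And>k. k \<in> S \<Longrightarrow> \<mu> k > 0" and nn: "\<And>k. k \<in> Q \<Longrightarrow> \<mu> k \<ge> 0"
  shows "(norm (\<Sum>n\<in>I. \<Sum>k\<in>S. of_real (\<phi> n k) * a k * cnj (c n k)))\<^sup>2
    \<le> (\<Sum>k\<in>S. (norm (a k))\<^sup>2 / \<mu> k) *
      (\<Sum>n\<in>I. \<Sum>m\<in>I. norm (\<Sum>k\<in>Q. of_real (\<mu> k * \<phi> n k * \<phi> m k) * c n k * cnj (c m k)))"
proof -
  define d where "d k = (\<Sum>n\<in>I. of_real (\<phi> n k) * c n k)" for k
  have "(\<Sum>n\<in>I. \<Sum>k\<in>S. of_real (\<phi> n k) * a k * cnj (c n k)) = (\<Sum>k\<in>S. a k * cnj (d k))"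
    unfolding d_def by (subst sum.swap) (simp add: sum_distrib_left mult_ac)
  then have "norm (\<Sum>n\<in>I. \<Sum>k\<in>S. of_real (\<phi> n k) * a k * cnj (c n k)) \<le> (\<Sum>k\<in>S. norm (a k) * norm (d k))"
    using norm_sum[of "\<lambda>k. a k * cnj (d k)" S] by (simp add: norm_mult)
  also have "\<dots> = (\<Sum>k\<in>S. (norm (a k) / sqrt (\<mu> k)) * (sqrt (\<mu> k) * norm (d k)))"
  proof (intro sum.cong refl)
    fix k assume "k \<in> S"
    then have "sqrt (\<mu> k) \<noteq> 0" using pos[of k] by simp
    then show "norm (a k) * norm (d k) = (norm (a k) / sqrt (\<mu> k)) * (sqrt (\<mu> k) * norm (d k))" by simp
  qed
  finally have "(norm (\<Sum>n\<in>I. \<Sum>k\<in>S. of_real (\<phi> n k) * a k * cnj (c n k)))\<^sup>2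
    \<le> (\<Sum>k\<in>S. (norm (a k) / sqrt (\<mu> k)) * (sqrt (\<mu> k) * norm (d k)))\<^sup>2"
    by (intro power_mono) auto
  also have "\<dots> \<le> (\<Sum>k\<in>S. (norm (a k) / sqrt (\<mu> k))\<^sup>2) * (\<Sum>k\<in>S. (sqrt (\<mu> k) * norm (d k))\<^sup>2)"
    by (rule Cauchy_Schwarz_ineq_sum)
  also have "(\<Sum>k\<in>S. (norm (a k) / sqrt (\<mu> k))\<^sup>2) = (\<Sum>k\<in>S. (norm (a k))\<^sup>2 / \<mu> k)"
    using pos by (intro sum.cong refl) (simp add: power_divide less_imp_le)
  also have "(\<Sum>k\<in>S. (norm (a k))\<^sup>2 / \<mu> k) * (\<Sum>k\<in>S. (sqrt (\<mu> k) * norm (d k))\<^sup>2)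
    \<le> (\<Sum>k\<in>S. (norm (a k))\<^sup>2 / \<mu> k) *
      (\<Sum>n\<in>I. \<Sum>m\<in>I. norm (\<Sum>k\<in>Q. of_real (\<mu> k * \<phi> n k * \<phi> m k) * c n k * cnj (c m k)))"
  proof (rule mult_left_mono)
    \<comment> \<open>Here S is replaced by Q.\<close>
    have "(\<Sum>k\<in>S. (sqrt (\<mu> k) * norm (d k))\<^sup>2) \<le> (\<Sum>k\<in>Q. (sqrt (\<mu> k) * norm (d k))\<^sup>2)"
      using assms by (intro sum_mono2) auto
    also have "\<dots> = (\<Sum>k\<in>Q. \<mu> k * (norm (d k))\<^sup>2)"
      using nn by (intro sum.cong refl) (simp add: power_mult_distrib)
    also have "\<dots> = norm (complex_of_real (\<Sum>k\<in>Q. \<mu> k * (norm (d k))\<^sup>2))"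
      unfolding norm_of_real using nn by (intro abs_of_nonneg[symmetric] sum_nonneg) auto
    also have "complex_of_real (\<Sum>k\<in>Q. \<mu> k * (norm (d k))\<^sup>2)
      = (\<Sum>k\<in>Q. \<Sum>n\<in>I. \<Sum>m\<in>I. of_real (\<mu> k * \<phi> n k * \<phi> m k) * c n k * cnj (c m k))"
    proof -
      have "complex_of_real (\<Sum>k\<in>Q. \<mu> k * (norm (d k))\<^sup>2) = (\<Sum>k\<in>Q. of_real (\<mu> k) * (d k * cnj (d k)))"
        by (simp only: complex_norm_square[symmetric] of_real_sum of_real_mult)
      also have "\<dots> = (\<Sum>k\<in>Q. \<Sum>n\<in>I. \<Sum>m\<in>I. of_real (\<mu> k) * ((of_real (\<phi> n k) * c n k) * cnj (of_real (\<phi> m k) * c m k)))"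
        by (intro sum.cong refl) (simp only: d_def cnj_sum sum_product, simp only: sum_distrib_left)
      also have "\<dots> = (\<Sum>k\<in>Q. \<Sum>n\<in>I. \<Sum>m\<in>I. of_real (\<mu> k * \<phi> n k * \<phi> m k) * c n k * cnj (c m k))"
        by (intro sum.cong refl) simp
      finally show ?thesis .
    qed
    also have "\<dots> = (\<Sum>n\<in>I. \<Sum>m\<in>I. \<Sum>k\<in>Q. of_real (\<mu> k * \<phi> n k * \<phi> m k) * c n k * cnj (c m k))"
      by (subst sum.swap, intro sum.cong refl, rule sum.swap)
    also have "norm \<dots> \<le> (\<Sum>n\<in>I. \<Sum>m\<in>I. norm (\<Sum>k\<in>Q. of_real (\<mu> k * \<phi> n k * \<phi> m k) * c n k * cnj (c m k)))"
      by (rule order_trans[OF norm_sum], intro sum_mono, rule norm_sum)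
    finally show "(\<Sum>k\<in>S. (sqrt (\<mu> k) * norm (d k))\<^sup>2)
      \<le> (\<Sum>n\<in>I. \<Sum>m\<in>I. norm (\<Sum>k\<in>Q. of_real (\<mu> k * \<phi> n k * \<phi> m k) * c n k * cnj (c m k)))" .
  qed (use pos in \<open>auto intro!: sum_nonneg divide_nonneg_pos\<close>)
  finally show ?thesis .
qed

text \<open>
  For the half wave itself the kernel of order \<open>-2\<close> has a logarithmic singularity on the light
  cone. Treating the cosine and the sine part separately avoids it.
\<close>

lemma wave_pair_kernel_bound:
  assumes "T \<ge> 0"
  shows "\<exists>C>0. \<forall>n a b \<tau> (i::int) (j::int) \<phi> x. \<phi> = cos \<or> \<phi> = sin \<longrightarrow> 1 \<le> a \<longrightarrow> 2 * a \<le> b \<longrightarrow>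
    i * \<tau> \<in> {0..T} \<longrightarrow> j * \<tau> \<in> {0..T} \<longrightarrow>
    norm (trig_poly (freq_box (2 * n)) (\<lambda>d. of_real (fejer_weight n d * wave_symbol a b d *
        \<phi> (i * \<tau> * norm (freq d)) * \<phi> (j * \<tau> * norm (freq d)))) x)
      \<le> C / (\<bar>i * \<tau> - j * \<tau>\<bar> + 1 / b)"
proof -
  \<comment> \<open>The horizon is doubled because the sum of two times in [0, T] occurs
    below.\<close>
  obtain C where C: "C > 0" and disp: "\<And>n a b t x. \<lbrakk>1 \<le> a; 2 * a \<le> b; 0 \<le> t; t \<le> 2 * T\<rbrakk> \<Longrightarrow>
    norm (\<Sum>d\<in>freq_box (2 * n). of_real (fejer_weight n d * wave_symbol a b d * cos (t * norm (freq d))) * fourier_mode d x)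
      \<le> C / (t + 1 / b)"
    using dispersive_estimate[of "2 * T"] assms by auto
  have "norm (trig_poly (freq_box (2 * n)) (\<lambda>d. of_real (fejer_weight n d * wave_symbol a b d *
        \<phi> (s * norm (freq d)) * \<phi> (t * norm (freq d)))) x) \<le> C / (\<bar>s - t\<bar> + 1 / b)"
    if \<phi>: "\<phi> = cos \<or> \<phi> = sin" and a: "1 \<le> a" "2 * a \<le> b" and s: "s \<in> {0..T}" and t: "t \<in> {0..T}"
    for n a b \<phi> x and s t :: real
  proof -
    let ?w = "\<lambda>d. fejer_weight n d * wave_symbol a b d" and ?r = "\<lambda>d. norm (freq d)"
    let ?D = "\<lambda>t. \<Sum>d\<in>freq_box (2 * n). of_real (?w d * cos (t * ?r d)) * fourier_mode d x"
    \<comment> \<open>The sign in the product formulas for cos * cos and sin * sin.\<close>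
    define \<sigma> :: complex where "\<sigma> = (if \<phi> = cos then 1 else - 1)"
    have \<sigma>: "norm \<sigma> = 1" by (simp add: \<sigma>_def)
    have b: "b > 0" using a by simp
    have prod: "complex_of_real (?w d * \<phi> (s * ?r d) * \<phi> (t * ?r d)) =
      (of_real (?w d * cos (\<bar>s - t\<bar> * ?r d)) + \<sigma> * of_real (?w d * cos ((s + t) * ?r d))) / 2" for d
    proof -
      have "cos (\<bar>s - t\<bar> * ?r d) = cos (s * ?r d - t * ?r d)"
        by (cases "s \<ge> t") (simp_all add: left_diff_distrib, metis cos_minus minus_diff_eq)
      moreover have "\<phi> (s * ?r d) * \<phi> (t * ?r d) = (cos (s * ?r d - t * ?r d) + (if \<phi> = cos then 1 else - 1) * cos (s * ?r d + t * ?r d)) / 2"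
      proof (cases "\<phi> = cos")
        case True
        then show ?thesis by (simp add: cos_times_cos)
      next
        case False
        then show ?thesis using \<phi> by (simp add: sin_times_sin)
      qed
      ultimately have "?w d * \<phi> (s * ?r d) * \<phi> (t * ?r d) = (?w d * cos (\<bar>s - t\<bar> * ?r d) + (if \<phi> = cos then 1 else - 1) * (?w d * cos ((s + t) * ?r d))) / 2"
        by (simp add: mult.assoc distrib_left distrib_right)
      then have "complex_of_real (?w d * \<phi> (s * ?r d) * \<phi> (t * ?r d)) = of_real ((?w d * cos (\<bar>s - t\<bar> * ?r d) + (if \<phi> = cos then 1 else - 1) * (?w d * cos ((s + t) * ?r d))) / 2)"
        by (simp only:)
      then show ?thesis by (simp add: \<sigma>_def)
    qed
    have eq: "trig_poly (freq_box (2 * n)) (\<lambda>d. of_real (?w d * \<phi> (s * ?r d) * \<phi> (t * ?r d))) x = (?D \<bar>s - t\<bar> + \<sigma> * ?D (s + t)) / 2"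
      unfolding trig_poly_def prod by (simp add: sum_distrib_left sum.distrib[symmetric] sum_divide_distrib[symmetric] distrib_right mult.assoc)
    have "norm ((X + \<sigma> * Y) / 2) \<le> (norm X + norm Y) / 2" for X Y
      using norm_triangle_ineq[of X "\<sigma> * Y"] by (simp add: norm_mult norm_divide \<sigma>)
    then have "norm (trig_poly (freq_box (2 * n)) (\<lambda>d. of_real (?w d * \<phi> (s * ?r d) * \<phi> (t * ?r d))) x) \<le> (norm (?D \<bar>s - t\<bar>) + norm (?D (s + t))) / 2"
      unfolding eq .
    also have "\<dots> \<le> (C / (\<bar>s - t\<bar> + 1 / b) + C / (\<bar>s - t\<bar> + 1 / b)) / 2"
    proof (intro divide_right_mono add_mono)
      show "norm (?D \<bar>s - t\<bar>) \<le> C / (\<bar>s - t\<bar> + 1 / b)"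
        by (rule disp[OF a]) (use s t in auto)
      \<comment> \<open>Both times are nonnegative, so s + t \<ge> |s - t| and the second kernel
        obeys the bound of the first.\<close>
      have "norm (?D (s + t)) \<le> C / ((s + t) + 1 / b)"
        by (rule disp[OF a]) (use s t in auto)
      also have "\<dots> \<le> C / (\<bar>s - t\<bar> + 1 / b)"
        using C s t b by (intro divide_left_mono mult_pos_pos add_nonneg_pos) auto
      finally show "norm (?D (s + t)) \<le> C / (\<bar>s - t\<bar> + 1 / b)" .
    qed simp
    also have "\<dots> = C / (\<bar>s - t\<bar> + 1 / b)" by (simp only: add_divide_distrib field_sum_of_halves)
    finally show ?thesis .
  qed
  then show ?thesis by (intro exI[of _ C] conjI C allI impI) auto
qed

lemma norm_freq_box_le:
  assumes "d \<in> freq_box n"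
  shows "(norm (freq d))\<^sup>2 \<le> 3 * (real n)\<^sup>2"
proof -
  have "(norm (freq d))\<^sup>2 = (\<Sum>i\<in>UNIV. (real_of_int (d $ i))\<^sup>2)"
    by (simp add: norm_vec_def L2_set_def freq_def sum_nonneg)
  also have "\<dots> \<le> (\<Sum>i\<in>(UNIV::3 set). (real n)\<^sup>2)"
  proof (rule sum_mono)
    fix i :: 3
    have "\<bar>d $ i\<bar> \<le> int n" using assms unfolding freq_box_def by (simp add: abs_le_iff) (metis minus_le_iff)
    then have "\<bar>real_of_int (d $ i)\<bar> \<le> \<bar>real n\<bar>" by linarith
    then show "(real_of_int (d $ i))\<^sup>2 \<le> (real n)\<^sup>2" by (simp only: abs_le_square_iff)
  qed
  finally show ?thesis by simp
qed

lemma freq_box_mono: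
  assumes "m \<le> n"
  shows "freq_box m \<subseteq> freq_box n"
proof -
  have "{- int m..int m} \<subseteq> {- int n..int n}" using assms by simp
  then show ?thesis unfolding freq_box_def by blast
qed

text \<open>Each x i is at most the total X, hence x i^r \<le> x i * X^(r - 1).\<close>

lemma sum_powr_le_powr_sum:
  fixes x :: "'a \<Rightarrow> real"
  assumes "finite I" "\<And>i. i \<in> I \<Longrightarrow> x i \<ge> 0" "r \<ge> 1"
  shows "(\<Sum>i\<in>I. x i powr r) \<le> (\<Sum>i\<in>I. x i) powr r"
proof -
  let ?X = "\<Sum>i\<in>I. x i"
  have X: "?X \<ge> 0" using assms by (intro sum_nonneg) auto
  have "(\<Sum>i\<in>I. x i powr r) \<le> (\<Sum>i\<in>I. x i * ?X powr (r - 1))"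
  proof (rule sum_mono)
    fix i assume i: "i \<in> I"
    have "x i \<le> ?X" using assms i by (intro member_le_sum) auto
    then have "x i powr (r - 1) \<le> ?X powr (r - 1)" using assms i by (intro powr_mono2) auto
    then have "x i * x i powr (r - 1) \<le> x i * ?X powr (r - 1)" using assms i by (intro mult_left_mono) auto
    then show "x i powr r \<le> x i * ?X powr (r - 1)"
      using powr_mult_base[of "x i" "r - 1"] assms i by simp
  qed
  also have "\<dots> = ?X * ?X powr (r - 1)" by (simp add: sum_distrib_right)
  also have "\<dots> = ?X powr r" using powr_mult_base[OF X, of "r - 1"] by simp
  finally show ?thesis .
qed

section \<open>Cosine and sine parts of the wave at one dyadic scale\<close>

definition wave_part :: "(real \<Rightarrow> real) \<Rightarrow> (int^3) set \<Rightarrow> (int^3 \<Rightarrow> complex) \<Rightarrow> real \<Rightarrow> real^3 \<Rightarrow> complex" where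
  "wave_part \<phi> S a t = trig_poly S (\<lambda>k. of_real (\<phi> (t * norm (freq k))) * a k)"

text \<open>H is the extremiser for L^q duality, rescaled by L^(p - q): over a sequence of times
  these functions are extremal for the mixed norm, because the pairing gives L^p and the dual norms
  are L^(p - 1). For L = 0 the identities persist, as powers of 0 are 0.\<close>

lemma dual_function:
  fixes p q :: real
  assumes q: "q > 2" and v: "v \<in> bounded_measurable torus"
  defines "L \<equiv> lpnorm torus q v"
  defines "H \<equiv> \<lambda>x. of_real (L powr (p - q) * norm (v x) powr (q - 2)) * v x"
  assumes p: "p > 1"
  shows "H \<in> bounded_measurable torus" and "lpnorm torus (q / (q - 1)) H = L powr (p - 1)"
    and "(\<integral>x. H x * cnj (v x) \<partial>torus) = of_real (L powr p)"
proof -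
  obtain B where B: "\<And>x. norm (v x) \<le> B" using v by (auto simp: bounded_measurable_def)
  have [measurable]: "v \<in> borel_measurable torus" using v by (rule bounded_measurable_measurable)
  have vv: "norm (v x) powr (q - 2) * norm (v x) = norm (v x) powr (q - 1)" for x
    using powr_mult_base[of "norm (v x)" "q - 2"] by (simp add: mult.commute)
  have nH: "norm (H x) = L powr (p - q) * norm (v x) powr (q - 1)" for x
    using vv[of x] by (simp add: H_def norm_mult mult.assoc)
  have Hm: "H \<in> borel_measurable torus" unfolding H_def by measurable
  show Hb: "H \<in> bounded_measurable torus"
    by (rule bounded_measurableI[where c="L powr (p - q) * B powr (q - 1)"])
       (use Hm B q nH in \<open>auto intro!: mult_left_mono powr_mono2\<close>)
  have L0: "L \<ge> 0" by (simp add: L_def)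
  have Lq: "(\<integral>x. norm (v x) powr q \<partial>torus) = L powr q"
    using q by (simp add: L_def lpnorm_powr)
  let ?q' = "q / (q - 1)"
  have q': "?q' > 0" "(q - 1) * ?q' = q" "(q - 1) / q = 1 / ?q'" using q by auto
  have pow: "L powr (p - q) * L powr (r + (q - p)) = L powr r" if "r > 0" for r
    using L0 that by (cases "L = 0") (simp_all add: powr_add[symmetric])
  have "(\<integral>x. norm (H x) powr ?q' \<partial>torus) = (\<integral>x. (L powr (p - q)) powr ?q' * norm (v x) powr q \<partial>torus)"
    by (simp only: nH powr_mult powr_powr q'(2) powr_ge_zero norm_ge_zero)
  also have "\<dots> = (L powr (p - q)) powr ?q' * L powr q" by (simp add: Lq)
  finally have "lpnorm torus ?q' H = ((L powr (p - q)) powr ?q' * L powr q) powr (1 / ?q')"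
    by (simp only: lpnorm_def)
  also have "\<dots> = L powr ((p - q) * ?q' * (1 / ?q')) * L powr (q * (1 / ?q'))"
    by (simp only: powr_mult powr_powr powr_ge_zero)
  also have "(p - q) * ?q' * (1 / ?q') = p - q" using q by simp
  also have "q * (1 / ?q') = q - 1" using q by simp
  also have "L powr (p - q) * L powr (q - 1) = L powr (p - 1)" using pow[of "p - 1"] p by simp
  finally show "lpnorm torus (q / (q - 1)) H = L powr (p - 1)" .
  have "(\<integral>x. H x * cnj (v x) \<partial>torus) = (\<integral>x. complex_of_real (L powr (p - q) * norm (v x) powr q) \<partial>torus)"
  proof (intro Bochner_Integration.integral_cong refl)
    fix x
    have "norm (v x) powr (q - 2) * (norm (v x))\<^sup>2 = norm (v x) powr q"
      using vv[of x] powr_mult_base[of "norm (v x)" "q - 1"] by (simp add: power2_eq_square) (metis mult.assoc mult.commute)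
    then have "of_real (norm (v x) powr (q - 2)) * (v x * cnj (v x)) = complex_of_real (norm (v x) powr q)"
      by (simp only: complex_norm_square[symmetric] of_real_mult[symmetric])
    then show "H x * cnj (v x) = complex_of_real (L powr (p - q) * norm (v x) powr q)"
      by (simp add: H_def mult.assoc)
  qed
  also have "\<dots> = of_real (L powr (p - q) * L powr q)"
    by (simp only: integral_complex_of_real integral_mult_right_zero Lq)
  also have "\<dots> = of_real (L powr p)" using pow[of p] p by simp
  finally show "(\<integral>x. H x * cnj (v x) \<partial>torus) = of_real (L powr p)" .
qed

text \<open>In the cube |d|^2 \<le> 3 N^2, so the symbol times N^2 is at least 4 / (4 * 7) = 1/7,
  and the Fejer weight gives the factor 1/8. With a = N the symbol is flat at low frequencies, so
  the bound holds on the full cube and not just on a shell.\<close>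

lemma wave_symbol_dyadic:
  assumes N: "N \<ge> 1" and d: "d \<in> freq_box N"
  shows "fejer_weight N d * wave_symbol (real N) (2 * real N) d * (real N)\<^sup>2 \<ge> 1 / 56"
proof -
  let ?r = "(norm (freq d))\<^sup>2" and ?N = "(real N)\<^sup>2"
  have N0: "?N > 0" using N by simp
  have "1 / 7 = ?N * (4 * ?N) / ((4 * ?N) * (7 * ?N))" using N0 by simp
  also have "\<dots> \<le> ?N * (4 * ?N) / ((?N + ?r) * (4 * ?N + ?r))"
    using norm_freq_box_le[OF d] N0 by (intro divide_left_mono mult_mono mult_pos_pos add_pos_nonneg) auto
  also have "\<dots> = wave_symbol (real N) (2 * real N) d * ?N"
    by (simp add: wave_symbol_def power_mult_distrib)
  finally have "1 / 8 * (1 / 7) \<le> fejer_weight N d * (wave_symbol (real N) (2 * real N) d * ?N)"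
    by (intro mult_mono fejer_weight_ge d fejer_weight_nonneg) auto
  then show ?thesis by (simp add: mult.assoc)
qed

lemma wave_symbol_dyadic_le:
  assumes N: "N \<ge> 1"
  shows "fejer_weight N d * wave_symbol (real N) (2 * real N) d * (real N)\<^sup>2 \<le> 1"
proof -
  let ?r = "(norm (freq d))\<^sup>2" and ?N = "(real N)\<^sup>2"
  have N0: "?N > 0" using N by simp
  have "wave_symbol (real N) (2 * real N) d * ?N = ?N * (4 * ?N) / ((?N + ?r) * (4 * ?N + ?r))"
    by (simp add: wave_symbol_def power_mult_distrib)
  also have "\<dots> \<le> 1"
  proof -
    have "?N * (4 * ?N) \<le> (?N + ?r) * (4 * ?N + ?r)" by (intro mult_mono) auto
    moreover have "(?N + ?r) * (4 * ?N + ?r) > 0" using N0 by (intro mult_pos_pos add_pos_nonneg) auto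
    ultimately show ?thesis by (simp only: divide_le_eq_1) simp
  qed
  finally have "fejer_weight N d * (wave_symbol (real N) (2 * real N) d * ?N) \<le> 1 * 1"
    by (intro mult_mono fejer_weight_le_1) (auto simp: wave_symbol_nonneg)
  then show ?thesis by (simp add: mult.assoc)
qed

lemma bounded_measurable_wave_part [simp]: "wave_part \<phi> S a t \<in> bounded_measurable torus"
  by (simp add: wave_part_def)

text \<open>TT* with the functions of \<open>dual_function\<close>. Off the diagonal, the
  interpolated kernel bound is weakened to the time decay |n - m|^(-2/p) that
  \<open>discrete_HLS\<close> accepts, the remaining power being absorbed by N. The diagonal terms
  have no decay and yield the power of N\<tau>.\<close>

theorem dyadic_strichartz:
  assumes p: "p > 2" and q: "q > 2" and pq: "1 / p + 1 / q \<le> 1 / 2" and T: "T \<ge> 0"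
  shows "\<exists>C\<ge>0. \<forall>N \<tau> I S a \<phi>. N \<ge> 1 \<longrightarrow> \<tau> > 0 \<longrightarrow> finite I \<longrightarrow> (\<forall>n\<in>I. of_int n * \<tau> \<in> {0..T}) \<longrightarrow>
     S \<subseteq> freq_box N \<longrightarrow> \<phi> = cos \<or> \<phi> = sin \<longrightarrow>
     (\<tau> * (\<Sum>n\<in>I. lpnorm torus q (wave_part \<phi> S a (of_int n * \<tau>)) powr p)) powr (1 / p)
       \<le> C * (1 + real N * \<tau>) powr (1 / p) * real N powr (3 / 2 - 3 / q - 1 / p) * sqrt (\<Sum>k\<in>S. (norm (a k))\<^sup>2)"
proof -
  obtain C1 where C1: "C1 > 0" and kernel: "\<And>n a b \<tau> (i::int) (j::int) \<phi> x. \<lbrakk>\<phi> = cos \<or> \<phi> = sin; 1 \<le> a; 2 * a \<le> b;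
    i * \<tau> \<in> {0..T}; j * \<tau> \<in> {0..T}\<rbrakk> \<Longrightarrow>
    norm (trig_poly (freq_box (2 * n)) (\<lambda>d. of_real (fejer_weight n d * wave_symbol a b d *
        \<phi> (i * \<tau> * norm (freq d)) * \<phi> (j * \<tau> * norm (freq d)))) x)
      \<le> C1 / (\<bar>i * \<tau> - j * \<tau>\<bar> + 1 / b)"
    using wave_pair_kernel_bound[OF T] that by (elim exE conjE) blast
  obtain C2 where C2: "C2 \<ge> 0" and form: "\<And>Q \<nu> \<beta> f g. \<lbrakk>finite Q; \<forall>k\<in>Q. norm (\<nu> k) \<le> 1; \<beta> > 0;
    \<forall>x. norm (trig_poly Q \<nu> x) \<le> \<beta>; f \<in> bounded_measurable torus; g \<in> bounded_measurable torus\<rbrakk> \<Longrightarrow>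
    norm (\<Sum>k\<in>Q. \<nu> k * mode_integral f k * cnj (mode_integral g k))
      \<le> C2 * \<beta> powr (1 - 2 / q) * lpnorm torus (q / (q - 1)) f * lpnorm torus (q / (q - 1)) g"
    using multiplier_form_bound[OF q] that by (elim exE conjE) blast
  \<comment> \<open>\<theta> is the power of the kernel left by interpolation and \<alpha> the decay
    used in \<open>discrete_HLS\<close>; the admissibility condition says exactly \<alpha> \<le>
    \<theta>.\<close>
  define \<theta> where "\<theta> = 1 - 2 / q"
  define \<alpha> where "\<alpha> = 2 / p"
  have \<theta>: "\<theta> > 0" "\<alpha> \<le> \<theta>" "\<alpha> > 0" using p q pq by (auto simp: \<theta>_def \<alpha>_def)
  define K where "K = C2 * C1 powr \<theta> * 2 powr \<theta>"
  have K: "K \<ge> 0" using C2 by (simp add: K_def)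
  define B where "B = 2 * (2 / (1 - 2 / p) + 4 powr (1 / p))"
  have B: "B \<ge> 0" using p by (simp add: B_def)
  \<comment> \<open>56 is the reciprocal of the lower bound for \<mu> on S, and 1 + B combines the
    diagonal with the constant of \<open>discrete_HLS\<close>. The root appears because TT* bounds a
    square.\<close>
  define C where "C = sqrt (56 * K * (1 + B))"
  have C0: "C \<ge> 0" using K B by (simp add: C_def)
  have main: "(\<tau> * (\<Sum>n\<in>I. lpnorm torus q (wave_part \<phi> S a (of_int n * \<tau>)) powr p)) powr (1 / p)
       \<le> C * (1 + real N * \<tau>) powr (1 / p) * real N powr (3 / 2 - 3 / q - 1 / p) * sqrt (\<Sum>k\<in>S. (norm (a k))\<^sup>2)"
    if N: "N \<ge> 1" and \<tau>: "\<tau> > 0" and I: "finite I" and J: "\<forall>n\<in>I. of_int n * \<tau> \<in> {0..T}"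
      and S: "S \<subseteq> freq_box N" and \<phi>: "\<phi> = cos \<or> \<phi> = sin"
    for N \<tau> I S and a :: "int^3 \<Rightarrow> complex" and \<phi> :: "real \<Rightarrow> real"
  proof -
    have N0: "real N > 0" using N by simp
    let ?v = "\<lambda>n::int. wave_part \<phi> S a (of_int n * \<tau>)"
    define L where "L n = lpnorm torus q (?v n)" for n
    define Y where "Y = (\<Sum>n\<in>I. L n powr p)"
    have Y0: "Y \<ge> 0" unfolding Y_def by (intro sum_nonneg) auto
    define H where "H n = (\<lambda>x. of_real (L n powr (p - q) * norm (?v n x) powr (q - 2)) * ?v n x)" for n
    have p1: "p > 1" using p by simp
    have H: "H n \<in> bounded_measurable torus" "lpnorm torus (q / (q - 1)) (H n) = L n powr (p - 1)"
      "(\<integral>x. H n x * cnj (?v n x) \<partial>torus) = of_real (L n powr p)" for n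
      unfolding H_def L_def using dual_function[OF q _ p1, of "?v n"] by simp_all
    define \<mu> where "\<mu> d = fejer_weight N d * wave_symbol (real N) (2 * real N) d * (real N)\<^sup>2" for d
    have \<mu>0: "\<mu> d \<ge> 0" and \<mu>1: "\<mu> d \<le> 1" for d
      using fejer_weight_nonneg wave_symbol_nonneg wave_symbol_dyadic_le[OF N] by (auto simp: \<mu>_def)
    have \<mu>S: "\<mu> d \<ge> 1 / 56" if "d \<in> S" for d
      unfolding \<mu>_def using wave_symbol_dyadic[OF N] S that by blast
    let ?c = "\<lambda>n k. mode_integral (H n) k"
    let ?X = "\<lambda>n k. \<phi> (of_int n * \<tau> * norm (freq k))"
    have \<phi>1: "\<bar>\<phi> z\<bar> \<le> 1" for z using \<phi> by auto
    \<comment> \<open>The dual functions are chosen so that the pairing with the wave returns the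
      sum that is to be estimated.\<close>
    have left: "(\<Sum>n\<in>I. \<Sum>k\<in>S. of_real (?X n k) * a k * cnj (?c n k)) = of_real Y"
    proof -
      have "(\<Sum>k\<in>S. of_real (?X n k) * a k * cnj (?c n k)) = of_real (L n powr p)" for n
      proof -
        have "(\<Sum>k\<in>S. of_real (?X n k) * a k * cnj (?c n k)) = cnj (\<Sum>k\<in>S. cnj (of_real (?X n k) * a k) * mode_integral (H n) k)"
          by simp
        also have "\<dots> = cnj (\<integral>x. H n x * cnj (?v n x) \<partial>torus)"
          unfolding wave_part_def integral_mult_cnj_trig_poly[OF H(1)] ..
        also have "\<dots> = of_real (L n powr p)" unfolding H(3) by simp
        finally show ?thesis .
      qed
      then show ?thesis by (simp add: Y_def)
    qed
    define M where "M = K * real N powr (3 * \<theta> - \<alpha>) * \<tau> powr (- \<alpha>)"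
    have M0: "M \<ge> 0" using K by (simp add: M_def)
    have inner: "norm (\<Sum>k\<in>freq_box (2 * N). of_real (\<mu> k * ?X n k * ?X m k) * ?c n k * cnj (?c m k))
        \<le> (if n = m then M * (real N * \<tau>) powr \<alpha> else M * \<bar>real_of_int (n - m)\<bar> powr (- \<alpha>)) * (L n powr (p - 1) * L m powr (p - 1))"
      if nm: "n \<in> I" "m \<in> I" for n m
    proof -
      define z where "z = \<bar>of_int n * \<tau> - of_int m * \<tau>\<bar>"
      have z0: "z \<ge> 0" by (simp add: z_def)
      \<comment> \<open>The factor N^2 normalises the symbol of order -2 to size one on the cube;
        1/(2N) is 1/b.\<close>
      define \<beta> where "\<beta> = (real N)\<^sup>2 * (C1 / (z + 1 / (2 * real N)))"
      have den: "z + 1 / (2 * real N) > 0" using z0 N0 by (intro add_nonneg_pos) auto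
      have \<beta>: "\<beta> > 0" unfolding \<beta>_def using C1 N0 den by simp
      have sup: "norm (trig_poly (freq_box (2 * N)) (\<lambda>k. of_real (\<mu> k * ?X n k * ?X m k)) x) \<le> \<beta>" for x
      proof -
        have "trig_poly (freq_box (2 * N)) (\<lambda>k. of_real (\<mu> k * ?X n k * ?X m k)) x
          = of_real ((real N)\<^sup>2) * trig_poly (freq_box (2 * N)) (\<lambda>d. of_real (fejer_weight N d * wave_symbol (real N) (2 * real N) d *
            \<phi> (of_int n * \<tau> * norm (freq d)) * \<phi> (of_int m * \<tau> * norm (freq d)))) x"
          by (simp add: trig_poly_def \<mu>_def sum_distrib_left mult_ac)
        then have "norm (trig_poly (freq_box (2 * N)) (\<lambda>k. of_real (\<mu> k * ?X n k * ?X m k)) x)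
          = (real N)\<^sup>2 * norm (trig_poly (freq_box (2 * N)) (\<lambda>d. of_real (fejer_weight N d * wave_symbol (real N) (2 * real N) d *
            \<phi> (of_int n * \<tau> * norm (freq d)) * \<phi> (of_int m * \<tau> * norm (freq d)))) x)"
          by (simp only: norm_mult norm_of_real) simp
        also have "\<dots> \<le> \<beta>"
          unfolding \<beta>_def z_def using nm J N by (intro mult_left_mono kernel \<phi>) auto
        finally show ?thesis .
      qed
      have s1: "norm (\<Sum>k\<in>freq_box (2 * N). of_real (\<mu> k * ?X n k * ?X m k) * ?c n k * cnj (?c m k))
        \<le> C2 * \<beta> powr (1 - 2 / q) * lpnorm torus (q / (q - 1)) (H n) * lpnorm torus (q / (q - 1)) (H m)"
      proof (rule form)
        show "\<forall>k\<in>freq_box (2 * N). norm (complex_of_real (\<mu> k * ?X n k * ?X m k)) \<le> 1"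
        proof
          fix k
          have "\<bar>\<mu> k * ?X n k\<bar> \<le> 1" unfolding abs_mult using \<mu>0[of k] \<mu>1[of k] \<phi>1 by (intro mult_le_one) auto
          then have "\<bar>\<mu> k * ?X n k * ?X m k\<bar> \<le> 1"
            unfolding abs_mult[of "\<mu> k * ?X n k"] using \<phi>1 by (intro mult_le_one) auto
          then show "norm (complex_of_real (\<mu> k * ?X n k * ?X m k)) \<le> 1" by (simp only: norm_of_real)
        qed
        show "\<forall>x. norm (trig_poly (freq_box (2 * N)) (\<lambda>k. of_real (\<mu> k * ?X n k * ?X m k)) x) \<le> \<beta>"
          using sup by (rule allI)
      qed (rule finite_freq_box \<beta> H(1))+
      have s2: "C2 * \<beta> powr (1 - 2 / q) * x * y = C2 * \<beta> powr \<theta> * (x * y)" for x y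
        unfolding \<theta>_def by (rule mult.assoc)
      have s3: "C2 * \<beta> powr \<theta> * (L n powr (p - 1) * L m powr (p - 1)) \<le> (if n = m then M * (real N * \<tau>) powr \<alpha> else M * \<bar>real_of_int (n - m)\<bar> powr (- \<alpha>)) * (L n powr (p - 1) * L m powr (p - 1))"
      proof (rule mult_right_mono)
        have \<beta>\<theta>: "\<beta> powr \<theta> = real N powr (2 * \<theta>) * C1 powr \<theta> * (z + 1 / (2 * real N)) powr (- \<theta>)"
        proof -
          have e1: "\<beta> = real N powr 2 * (C1 * (1 / (z + 1 / (2 * real N))))" using N0 by (simp add: \<beta>_def)
          have e2: "(1 / w) powr \<theta> = w powr (- \<theta>)" if "w > 0" for w :: real
            using that by (simp add: powr_divide powr_minus_divide)
          show ?thesis unfolding e1 using e2[OF den] C1 den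
            by (simp only: powr_mult powr_powr powr_ge_zero mult.assoc)
        qed
        show "C2 * \<beta> powr \<theta> \<le> (if n = m then M * (real N * \<tau>) powr \<alpha> else M * \<bar>real_of_int (n - m)\<bar> powr (- \<alpha>))"
        proof (cases "n = m")
          case True
          \<comment> \<open>At equal times the denominator is just 1/(2N), so all of \<theta> turns
            into a power of N. Expressed through M this is the factor (N\<tau>)^\<alpha>.\<close>
          have "C2 * \<beta> powr \<theta> = C2 * (real N powr (2 * \<theta>) * C1 powr \<theta> * (2 powr \<theta> * real N powr \<theta>))"
            unfolding \<beta>\<theta> using True N0 by (simp add: z_def powr_minus powr_divide powr_mult)
          also have "\<dots> = K * (real N powr (2 * \<theta>) * real N powr \<theta>)" by (simp add: K_def mult_ac)
          also have "real N powr (2 * \<theta>) * real N powr \<theta> = real N powr (3 * \<theta> - \<alpha>) * real N powr \<alpha>"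
            by (simp add: powr_add[symmetric])
          also have "K * (real N powr (3 * \<theta> - \<alpha>) * real N powr \<alpha>) = M * (real N * \<tau>) powr \<alpha>"
            unfolding M_def using \<tau> N0 by (simp add: powr_mult powr_minus)
          finally show ?thesis using True by simp
        next
          case False
          then have zpos: "z > 0" using \<tau> by (simp add: z_def left_diff_distrib[symmetric])
          have zn: "z = \<bar>real_of_int (n - m)\<bar> * \<tau>"
            using \<tau> by (simp add: z_def left_diff_distrib[symmetric] abs_mult)
          \<comment> \<open>The power is split as \<alpha> + (\<theta> - \<alpha>): the first part
            keeps the time difference, the second only the cutoff scale.\<close>
          have "(z + 1 / (2 * real N)) powr (- \<theta>) = (z + 1 / (2 * real N)) powr (- \<alpha>) * (z + 1 / (2 * real N)) powr (- (\<theta> - \<alpha>))"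
            by (simp add: powr_add[symmetric])
          also have "\<dots> \<le> z powr (- \<alpha>) * (1 / (2 * real N)) powr (- (\<theta> - \<alpha>))"
            using zpos N0 \<theta> by (intro mult_mono powr_mono2') auto
          also have "(1 / (2 * real N)) powr (- (\<theta> - \<alpha>)) = (2 * real N) powr (\<theta> - \<alpha>)"
          proof -
            have inv: "(1 / w) powr (- e) = w powr e" if "w > 0" for w e :: real
              using that by (simp add: powr_divide powr_minus_divide)
            show ?thesis by (rule inv) (use N0 in simp)
          qed
          also have "\<dots> = 2 powr (\<theta> - \<alpha>) * real N powr (\<theta> - \<alpha>)" using N0 by (simp add: powr_mult)
          also have "z powr (- \<alpha>) * \<dots> \<le> z powr (- \<alpha>) * (2 powr \<theta> * real N powr (\<theta> - \<alpha>))"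
            using \<theta> by (intro mult_left_mono mult_right_mono powr_mono) auto
          finally have "(z + 1 / (2 * real N)) powr (- \<theta>) \<le> z powr (- \<alpha>) * (2 powr \<theta> * real N powr (\<theta> - \<alpha>))" .
          then have "C2 * \<beta> powr \<theta> \<le> C2 * (real N powr (2 * \<theta>) * C1 powr \<theta> * (z powr (- \<alpha>) * (2 powr \<theta> * real N powr (\<theta> - \<alpha>))))"
            unfolding \<beta>\<theta> using C2 by (intro mult_left_mono) auto
          also have "\<dots> = K * (real N powr (2 * \<theta>) * real N powr (\<theta> - \<alpha>)) * z powr (- \<alpha>)" by (simp add: K_def mult_ac)
          also have "real N powr (2 * \<theta>) * real N powr (\<theta> - \<alpha>) = real N powr (3 * \<theta> - \<alpha>)"
            by (simp add: powr_add[symmetric])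
          also have "K * real N powr (3 * \<theta> - \<alpha>) * z powr (- \<alpha>) = M * \<bar>real_of_int (n - m)\<bar> powr (- \<alpha>)"
            unfolding M_def zn using \<tau> by (simp add: powr_mult mult_ac)
          finally show ?thesis using False by simp
        qed
      qed simp
      show ?thesis using s1 s3 unfolding s2 H(2) by (rule order_trans)
    qed
    have "(norm (of_real Y :: complex))\<^sup>2
      \<le> (\<Sum>k\<in>S. (norm (a k))\<^sup>2 / \<mu> k) *
        (\<Sum>n\<in>I. \<Sum>m\<in>I. norm (\<Sum>k\<in>freq_box (2 * N). of_real (\<mu> k * ?X n k * ?X m k) * ?c n k * cnj (?c m k)))"
      unfolding left[symmetric]
    proof (rule TTstar_sum)
      show "S \<subseteq> freq_box (2 * N)" using S freq_box_mono[of N "2 * N"] by auto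
      show "\<mu> k > 0" if "k \<in> S" for k using \<mu>S[OF that] by linarith
    qed (use \<mu>0 in auto)
    also have "\<dots> \<le> (56 * (\<Sum>k\<in>S. (norm (a k))\<^sup>2)) * (M * ((real N * \<tau>) powr \<alpha> + B) * Y powr (2 * (p - 1) / p))"
    proof (rule mult_mono)
      show "(\<Sum>k\<in>S. (norm (a k))\<^sup>2 / \<mu> k) \<le> 56 * (\<Sum>k\<in>S. (norm (a k))\<^sup>2)"
        unfolding sum_distrib_left
      proof (rule sum_mono)
        fix k assume "k \<in> S"
        then have "(norm (a k))\<^sup>2 / \<mu> k \<le> (norm (a k))\<^sup>2 / (1 / 56)"
          using \<mu>S[of k] by (intro divide_left_mono mult_pos_pos) (auto intro: less_le_trans[of 0 "1/56"])
        then show "(norm (a k))\<^sup>2 / \<mu> k \<le> 56 * (norm (a k))\<^sup>2" by simp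
      qed
      let ?h = "\<lambda>n. L n powr (p - 1)"
      have hp: "?h n powr (p / (p - 1)) = L n powr p" for n using p1 by (simp add: powr_powr)
      have hY: "(\<Sum>n\<in>I. ?h n powr (p / (p - 1))) = Y" by (simp only: hp Y_def)
      have "(\<Sum>n\<in>I. \<Sum>m\<in>I. norm (\<Sum>k\<in>freq_box (2 * N). of_real (\<mu> k * ?X n k * ?X m k) * ?c n k * cnj (?c m k)))
        \<le> (\<Sum>n\<in>I. \<Sum>m\<in>I. (if n = m then M * (real N * \<tau>) powr \<alpha> else M * \<bar>real_of_int (n - m)\<bar> powr (- \<alpha>)) * (?h n * ?h m))"
        by (intro sum_mono inner)
      also have "\<dots> = (\<Sum>n\<in>I. M * (real N * \<tau>) powr \<alpha> * (?h n * ?h n) + (\<Sum>m\<in>I - {n}. M * \<bar>real_of_int (n - m)\<bar> powr (- \<alpha>) * (?h n * ?h m)))"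
      proof (intro sum.cong refl)
        fix n assume n: "n \<in> I"
        have "(\<Sum>m\<in>I - {n}. (if n = m then M * (real N * \<tau>) powr \<alpha> else M * \<bar>real_of_int (n - m)\<bar> powr (- \<alpha>)) * (?h n * ?h m))
          = (\<Sum>m\<in>I - {n}. M * \<bar>real_of_int (n - m)\<bar> powr (- \<alpha>) * (?h n * ?h m))"
          by (intro sum.cong refl) auto
        then show "(\<Sum>m\<in>I. (if n = m then M * (real N * \<tau>) powr \<alpha> else M * \<bar>real_of_int (n - m)\<bar> powr (- \<alpha>)) * (?h n * ?h m))
          = M * (real N * \<tau>) powr \<alpha> * (?h n * ?h n) + (\<Sum>m\<in>I - {n}. M * \<bar>real_of_int (n - m)\<bar> powr (- \<alpha>) * (?h n * ?h m))"
          by (subst sum.remove[OF I n]) simp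
      qed
      also have "\<dots> = M * (real N * \<tau>) powr \<alpha> * (\<Sum>n\<in>I. ?h n * ?h n) + M * (\<Sum>n\<in>I. \<Sum>m\<in>I - {n}. \<bar>real_of_int (n - m)\<bar> powr (- \<alpha>) * (?h n * ?h m))"
        by (simp add: sum.distrib sum_distrib_left mult.assoc)
      also have "\<dots> \<le> M * (real N * \<tau>) powr \<alpha> * Y powr (2 * (p - 1) / p) + M * (B * Y powr (2 * (p - 1) / p))"
      proof (intro add_mono mult_left_mono)
        have "(\<Sum>n\<in>I. ?h n * ?h n) = (\<Sum>n\<in>I. (L n powr p) powr (2 * (p - 1) / p))"
        proof (intro sum.cong refl)
          fix n
          have "p * (2 * (p - 1) / p) = (p - 1) + (p - 1)" using p by simp
          then show "?h n * ?h n = (L n powr p) powr (2 * (p - 1) / p)" by (simp only: powr_powr powr_add)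
        qed
        also have "\<dots> \<le> Y powr (2 * (p - 1) / p)"
          unfolding Y_def using p by (intro sum_powr_le_powr_sum I) (auto simp: field_simps)
        finally show "(\<Sum>n\<in>I. ?h n * ?h n) \<le> Y powr (2 * (p - 1) / p)" .
        show "(\<Sum>n\<in>I. \<Sum>m\<in>I - {n}. \<bar>real_of_int (n - m)\<bar> powr (- \<alpha>) * (?h n * ?h m)) \<le> B * Y powr (2 * (p - 1) / p)"
          using discrete_HLS[OF p I, of ?h] unfolding hY B_def \<alpha>_def by simp
      qed (use M0 in auto)
      finally show "(\<Sum>n\<in>I. \<Sum>m\<in>I. norm (\<Sum>k\<in>freq_box (2 * N). of_real (\<mu> k * ?X n k * ?X m k) * ?c n k * cnj (?c m k)))
        \<le> M * ((real N * \<tau>) powr \<alpha> + B) * Y powr (2 * (p - 1) / p)"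
        by (simp add: distrib_left distrib_right mult.assoc)
    qed (auto intro!: sum_nonneg)
    finally have Y2: "Y\<^sup>2 \<le> (56 * (\<Sum>k\<in>S. (norm (a k))\<^sup>2)) * (M * ((real N * \<tau>) powr \<alpha> + B) * Y powr (2 * (p - 1) / p))"
      using Y0 by simp
    let ?A = "\<Sum>k\<in>S. (norm (a k))\<^sup>2"
    have A0: "?A \<ge> 0" by (intro sum_nonneg) auto
    show ?thesis
    proof (cases "Y = 0")
      case True
      then show ?thesis using C0 A0 by (simp add: Y_def L_def)
    next
      case False
      then have Y: "Y > 0" using Y0 by simp
      \<comment> \<open>Both sides of \<open>Y2\<close> contain Y; cancelling the power 2(p - 1)/p
        leaves Y^(2/p), the square of the norm sought up to \<tau>.\<close>
      have "Y powr \<alpha> * Y powr (2 * (p - 1) / p) = Y powr 2"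
      proof -
        have "\<alpha> + 2 * (p - 1) / p = 2" using p by (simp add: \<alpha>_def field_simps)
        then show ?thesis by (simp only: powr_add[symmetric])
      qed
      also have "\<dots> = Y\<^sup>2" using Y by simp
      finally have "Y powr \<alpha> * Y powr (2 * (p - 1) / p) \<le> (56 * ?A * (M * ((real N * \<tau>) powr \<alpha> + B))) * Y powr (2 * (p - 1) / p)"
        using Y2 by (simp add: mult.assoc)
      then have "Y powr \<alpha> \<le> 56 * ?A * (M * ((real N * \<tau>) powr \<alpha> + B))"
        using Y by (simp only: mult_le_cancel_right_pos powr_gt_zero)
      also have "\<dots> \<le> 56 * ?A * (M * ((1 + B) * (1 + real N * \<tau>) powr \<alpha>))"
      proof (intro mult_left_mono)
        have "(real N * \<tau>) powr \<alpha> \<le> (1 + real N * \<tau>) powr \<alpha>"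
          using \<theta> N0 \<tau> by (intro powr_mono2) auto
        moreover have "B * 1 \<le> B * (1 + real N * \<tau>) powr \<alpha>"
          using B \<theta> N0 \<tau> by (intro mult_left_mono ge_one_powr_ge_zero) auto
        ultimately show "(real N * \<tau>) powr \<alpha> + B \<le> (1 + B) * (1 + real N * \<tau>) powr \<alpha>"
          by (simp add: distrib_right)
      qed (use A0 M0 in auto)
      finally have "\<tau> powr \<alpha> * Y powr \<alpha> \<le> \<tau> powr \<alpha> * (56 * ?A * (M * ((1 + B) * (1 + real N * \<tau>) powr \<alpha>)))"
        by (intro mult_left_mono) auto
      also have "\<dots> = (56 * K * (1 + B)) * (1 + real N * \<tau>) powr \<alpha> * real N powr (3 * \<theta> - \<alpha>) * ?A"
        unfolding M_def using \<tau> by (simp add: powr_minus)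
      also have "(1 + real N * \<tau>) powr \<alpha> = ((1 + real N * \<tau>) powr (1 / p))\<^sup>2"
      proof -
        have "\<alpha> = 1 / p * 2" by (simp add: \<alpha>_def)
        then show ?thesis by (simp only: powr_powr[symmetric]) simp
      qed
      also have "real N powr (3 * \<theta> - \<alpha>) = (real N powr (3 / 2 - 3 / q - 1 / p))\<^sup>2"
      proof -
        have "3 * \<theta> - \<alpha> = (3 / 2 - 3 / q - 1 / p) * 2" by (simp add: \<alpha>_def \<theta>_def field_simps)
        then show ?thesis by (simp only: powr_powr[symmetric]) simp
      qed
      also have "\<tau> powr \<alpha> * Y powr \<alpha> = ((\<tau> * Y) powr (1 / p))\<^sup>2"
      proof -
        have "\<alpha> = 1 / p * 2" by (simp add: \<alpha>_def)
        then show ?thesis using \<tau> Y by (simp only: powr_powr[symmetric] powr_mult[symmetric]) simp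
      qed
      finally have "((\<tau> * Y) powr (1 / p))\<^sup>2 \<le> 56 * K * (1 + B) * ((1 + real N * \<tau>) powr (1 / p))\<^sup>2 * (real N powr (3 / 2 - 3 / q - 1 / p))\<^sup>2 * ?A" .
      then have "sqrt (((\<tau> * Y) powr (1 / p))\<^sup>2) \<le> sqrt (56 * K * (1 + B) * ((1 + real N * \<tau>) powr (1 / p))\<^sup>2 * (real N powr (3 / 2 - 3 / q - 1 / p))\<^sup>2 * ?A)"
        by (rule real_sqrt_le_mono)
      then show ?thesis unfolding Y_def L_def C_def by (simp add: real_sqrt_mult)
    qed
  qed
  show ?thesis using C0 main by blast
qed

section \<open>The endpoint\<close>

text \<open>Each term equals 1 - x with x the quotient of consecutive denominators, and 1 - x \<le>
  - ln x makes the sum telescope.\<close>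

lemma log_telescope:
  fixes \<tau> s :: real
  assumes "\<tau> > 0" "s > 0"
  shows "(\<Sum>j=1..M. \<tau> / (real j * \<tau> + s)) \<le> ln ((real M * \<tau> + s) / s)"
proof (induction M)
  case (Suc M)
  let ?a = "real M * \<tau> + s" and ?b = "real (Suc M) * \<tau> + s"
  have ab: "?a > 0" "?b > 0" using assms by (auto intro: add_nonneg_pos)
  have "\<tau> / ?b = 1 - ?a / ?b" using ab by (simp add: field_simps)
  also have "\<dots> \<le> - ln (?a / ?b)"
    using ln_le_minus_one[of "?a / ?b"] ab by simp
  also have "\<dots> = ln (?b / s) - ln (?a / s)" using ab assms by (simp add: ln_div)
  finally show ?case using Suc.IH by simp
qed (use assms in simp)

text \<open>The sup norm is represented by evaluation at points X n, so the dual objects are point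
  masses and the dispersive bound acts on them directly, without interpolation. A Schur test over
  the time grid finishes: the kernel decays like 1/t, whose sum is a logarithm. The symbol with a =
  1 and b = 2K matches the H^1 weight on the whole cube, so no dyadic decomposition occurs.\<close>

theorem endpoint_strichartz:
  assumes T: "T \<ge> 0"
  shows "\<exists>C\<ge>0. \<forall>K \<tau> I S a \<phi> X. K \<ge> 1 \<longrightarrow> \<tau> > 0 \<longrightarrow> finite I \<longrightarrow> (\<forall>n\<in>I. of_int n * \<tau> \<in> {0..T}) \<longrightarrow>
     S \<subseteq> freq_box (nat \<lfloor>K\<rfloor>) \<longrightarrow> \<phi> = cos \<or> \<phi> = sin \<longrightarrow>
     \<tau> * (\<Sum>n\<in>I. (norm (wave_part \<phi> S a (of_int n * \<tau>) (X n)))\<^sup>2)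
       \<le> C * (1 + K * \<tau> + ln K) * (\<Sum>k\<in>S. (1 + (norm (freq k))\<^sup>2) * (norm (a k))\<^sup>2)"
proof -
  obtain C1 where C1: "C1 > 0" and kernel: "\<And>n a b \<tau> (i::int) (j::int) \<phi> x. \<lbrakk>\<phi> = cos \<or> \<phi> = sin; 1 \<le> a; 2 * a \<le> b;
    i * \<tau> \<in> {0..T}; j * \<tau> \<in> {0..T}\<rbrakk> \<Longrightarrow>
    norm (trig_poly (freq_box (2 * n)) (\<lambda>d. of_real (fejer_weight n d * wave_symbol a b d *
        \<phi> (i * \<tau> * norm (freq d)) * \<phi> (j * \<tau> * norm (freq d)))) x)
      \<le> C1 / (\<bar>i * \<tau> - j * \<tau>\<bar> + 1 / b)"
    using wave_pair_kernel_bound[OF T] that by (elim exE conjE) blast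
  define L where "L = ln (1 + 2 * T)"
  have L0: "L \<ge> 0" using T by (simp add: L_def)
  define C where "C = 14 * (2 * C1 * (1 + L))"
  have C0: "C \<ge> 0" using C1 L0 by (simp add: C_def)
  have main: "\<tau> * (\<Sum>n\<in>I. (norm (wave_part \<phi> S a (of_int n * \<tau>) (X n)))\<^sup>2)
       \<le> C * (1 + K * \<tau> + ln K) * (\<Sum>k\<in>S. (1 + (norm (freq k))\<^sup>2) * (norm (a k))\<^sup>2)"
    if K: "K \<ge> 1" and \<tau>: "\<tau> > 0" and I: "finite I" and J: "\<forall>n\<in>I. of_int n * \<tau> \<in> {0..T}"
      and S: "S \<subseteq> freq_box (nat \<lfloor>K\<rfloor>)" and \<phi>: "\<phi> = cos \<or> \<phi> = sin"
    for K \<tau> I S and a :: "int^3 \<Rightarrow> complex" and \<phi> :: "real \<Rightarrow> real" and X :: "int \<Rightarrow> real^3"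
  proof -
    let ?N = "nat \<lfloor>K\<rfloor>"
    have NK: "real ?N \<le> K" using K by linarith
    define V where "V n = wave_part \<phi> S a (of_int n * \<tau>) (X n)" for n
    define Y where "Y = (\<Sum>n\<in>I. (norm (V n))\<^sup>2)"
    have Y0: "Y \<ge> 0" unfolding Y_def by (intro sum_nonneg) auto
    define \<mu> where "\<mu> d = fejer_weight ?N d * wave_symbol 1 (2 * K) d" for d
    have \<mu>0: "\<mu> d \<ge> 0" for d unfolding \<mu>_def using fejer_weight_nonneg wave_symbol_nonneg by simp
    \<comment> \<open>In the cube |d|^2 \<le> 3 K^2, so the quotient 4 K^2 / (4 K^2 + |d|^2) is at
      least 4/7; times the Fejer bound 1/8 this is 1/14.\<close>
    have \<mu>S: "\<mu> d \<ge> 1 / (14 * (1 + (norm (freq d))\<^sup>2))" if "d \<in> S" for d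
    proof -
      let ?r = "(norm (freq d))\<^sup>2"
      have d: "d \<in> freq_box ?N" using S that by auto
      have "?r \<le> 3 * (real ?N)\<^sup>2" by (rule norm_freq_box_le[OF d])
      also have "\<dots> \<le> 3 * K\<^sup>2" using NK by (intro mult_left_mono power_mono) auto
      finally have r: "?r \<le> 3 * K\<^sup>2" .
      have K2: "K\<^sup>2 > 0" using K by simp
      have r0: "1 + ?r > 0" by (intro add_pos_nonneg) auto
      have "4 / (7 * (1 + ?r)) = 4 * K\<^sup>2 / ((1 + ?r) * (7 * K\<^sup>2))" using K2 by simp
      also have "\<dots> \<le> 4 * K\<^sup>2 / ((1 + ?r) * (4 * K\<^sup>2 + ?r))"
        using r K2 r0 by (intro divide_left_mono mult_left_mono mult_pos_pos add_pos_nonneg) auto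
      also have "\<dots> = wave_symbol 1 (2 * K) d"
        by (simp add: wave_symbol_def power_mult_distrib)
      finally have "1 / 8 * (4 / (7 * (1 + ?r))) \<le> \<mu> d"
        unfolding \<mu>_def using r0 by (intro mult_mono fejer_weight_ge d fejer_weight_nonneg) auto
      then show ?thesis by simp
    qed
    let ?X = "\<lambda>n k. \<phi> (of_int n * \<tau> * norm (freq k))"
    \<comment> \<open>Plays the role of the mode integrals of a point mass at X n with amplitude V
      n.\<close>
    define c where "c n k = cnj (fourier_mode k (X n)) * V n" for n k
    have left: "(\<Sum>n\<in>I. \<Sum>k\<in>S. of_real (?X n k) * a k * cnj (c n k)) = of_real Y"
    proof -
      have "(\<Sum>k\<in>S. of_real (?X n k) * a k * cnj (c n k)) = of_real ((norm (V n))\<^sup>2)" for n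
      proof -
        have "(\<Sum>k\<in>S. of_real (?X n k) * a k * cnj (c n k)) = V n * cnj (V n)"
          unfolding c_def by (simp add: V_def wave_part_def trig_poly_def sum_distrib_right mult.assoc)
        then show ?thesis by (simp only: complex_norm_square)
      qed
      then show ?thesis by (simp add: Y_def)
    qed
    define s where "s = 1 / (2 * K)"
    have s: "s > 0" using K by (simp add: s_def)
    define \<beta> where "\<beta> n m = C1 / (\<bar>of_int n * \<tau> - of_int m * \<tau>\<bar> + s)" for n m :: int
    have \<beta>0: "\<beta> n m \<ge> 0" for n m using C1 s by (simp add: \<beta>_def)
    have \<beta>_sym: "\<beta> n m = \<beta> m n" for n m by (simp add: \<beta>_def abs_minus_commute)
    have inner: "norm (\<Sum>k\<in>freq_box (2 * ?N). of_real (\<mu> k * ?X n k * ?X m k) * c n k * cnj (c m k))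
        \<le> (\<beta> n m * (norm (V n))\<^sup>2 + \<beta> n m * (norm (V m))\<^sup>2) / 2"
      if nm: "n \<in> I" "m \<in> I" for n m
    proof -
      have "(\<Sum>k\<in>freq_box (2 * ?N). of_real (\<mu> k * ?X n k * ?X m k) * c n k * cnj (c m k))
        = trig_poly (freq_box (2 * ?N)) (\<lambda>d. of_real (fejer_weight ?N d * wave_symbol 1 (2 * K) d *
            \<phi> (of_int n * \<tau> * norm (freq d)) * \<phi> (of_int m * \<tau> * norm (freq d)))) (X m - X n) * (V n * cnj (V m))"
        unfolding trig_poly_def sum_distrib_right
        by (intro sum.cong refl) (simp add: c_def \<mu>_def fourier_mode_diff_right mult_ac)
      then have "norm (\<Sum>k\<in>freq_box (2 * ?N). of_real (\<mu> k * ?X n k * ?X m k) * c n k * cnj (c m k))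
        \<le> \<beta> n m * (norm (V n) * norm (V m))"
        unfolding \<beta>_def s_def using nm J K by (simp only: norm_mult complex_mod_cnj) (intro mult_right_mono kernel \<phi>, auto)
      \<comment> \<open>Symmetrisation for the Schur test: afterwards only row sums of \<beta> are
        needed.\<close>
      also have "\<dots> \<le> \<beta> n m * (((norm (V n))\<^sup>2 + (norm (V m))\<^sup>2) / 2)"
        using sum_squares_bound[of "norm (V n)" "norm (V m)"] by (intro mult_left_mono \<beta>0) simp
      finally show ?thesis by (simp add: distrib_left)
    qed
    define R where "R = 2 * C1 * (K * \<tau> + (L + ln K))"
    have row: "\<tau> * (\<Sum>m\<in>I. \<beta> n m) \<le> R" if n: "n \<in> I" for n
    proof -
      let ?g = "\<lambda>j. C1 / (real j * \<tau> + s)"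
      let ?M = "nat \<lfloor>T / \<tau>\<rfloor>"
      have \<beta>g: "\<beta> n m = ?g (nat \<bar>n - m\<bar>)" for m
        using \<tau> by (simp add: \<beta>_def left_diff_distrib[symmetric] abs_mult)
      have "(\<Sum>m\<in>I. \<beta> n m) = \<beta> n n + (\<Sum>m\<in>I - {n}. \<beta> n m)"
        by (rule sum.remove[OF I n])
      also have "(\<Sum>m\<in>I - {n}. \<beta> n m) \<le> 2 * (\<Sum>j\<in>{1..?M}. ?g j)"
        unfolding \<beta>g
      proof (rule sum_int_distance_le)
        fix m assume m: "m \<in> I - {n}"
        have "\<bar>of_int n * \<tau> - of_int m * \<tau>\<bar> \<le> T" using m n J by (auto simp: abs_le_iff) (smt (verit) atLeastAtMost_iff)+
        then have "real_of_int \<bar>n - m\<bar> \<le> T / \<tau>"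
          using \<tau> by (simp add: left_diff_distrib[symmetric] abs_mult pos_le_divide_eq)
        then have "\<bar>n - m\<bar> \<le> \<lfloor>T / \<tau>\<rfloor>" by (simp add: le_floor_iff)
        then show "m \<noteq> n \<and> nat \<bar>n - m\<bar> \<in> {1..?M}" using m by auto
      qed (use I C1 \<tau> s in auto)
      \<comment> \<open>The diagonal has size 1/s = 2K; multiplied by the step it is the term
        K\<tau> of the final bound.\<close>
      also have "\<beta> n n = 2 * K * C1" using K by (simp add: \<beta>_def s_def)
      finally have "\<tau> * (\<Sum>m\<in>I. \<beta> n m) \<le> \<tau> * (2 * K * C1 + 2 * (\<Sum>j\<in>{1..?M}. ?g j))"
        using \<tau> by (intro mult_left_mono) auto
      also have "\<dots> = 2 * C1 * (K * \<tau> + (\<Sum>j=1..?M. \<tau> / (real j * \<tau> + s)))"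
        by (simp add: distrib_left sum_distrib_left mult_ac)
      also have "\<dots> \<le> 2 * C1 * (K * \<tau> + (L + ln K))"
      proof (intro mult_left_mono add_left_mono)
        have "(\<Sum>j=1..?M. \<tau> / (real j * \<tau> + s)) \<le> ln ((real ?M * \<tau> + s) / s)"
          by (rule log_telescope[OF \<tau> s])
        also have "\<dots> \<le> ln (K * (1 + 2 * T))"
        proof -
          have "real ?M \<le> T / \<tau>" using T \<tau> by (simp add: of_nat_floor)
          then have "real ?M * \<tau> \<le> T" using \<tau> by (simp add: pos_le_divide_eq)
          then have "(real ?M * \<tau> + s) / s \<le> (T + s) / s" using s by (intro divide_right_mono) auto
          \<comment> \<open>Since K \<ge> 1 this is at most K (1 + 2T), whose logarithm separates
            into ln K and the constant L, which depends on T alone.\<close>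
          also have "\<dots> = 1 + 2 * K * T" using K by (simp add: s_def field_simps)
          also have "\<dots> \<le> K * (1 + 2 * T)" using K by (simp add: algebra_simps)
          finally have "(real ?M * \<tau> + s) / s \<le> K * (1 + 2 * T)" .
          moreover have "(real ?M * \<tau> + s) / s > 0" using \<tau> s by (intro divide_pos_pos add_nonneg_pos) auto
          ultimately show ?thesis by (simp only: ln_mono)
        qed
        also have "\<dots> = L + ln K" using K T by (simp add: L_def ln_mult)
        finally show "(\<Sum>j=1..?M. \<tau> / (real j * \<tau> + s)) \<le> L + ln K" .
      qed (use C1 in auto)
      finally show ?thesis unfolding R_def .
    qed
    have schur: "\<tau> * (\<Sum>n\<in>I. \<Sum>m\<in>I. (\<beta> n m * (norm (V n))\<^sup>2 + \<beta> n m * (norm (V m))\<^sup>2) / 2) \<le> R * Y"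
    proof -
      have A: "\<tau> * (\<Sum>n\<in>I. \<Sum>m\<in>I. \<beta> n m * (norm (V n))\<^sup>2) \<le> R * Y"
      proof -
        have "\<tau> * (\<Sum>n\<in>I. \<Sum>m\<in>I. \<beta> n m * (norm (V n))\<^sup>2) = (\<Sum>n\<in>I. (\<tau> * (\<Sum>m\<in>I. \<beta> n m)) * (norm (V n))\<^sup>2)"
          by (simp add: sum_distrib_left sum_distrib_right mult.assoc)
        also have "\<dots> \<le> (\<Sum>n\<in>I. R * (norm (V n))\<^sup>2)" by (intro sum_mono mult_right_mono row) auto
        finally show ?thesis by (simp add: Y_def sum_distrib_left)
      qed
      have "(\<Sum>n\<in>I. \<Sum>m\<in>I. \<beta> n m * (norm (V m))\<^sup>2) = (\<Sum>n\<in>I. \<Sum>m\<in>I. \<beta> n m * (norm (V n))\<^sup>2)"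
        by (subst sum.swap) (simp add: \<beta>_sym)
      then have "(\<Sum>n\<in>I. \<Sum>m\<in>I. (\<beta> n m * (norm (V n))\<^sup>2 + \<beta> n m * (norm (V m))\<^sup>2) / 2) = (\<Sum>n\<in>I. \<Sum>m\<in>I. \<beta> n m * (norm (V n))\<^sup>2)"
        by (simp add: sum_divide_distrib[symmetric] sum.distrib)
      then show ?thesis using A by simp
    qed
    let ?A = "\<Sum>k\<in>S. (1 + (norm (freq k))\<^sup>2) * (norm (a k))\<^sup>2"
    have A0: "?A \<ge> 0" by (intro sum_nonneg mult_nonneg_nonneg) auto
    have "(norm (of_real Y :: complex))\<^sup>2
      \<le> (\<Sum>k\<in>S. (norm (a k))\<^sup>2 / \<mu> k) *
        (\<Sum>n\<in>I. \<Sum>m\<in>I. norm (\<Sum>k\<in>freq_box (2 * ?N). of_real (\<mu> k * ?X n k * ?X m k) * c n k * cnj (c m k)))"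
      unfolding left[symmetric]
    proof (rule TTstar_sum)
      show "S \<subseteq> freq_box (2 * ?N)" using S freq_box_mono[of ?N "2 * ?N"] by auto
      show "\<mu> k > 0" if "k \<in> S" for k
        by (rule less_le_trans[OF _ \<mu>S[OF that]]) (simp add: add_pos_nonneg)
    qed (use \<mu>0 in auto)
    also have "\<dots> \<le> (14 * ?A) * (\<Sum>n\<in>I. \<Sum>m\<in>I. (\<beta> n m * (norm (V n))\<^sup>2 + \<beta> n m * (norm (V m))\<^sup>2) / 2)"
    proof (rule mult_mono)
      show "(\<Sum>k\<in>S. (norm (a k))\<^sup>2 / \<mu> k) \<le> 14 * ?A"
        unfolding sum_distrib_left
      proof (rule sum_mono)
        fix k assume k: "k \<in> S"
        have p: "1 / (14 * (1 + (norm (freq k))\<^sup>2)) > 0" by (simp add: add_pos_nonneg)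
        have "(norm (a k))\<^sup>2 / \<mu> k \<le> (norm (a k))\<^sup>2 / (1 / (14 * (1 + (norm (freq k))\<^sup>2)))"
          using \<mu>S[OF k] p less_le_trans[OF p \<mu>S[OF k]] by (intro divide_left_mono mult_pos_pos) auto
        then show "(norm (a k))\<^sup>2 / \<mu> k \<le> 14 * ((1 + (norm (freq k))\<^sup>2) * (norm (a k))\<^sup>2)" by (simp add: algebra_simps)
      qed
      show "(\<Sum>n\<in>I. \<Sum>m\<in>I. norm (\<Sum>k\<in>freq_box (2 * ?N). of_real (\<mu> k * ?X n k * ?X m k) * c n k * cnj (c m k)))
        \<le> (\<Sum>n\<in>I. \<Sum>m\<in>I. (\<beta> n m * (norm (V n))\<^sup>2 + \<beta> n m * (norm (V m))\<^sup>2) / 2)"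
        by (intro sum_mono inner)
    qed (use A0 in \<open>auto intro!: sum_nonneg\<close>)
    finally have "\<tau> * Y\<^sup>2 \<le> \<tau> * ((14 * ?A) * (\<Sum>n\<in>I. \<Sum>m\<in>I. (\<beta> n m * (norm (V n))\<^sup>2 + \<beta> n m * (norm (V m))\<^sup>2) / 2))"
      using Y0 \<tau> by (intro mult_left_mono) auto
    also have "\<dots> = (14 * ?A) * (\<tau> * (\<Sum>n\<in>I. \<Sum>m\<in>I. (\<beta> n m * (norm (V n))\<^sup>2 + \<beta> n m * (norm (V m))\<^sup>2) / 2))"
      by simp
    also have "\<dots> \<le> (14 * ?A) * (R * Y)" using A0 by (intro mult_left_mono schur) auto
    finally have le: "(\<tau> * Y) * Y \<le> (14 * ?A * R) * Y" by (simp add: power2_eq_square mult.assoc)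
    have Kt: "K * \<tau> \<ge> 0" "ln K \<ge> 0" using K \<tau> by auto
    have R0: "R \<ge> 0" unfolding R_def using C1 Kt L0 by simp
    have "\<tau> * Y \<le> 14 * ?A * R"
    proof (cases "Y = 0")
      case True
      then show ?thesis using A0 R0 by simp
    next
      case False
      then have "Y > 0" using Y0 by simp
      then show ?thesis using le by (simp only: mult_le_cancel_right_pos)
    qed
    also have "\<dots> \<le> 14 * ?A * (2 * C1 * ((1 + L) * (1 + K * \<tau> + ln K)))"
      unfolding R_def
    proof (intro mult_left_mono)
      have "0 \<le> L * (K * \<tau> + ln K)" using L0 Kt by simp
      then show "K * \<tau> + (L + ln K) \<le> (1 + L) * (1 + K * \<tau> + ln K)"
        by (simp add: distrib_left distrib_right)
    qed (use A0 C1 in auto)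
    also have "\<dots> = C * (1 + K * \<tau> + ln K) * ?A" by (simp only: C_def mult.assoc mult.commute mult.left_commute)
    finally show ?thesis unfolding Y_def V_def .
  qed
  show ?thesis using C0 main by blast
qed

section \<open>Summation over dyadic pieces\<close>

lemma lpnorm_half_square:
  assumes "q > 0"
  shows "lpnorm M (q / 2) (\<lambda>x. (norm (f x))\<^sup>2) = (lpnorm M q f)\<^sup>2"
proof -
  have e: "norm ((norm (f x))\<^sup>2) powr (q / 2) = norm (f x) powr q" for x
  proof -
    have "norm ((norm (f x))\<^sup>2) = norm (f x) powr 2" by simp
    then show ?thesis by (simp only: powr_powr) simp
  qed
  have "2 / q = 1 / q * 2" by simp
  then show ?thesis unfolding lpnorm_def e by (simp only: divide_divide_eq_right mult_1 powr_powr[symmetric]) simp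
qed

lemma sum_norm_squared_le:
  fixes w :: "'i \<Rightarrow> 'a::real_normed_vector"
  shows "(norm (\<Sum>j\<in>P. w j))\<^sup>2 \<le> (\<Sum>p\<in>P \<times> P. norm (w (fst p)) * norm (w (snd p)))"
proof -
  have "(norm (\<Sum>j\<in>P. w j))\<^sup>2 \<le> (\<Sum>j\<in>P. norm (w j))\<^sup>2" by (intro power_mono norm_sum) auto
  then show ?thesis by (simp add: power2_eq_square sum_product sum.cartesian_product case_prod_beta)
qed

text \<open>
  The Littlewood--Paley square function is avoided by expanding the square of the sum: the
  product of two pieces is estimated with two different pairs of exponents.
\<close>

lemma (in finite_measure) lpnorm_sum_squared_le:
  fixes w :: "'i \<Rightarrow> 'a \<Rightarrow> complex"
  assumes P: "finite P" and w: "\<And>j. j \<in> P \<Longrightarrow> w j \<in> bounded_measurable M" and q: "q \<ge> 2"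
  shows "(lpnorm M q (\<lambda>x. \<Sum>j\<in>P. w j x))\<^sup>2 \<le> (\<Sum>p\<in>P \<times> P. lpnorm M (q / 2) (\<lambda>x. w (fst p) x * w (snd p) x))"
proof -
  let ?g = "\<lambda>p x. norm (w (fst p) x * w (snd p) x)"
  have wm[measurable]: "w j \<in> borel_measurable M" if "j \<in> P" for j
    using w[OF that] by (rule bounded_measurable_measurable)
  have prod: "(\<lambda>x. w i x * w j x) \<in> bounded_measurable M" if ij: "i \<in> P" "j \<in> P" for i j
  proof -
    obtain c d where c: "\<And>x. norm (w i x) \<le> c" and d: "\<And>x. norm (w j x) \<le> d"
      using w[OF ij(1)] w[OF ij(2)] by (auto simp: bounded_measurable_def)
    show ?thesis
      by (rule bounded_measurableI[where c="c * d"])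
         (use ij in \<open>auto simp: norm_mult intro!: mult_mono c d order_trans[OF norm_ge_zero c]\<close>)
  qed
  have S: "(\<lambda>x. complex_of_real (\<Sum>p\<in>P \<times> P. ?g p x)) \<in> bounded_measurable M"
  proof -
    have "\<exists>c. \<forall>x. ?g p x \<le> c" if "p \<in> P \<times> P" for p
      using prod[of "fst p" "snd p"] that by (auto simp: bounded_measurable_def)
    then obtain c where c: "\<And>p x. p \<in> P \<times> P \<Longrightarrow> ?g p x \<le> c p" by metis
    show ?thesis
    proof (rule bounded_measurableI[where c="\<Sum>p\<in>P \<times> P. c p"])
      have "norm (complex_of_real (\<Sum>p\<in>P \<times> P. ?g p x)) = (\<Sum>p\<in>P \<times> P. ?g p x)" for x
        unfolding norm_of_real by (intro abs_of_nonneg sum_nonneg) auto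
      then show "norm (complex_of_real (\<Sum>p\<in>P \<times> P. ?g p x)) \<le> (\<Sum>p\<in>P \<times> P. c p)" for x
        using c by (auto intro: sum_mono)
    qed (use P in \<open>auto intro!: borel_measurable_sum\<close>)
  qed
  have nS: "norm (complex_of_real (\<Sum>p\<in>P \<times> P. ?g p x)) = (\<Sum>p\<in>P \<times> P. ?g p x)" for x
    unfolding norm_of_real by (intro abs_of_nonneg sum_nonneg) auto
  have iS: "integrable M (\<lambda>x. (\<Sum>p\<in>P \<times> P. ?g p x) powr (q / 2))"
    using integrable_norm_powr[OF S, of "q / 2"] q unfolding nS by simp
  have "(lpnorm M q (\<lambda>x. \<Sum>j\<in>P. w j x))\<^sup>2 = lpnorm M (q / 2) (\<lambda>x. (norm (\<Sum>j\<in>P. w j x))\<^sup>2)"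
    using q by (simp add: lpnorm_half_square)
  also have "\<dots> \<le> lpnorm M (q / 2) (\<lambda>x. \<Sum>p\<in>P \<times> P. ?g p x)"
  proof (rule lpnorm_mono)
    fix x
    have "(norm (\<Sum>j\<in>P. w j x))\<^sup>2 \<le> (\<Sum>p\<in>P \<times> P. ?g p x)"
      using sum_norm_squared_le[of "\<lambda>j. w j x" P] by (simp add: norm_mult)
    then show "norm ((norm (\<Sum>j\<in>P. w j x))\<^sup>2) \<le> norm (\<Sum>p\<in>P \<times> P. ?g p x)" by simp
  next
    have "norm (\<Sum>p\<in>P \<times> P. ?g p x) = (\<Sum>p\<in>P \<times> P. ?g p x)" for x
      unfolding real_norm_def by (intro abs_of_nonneg sum_nonneg) auto
    then show "integrable M (\<lambda>x. norm (\<Sum>p\<in>P \<times> P. ?g p x) powr (q / 2))" using iS by simp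
  qed (use q P in \<open>auto intro!: borel_measurable_power borel_measurable_norm borel_measurable_sum\<close>)
  also have "\<dots> \<le> (\<Sum>p\<in>P \<times> P. lpnorm M (q / 2) (?g p))"
  proof (rule lpnorm_sum_le)
    show "?g p \<in> borel_measurable M" if "p \<in> P \<times> P" for p
      using prod[of "fst p" "snd p"] that by (auto dest: bounded_measurable_measurable)
    show "integrable M (\<lambda>x. ?g p x powr (q / 2))" if "p \<in> P \<times> P" for p
      using prod[of "fst p" "snd p"] that q by (intro integrable_norm_powr) auto
  qed (use P q iS in auto)
  finally show ?thesis by simp
qed

text \<open>A symmetric matrix with geometric decay off the diagonal: its row sums are at most 1
  plus two geometric series, and 2 A i A j \<le> (A i)^2 + (A j)^2 reduces the form to row
  sums.\<close>

lemma schur_geometric: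
  fixes A :: "nat \<Rightarrow> real" and \<rho> :: real
  assumes P: "finite P" and \<rho>: "0 < \<rho>" "\<rho> < 1"
  shows "(\<Sum>p\<in>P \<times> P. \<rho> ^ nat \<bar>int (fst p) - int (snd p)\<bar> * (A (fst p) * A (snd p))) \<le> (1 + 2 / (1 - \<rho>)) * (\<Sum>j\<in>P. (A j)\<^sup>2)"
proof -
  let ?r = "\<lambda>i j. \<rho> ^ nat \<bar>int i - int j\<bar>"
  have row: "(\<Sum>j\<in>P. ?r i j) \<le> 1 + 2 / (1 - \<rho>)" if "i \<in> P" for i
  proof -
    have "(\<Sum>j\<in>P. ?r i j) = 1 + (\<Sum>j\<in>P - {i}. ?r i j)"
      by (subst sum.remove[OF P that]) simp
    also have "(\<Sum>j\<in>P - {i}. ?r i j) = (\<Sum>m\<in>int ` (P - {i}). \<rho> ^ nat \<bar>int i - m\<bar>)"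
      by (subst sum.reindex) (auto simp: inj_on_def)
    also have "\<dots> \<le> 2 * (\<Sum>k\<in>(\<lambda>j. nat \<bar>int i - int j\<bar>) ` P. \<rho> ^ k)"
      by (rule sum_int_distance_le) (use P \<rho> in auto)
    also have "\<dots> \<le> 2 * (1 / (1 - \<rho>))"
    proof (rule mult_left_mono)
      have s: "summable (\<lambda>k. \<rho> ^ k)" using \<rho> by (intro summable_geometric) auto
      have "(\<Sum>k\<in>(\<lambda>j. nat \<bar>int i - int j\<bar>) ` P. \<rho> ^ k) \<le> (\<Sum>k. \<rho> ^ k)"
        by (rule sum_le_suminf[OF s]) (use P \<rho> in auto)
      also have "\<dots> = 1 / (1 - \<rho>)" using \<rho> by (intro suminf_geometric) auto
      finally show "(\<Sum>k\<in>(\<lambda>j. nat \<bar>int i - int j\<bar>) ` P. \<rho> ^ k) \<le> 1 / (1 - \<rho>)" .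
    qed simp
    finally show ?thesis by simp
  qed
  have "(\<Sum>p\<in>P \<times> P. ?r (fst p) (snd p) * (A (fst p) * A (snd p)))
    \<le> (\<Sum>p\<in>P \<times> P. (?r (fst p) (snd p) * (A (fst p))\<^sup>2 + ?r (fst p) (snd p) * (A (snd p))\<^sup>2) / 2)"
  proof (rule sum_mono)
    fix p
    have "?r (fst p) (snd p) * (A (fst p) * A (snd p)) \<le> ?r (fst p) (snd p) * (((A (fst p))\<^sup>2 + (A (snd p))\<^sup>2) / 2)"
      using sum_squares_bound[of "A (fst p)" "A (snd p)"] \<rho> by (intro mult_left_mono) auto
    then show "?r (fst p) (snd p) * (A (fst p) * A (snd p)) \<le> (?r (fst p) (snd p) * (A (fst p))\<^sup>2 + ?r (fst p) (snd p) * (A (snd p))\<^sup>2) / 2"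
      by (simp add: distrib_left)
  qed
  also have "\<dots> = ((\<Sum>i\<in>P. \<Sum>j\<in>P. ?r i j * (A i)\<^sup>2) + (\<Sum>i\<in>P. \<Sum>j\<in>P. ?r i j * (A j)\<^sup>2)) / 2"
    by (simp add: sum.cartesian_product case_prod_beta sum.distrib sum_divide_distrib add_divide_distrib)
  also have "(\<Sum>i\<in>P. \<Sum>j\<in>P. ?r i j * (A j)\<^sup>2) = (\<Sum>i\<in>P. \<Sum>j\<in>P. ?r i j * (A i)\<^sup>2)"
    by (subst sum.swap) (simp add: abs_minus_commute)
  also have "((\<Sum>i\<in>P. \<Sum>j\<in>P. ?r i j * (A i)\<^sup>2) + (\<Sum>i\<in>P. \<Sum>j\<in>P. ?r i j * (A i)\<^sup>2)) / 2 = (\<Sum>i\<in>P. (\<Sum>j\<in>P. ?r i j) * (A i)\<^sup>2)"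
    by (simp add: sum_distrib_right)
  also have "\<dots> \<le> (\<Sum>i\<in>P. (1 + 2 / (1 - \<rho>)) * (A i)\<^sup>2)"
    by (intro sum_mono mult_right_mono row) auto
  finally show ?thesis by (simp add: sum_distrib_left)
qed

text \<open>Index of the dyadic shell in the sup norm. Level 0 is the full cube with entries in {-1,
  0, 1}, so zero and the low frequencies form an ordinary block.\<close>

definition freq_level :: "int^3 \<Rightarrow> nat" where
  "freq_level k = (LEAST j. k \<in> freq_box (2 ^ j))"

lemma freq_box_iff: "k \<in> freq_box n \<longleftrightarrow> (\<forall>i. \<bar>k $ i\<bar> \<le> int n)"
  by (auto simp: freq_box_def abs_le_iff minus_le_iff)

lemma freq_level_in: "k \<in> freq_box (2 ^ freq_level k)"
proof -
  let ?m = "nat (\<Sum>i\<in>UNIV. \<bar>k $ i\<bar>)"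
  have "k \<in> freq_box (2 ^ ?m)"
    unfolding freq_box_iff
  proof
    fix i
    have "\<bar>k $ i\<bar> \<le> (\<Sum>i\<in>UNIV. \<bar>k $ i\<bar>)" by (rule member_le_sum) auto
    also have "\<dots> = int ?m" by (simp add: sum_nonneg)
    also have "\<dots> \<le> int (2 ^ ?m)" using less_exp[of ?m] by (simp only: of_nat_le_iff less_imp_le)
    finally show "\<bar>k $ i\<bar> \<le> int (2 ^ ?m)" .
  qed
  then show ?thesis unfolding freq_level_def by (rule LeastI)
qed

text \<open>By minimality k misses the cube of half the size, so some entry exceeds 2^(j - 1). At
  level 0 there is no smaller cube, hence the alternative.\<close>

lemma freq_level_lower:
  obtains "freq_level k = 0" | i where "2 ^ freq_level k < 2 * \<bar>real_of_int (k $ i)\<bar>"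
proof (cases "freq_level k")
  case (Suc j)
  then have "k \<notin> freq_box (2 ^ j)"
    unfolding freq_level_def using not_less_Least[of j "\<lambda>j. k \<in> freq_box (2 ^ j)"] by simp
  then obtain i where "int (2 ^ j) < \<bar>k $ i\<bar>" by (auto simp: freq_box_iff not_le)
  then have "2 ^ j < \<bar>real_of_int (k $ i)\<bar>"
    by (simp only: of_int_less_iff[symmetric, where 'a=real]) simp
  then have "2 ^ freq_level k < 2 * \<bar>real_of_int (k $ i)\<bar>" using Suc by simp
  then show ?thesis by (rule that(2))
qed (rule that(1))

lemma freq_level_le_infnorm:
  assumes "infnorm (freq k) \<le> K" "K \<ge> 1"
  shows "2 ^ freq_level k \<le> 2 * K"
proof (rule freq_level_lower[of k])
  fix i assume "2 ^ freq_level k < 2 * \<bar>real_of_int (k $ i)\<bar>"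
  moreover have "\<bar>real_of_int (k $ i)\<bar> \<le> K"
    using component_le_infnorm_cart[of "freq k" i] assms by (simp add: freq_def)
  ultimately show ?thesis by linarith
qed (use assms in auto)

lemma freq_level_le_norm: "2 ^ freq_level k \<le> 2 * sqrt (1 + (norm (freq k))\<^sup>2)"
proof (rule freq_level_lower[of k])
  fix i assume "2 ^ freq_level k < 2 * \<bar>real_of_int (k $ i)\<bar>"
  moreover have "\<bar>real_of_int (k $ i)\<bar> \<le> norm (freq k)"
    using component_le_norm_cart[of "freq k" i] by (simp add: freq_def)
  moreover have "norm (freq k) \<le> sqrt (1 + (norm (freq k))\<^sup>2)" by (rule real_le_rsqrt) simp
  ultimately show ?thesis by linarith
next
  assume "freq_level k = 0"
  moreover have "1 \<le> sqrt (1 + (norm (freq k))\<^sup>2)" by simp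
  ultimately show ?thesis by (simp only: power_0)
qed

text \<open>At level j one has 2^j \<le> 2 sqrt (1 + |k|^2), so the Sobolev weight is at least (2^j
  / 2)^(2 \<gamma>).\<close>

lemma sobolev_block:
  assumes "\<gamma> \<ge> 0" and "\<And>k. k \<in> S \<Longrightarrow> freq_level k = j"
  shows "sqrt (\<Sum>k\<in>S. (norm (a k))\<^sup>2)
    \<le> 2 powr \<gamma> * (2 powr (- (real j * \<gamma>)) * sqrt (\<Sum>k\<in>S. (1 + (norm (freq k))\<^sup>2) powr \<gamma> * (norm (a k))\<^sup>2))"
proof -
  let ?c = "2 powr \<gamma> * 2 powr (- (real j * \<gamma>))"
  have "(norm (a k))\<^sup>2 \<le> ?c\<^sup>2 * ((1 + (norm (freq k))\<^sup>2) powr \<gamma> * (norm (a k))\<^sup>2)" if "k \<in> S" for k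
  proof -
    let ?r = "1 + (norm (freq k))\<^sup>2"
    have r: "?r > 0" by (intro add_pos_nonneg) auto
    have "2 ^ j / 2 \<le> sqrt ?r" using freq_level_le_norm[of k] assms(2)[OF that] by simp
    then have "(2 ^ j / 2)\<^sup>2 \<le> (sqrt ?r)\<^sup>2" by (intro power_mono) auto
    then have "(2 ^ j / 2)\<^sup>2 \<le> ?r" using r by simp
    then have le: "((2 ^ j / 2)\<^sup>2) powr \<gamma> \<le> ?r powr \<gamma>" using assms(1) by (intro powr_mono2) auto
    have "?c = (2 / 2 ^ j) powr \<gamma>"
    proof -
      have "2 powr (- (real j * \<gamma>)) = inverse ((2 ^ j) powr \<gamma>)"
        by (simp add: powr_minus powr_powr[symmetric] powr_realpow)
      moreover have "(2 / 2 ^ j) powr \<gamma> = 2 powr \<gamma> / (2 ^ j) powr \<gamma>" by (rule powr_divide)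
      ultimately show ?thesis by (simp only: divide_inverse[of "2 powr \<gamma>"])
    qed
    then have "?c * (2 ^ j / 2) powr \<gamma> = 1" by (simp add: powr_mult[symmetric])
    then have one: "?c\<^sup>2 * ((2 ^ j / 2) powr \<gamma>)\<^sup>2 = 1" by (simp only: power_mult_distrib[symmetric]) simp
    have "((2 ^ j / 2) powr \<gamma>)\<^sup>2 = ((2 ^ j / 2)\<^sup>2) powr \<gamma>"
      unfolding power2_eq_square by (rule powr_mult[symmetric])
    then have "1 \<le> ?c\<^sup>2 * ?r powr \<gamma>"
      using one mult_left_mono[OF le, of "?c\<^sup>2"] by simp
    then have "1 * (norm (a k))\<^sup>2 \<le> (?c\<^sup>2 * ?r powr \<gamma>) * (norm (a k))\<^sup>2" by (rule mult_right_mono) simp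
    then show ?thesis by (simp only: mult.assoc)
  qed
  then have "(\<Sum>k\<in>S. (norm (a k))\<^sup>2) \<le> ?c\<^sup>2 * (\<Sum>k\<in>S. (1 + (norm (freq k))\<^sup>2) powr \<gamma> * (norm (a k))\<^sup>2)"
    unfolding sum_distrib_left by (rule sum_mono)
  then have "sqrt (\<Sum>k\<in>S. (norm (a k))\<^sup>2) \<le> sqrt (?c\<^sup>2 * (\<Sum>k\<in>S. (1 + (norm (freq k))\<^sup>2) powr \<gamma> * (norm (a k))\<^sup>2))"
    by (rule real_sqrt_le_mono)
  also have "\<dots> = ?c * sqrt (\<Sum>k\<in>S. (1 + (norm (freq k))\<^sup>2) powr \<gamma> * (norm (a k))\<^sup>2)"
    by (simp add: real_sqrt_mult)
  finally show ?thesis by (simp only: mult.assoc)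
qed

lemma wave_part_blocks:
  assumes "finite S"
  shows "wave_part \<phi> S a t x = (\<Sum>j\<in>freq_level ` S. wave_part \<phi> {k\<in>S. freq_level k = j} a t x)"
  unfolding wave_part_def trig_poly_def
  by (rule sum.group[symmetric]) (use assms in auto)

text \<open>At most (3N)^3 modes occur, and Cauchy-Schwarz gives the sup bound. Combining it with
  Plancherel through |w|^q \<le> sup^(q - 2) |w|^2 gives the power 3/2 - 3/q of N.\<close>

lemma dyadic_bernstein:
  assumes q: "q > 2" and N: "N \<ge> 1" and S: "S \<subseteq> freq_box N" and \<phi>: "\<phi> = cos \<or> \<phi> = sin"
  shows "lpnorm torus q (wave_part \<phi> S a t) \<le> (27 * (1 + torus_vol)) * real N powr (3 / 2 - 3 / q) * sqrt (\<Sum>k\<in>S. (norm (a k))\<^sup>2)"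
proof -
  have fin: "finite S" using S finite_freq_box finite_subset by blast
  let ?w = "wave_part \<phi> S a t" and ?A = "sqrt (\<Sum>k\<in>S. (norm (a k))\<^sup>2)"
  let ?b = "\<lambda>k. complex_of_real (\<phi> (t * norm (freq k))) * a k"
  have \<phi>1: "\<bar>\<phi> z\<bar> \<le> 1" for z using \<phi> by auto
  have nb: "norm (?b k) \<le> norm (a k)" for k
    unfolding norm_mult norm_of_real using \<phi>1 by (intro mult_left_le_one_le) auto
  have A0: "?A \<ge> 0" by (intro real_sqrt_ge_zero sum_nonneg) auto
  have V: "torus_vol > 0" by (rule torus_vol_pos)
  have N0: "real N > 0" using N by simp
  have sup: "norm (?w x) \<le> 3 powr (3 / 2) * real N powr (3 / 2) * ?A" for x
  proof -
    have "norm (?w x) \<le> (\<Sum>k\<in>S. norm (a k))"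
      unfolding wave_part_def by (rule order_trans[OF norm_trig_poly_le]) (intro sum_mono nb)
    also have "\<dots> \<le> sqrt (real (card S)) * ?A"
    proof -
      have "(\<Sum>k\<in>S. 1 * norm (a k))\<^sup>2 \<le> (\<Sum>k\<in>S. 1\<^sup>2) * (\<Sum>k\<in>S. (norm (a k))\<^sup>2)"
        by (rule Cauchy_Schwarz_ineq_sum)
      then have "(\<Sum>k\<in>S. norm (a k))\<^sup>2 \<le> real (card S) * (\<Sum>k\<in>S. (norm (a k))\<^sup>2)" by simp
      then show ?thesis unfolding real_sqrt_mult[symmetric] by (rule real_le_rsqrt)
    qed
    also have "\<dots> \<le> (3 powr (3 / 2) * real N powr (3 / 2)) * ?A"
    proof (rule mult_right_mono[OF _ A0])
      have "real (card S) \<le> real (card (freq_box N))"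
        using S by (intro of_nat_mono card_mono) auto
      also have "\<dots> \<le> (3 * real N) ^ 3" unfolding card_freq_box using N by (intro power_mono) auto
      also have "\<dots> = (3 * real N) powr 3" using N by simp
      finally have "sqrt (real (card S)) \<le> sqrt ((3 * real N) powr 3)" by (rule real_sqrt_le_mono)
      also have "\<dots> = (3 * real N) powr (3 / 2)" by (simp only: powr_half_sqrt[symmetric] powr_ge_zero powr_powr) simp
      also have "\<dots> = 3 powr (3 / 2) * real N powr (3 / 2)" using N0 by (simp add: powr_mult)
      finally show "sqrt (real (card S)) \<le> 3 powr (3 / 2) * real N powr (3 / 2)" .
    qed
    finally show ?thesis .
  qed
  let ?B = "3 powr (3 / 2) * real N powr (3 / 2) * ?A"
  have wb: "?w \<in> bounded_measurable torus" by simp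
  have B0: "?B \<ge> 0" using A0 by simp
  have "(\<integral>x. norm (?w x) powr q \<partial>torus) \<le> (\<integral>x. ?B powr (q - 2) * (norm (?w x))\<^sup>2 \<partial>torus)"
  proof (rule integral_mono)
    show "integrable torus (\<lambda>x. norm (?w x) powr q)" using q by (intro torus.integrable_norm_powr wb) auto
    show "integrable torus (\<lambda>x. ?B powr (q - 2) * (norm (?w x))\<^sup>2)"
      by (intro integrable_mult_right integrable_norm_squared wb)
    fix x
    have "norm (?w x) powr q = norm (?w x) powr (q - 2) * norm (?w x) powr 2"
      by (simp only: powr_add[symmetric]) simp
    also have "\<dots> \<le> ?B powr (q - 2) * norm (?w x) powr 2"
      using q sup by (intro mult_right_mono powr_mono2) auto
    finally show "norm (?w x) powr q \<le> ?B powr (q - 2) * (norm (?w x))\<^sup>2" by simp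
  qed
  also have "\<dots> = ?B powr (q - 2) * (torus_vol * (\<Sum>k\<in>S. (norm (?b k))\<^sup>2))"
    unfolding wave_part_def by (simp only: integral_mult_right_zero integral_norm_squared_trig_poly[OF fin])
  also have "\<dots> \<le> ?B powr (q - 2) * (torus_vol * ?A\<^sup>2)"
  proof (intro mult_left_mono)
    have "(\<Sum>k\<in>S. (norm (?b k))\<^sup>2) \<le> (\<Sum>k\<in>S. (norm (a k))\<^sup>2)"
      by (intro sum_mono power_mono nb) auto
    then show "(\<Sum>k\<in>S. (norm (?b k))\<^sup>2) \<le> ?A\<^sup>2" by (simp add: sum_nonneg)
  qed (use V in auto)
  finally have "lpnorm torus q ?w \<le> (?B powr (q - 2) * (torus_vol * ?A\<^sup>2)) powr (1 / q)"
    unfolding lpnorm_def using q by (intro powr_mono2) (auto intro: integral_nonneg_AE)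
  also have "\<dots> = (3 powr (3 / 2)) powr ((q - 2) / q) * real N powr (3 / 2 * ((q - 2) / q)) * torus_vol powr (1 / q) * (?A powr ((q - 2) / q) * ?A powr (2 / q))"
  proof -
    have "?A\<^sup>2 = ?A powr 2" using A0 by simp
    then have "?B powr (q - 2) * (torus_vol * ?A\<^sup>2) = (3 powr (3 / 2) * real N powr (3 / 2) * ?A) powr (q - 2) * (torus_vol * ?A powr 2)" by (simp only:)
    moreover have "(x * y * z) powr (q - 2) * (v * z powr 2) = x powr (q - 2) * y powr (q - 2) * z powr (q - 2) * (v * z powr 2)" for x y z v :: real
      by (simp add: powr_mult)
    ultimately show ?thesis
      by (simp only: powr_mult powr_powr) (simp add: mult_ac)
  qed
  also have "?A powr ((q - 2) / q) * ?A powr (2 / q) = ?A"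
  proof -
    have "(q - 2) / q + 2 / q = 1" using q by (simp add: field_simps)
    then show ?thesis using A0 by (simp only: powr_add[symmetric]) simp
  qed
  also have "3 / 2 * ((q - 2) / q) = 3 / 2 - 3 / q" using q by (simp add: field_simps)
  \<comment> \<open>Rough numerical bounds that make the constant independent of q.\<close>
  also have "(3 powr (3 / 2)) powr ((q - 2) / q) * real N powr (3 / 2 - 3 / q) * torus_vol powr (1 / q) * ?A
    \<le> 27 * real N powr (3 / 2 - 3 / q) * (1 + torus_vol) * ?A"
  proof (intro mult_right_mono mult_mono A0)
    have "(3 powr (3 / 2)) powr ((q - 2) / q) \<le> (3::real) powr 3"
      unfolding powr_powr using q by (intro powr_mono) (auto simp: field_simps)
    then show "(3 powr (3 / 2)) powr ((q - 2) / q) \<le> (27::real)" by simp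
    have "torus_vol powr (1 / q) \<le> (1 + torus_vol) powr (1 / q)" using V q by (intro powr_mono2) auto
    also have "\<dots> \<le> (1 + torus_vol) powr 1" using V q by (intro powr_mono) auto
    finally show "torus_vol powr (1 / q) \<le> 1 + torus_vol" using V by simp
  qed (use V in auto)
  finally show ?thesis by (simp only: mult.assoc mult.commute mult.left_commute)
qed

section \<open>The discrete Strichartz estimates\<close>

text \<open>The exponents r and s need not match \<gamma>: a mismatch shows as a power of 2^j. This
  freedom is what the summation over the shells exploits.\<close>

lemma block_estimate:
  assumes r: "r > 2" and s: "s > 2" and rs: "1 / r + 1 / s \<le> 1 / 2" and T: "T \<ge> 0" and \<gamma>: "\<gamma> \<ge> 0"
  shows "\<exists>c\<ge>0. \<forall>K \<tau> I S j a \<phi>. K \<ge> 1 \<longrightarrow> \<tau> > 0 \<longrightarrow> finite I \<longrightarrow> (\<forall>n\<in>I. of_int n * \<tau> \<in> {0..T}) \<longrightarrow>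
     S \<noteq> {} \<longrightarrow> (\<forall>k\<in>S. infnorm (freq k) \<le> K \<and> freq_level k = j) \<longrightarrow> \<phi> = cos \<or> \<phi> = sin \<longrightarrow>
     (\<tau> * (\<Sum>n\<in>I. lpnorm torus s (wave_part \<phi> S a (of_int n * \<tau>)) powr r)) powr (1 / r)
       \<le> c * (1 + K * \<tau>) powr (1 / r) * (2 powr (real j * (3 / 2 - 3 / s - 1 / r - \<gamma>)) *
          sqrt (\<Sum>k\<in>S. (1 + (norm (freq k))\<^sup>2) powr \<gamma> * (norm (a k))\<^sup>2))"
proof -
  obtain C where C: "C \<ge> 0" and main: "\<And>N \<tau> I S a \<phi>. \<lbrakk>N \<ge> 1; \<tau> > 0; finite I; \<forall>n\<in>I. of_int n * \<tau> \<in> {0..T};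
     S \<subseteq> freq_box N; \<phi> = cos \<or> \<phi> = sin\<rbrakk> \<Longrightarrow>
     (\<tau> * (\<Sum>n\<in>I. lpnorm torus s (wave_part \<phi> S a (of_int n * \<tau>)) powr r)) powr (1 / r)
       \<le> C * (1 + real N * \<tau>) powr (1 / r) * real N powr (3 / 2 - 3 / s - 1 / r) * sqrt (\<Sum>k\<in>S. (norm (a k))\<^sup>2)"
    using dyadic_strichartz[OF r s rs T] that by (elim exE conjE) blast
  let ?\<sigma> = "3 / 2 - 3 / s - 1 / r"
  let ?c = "C * 2 * 2 powr \<gamma>"
  have "(\<tau> * (\<Sum>n\<in>I. lpnorm torus s (wave_part \<phi> S a (of_int n * \<tau>)) powr r)) powr (1 / r)
       \<le> ?c * (1 + K * \<tau>) powr (1 / r) * (2 powr (real j * (?\<sigma> - \<gamma>)) *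
          sqrt (\<Sum>k\<in>S. (1 + (norm (freq k))\<^sup>2) powr \<gamma> * (norm (a k))\<^sup>2))"
    if K: "K \<ge> 1" and \<tau>: "\<tau> > 0" and I: "finite I" and J: "\<forall>n\<in>I. of_int n * \<tau> \<in> {0..T}"
      and S: "S \<noteq> {}" "\<forall>k\<in>S. infnorm (freq k) \<le> K \<and> freq_level k = j" and \<phi>: "\<phi> = cos \<or> \<phi> = sin"
    for K \<tau> I S j and a :: "int^3 \<Rightarrow> complex" and \<phi> :: "real \<Rightarrow> real"
  proof -
    let ?A = "sqrt (\<Sum>k\<in>S. (1 + (norm (freq k))\<^sup>2) powr \<gamma> * (norm (a k))\<^sup>2)"
    have A0: "?A \<ge> 0" by (intro real_sqrt_ge_zero sum_nonneg mult_nonneg_nonneg) auto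
    obtain k0 where "k0 \<in> S" using S by auto
    \<comment> \<open>A nonempty block inside the cube of radius K has 2^j \<le> 2K; this turns the
      loss N\<tau> into K\<tau>.\<close>
    then have jK: "2 ^ j \<le> 2 * K" using freq_level_le_infnorm[of k0 K] S K by auto
    have sub: "S \<subseteq> freq_box (2 ^ j)"
  proof
    fix k assume "k \<in> S"
    then have "freq_level k = j" using S by auto
    then show "k \<in> freq_box (2 ^ j)" using freq_level_in[of k] by simp
  qed
    have "(\<tau> * (\<Sum>n\<in>I. lpnorm torus s (wave_part \<phi> S a (of_int n * \<tau>)) powr r)) powr (1 / r)
      \<le> C * (1 + real (2 ^ j) * \<tau>) powr (1 / r) * real (2 ^ j) powr ?\<sigma> * sqrt (\<Sum>k\<in>S. (norm (a k))\<^sup>2)"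
      by (rule main[OF _ \<tau> I J sub \<phi>]) simp
    also have "\<dots> \<le> C * (2 * (1 + K * \<tau>) powr (1 / r)) * real (2 ^ j) powr ?\<sigma> * (2 powr \<gamma> * (2 powr (- (real j * \<gamma>)) * ?A))"
    proof (intro mult_mono)
      have "1 + real (2 ^ j) * \<tau> \<le> 2 * (1 + K * \<tau>)"
        using mult_right_mono[OF jK less_imp_le[OF \<tau>]] by (simp add: distrib_left)
      then have "(1 + real (2 ^ j) * \<tau>) powr (1 / r) \<le> (2 * (1 + K * \<tau>)) powr (1 / r)"
        using \<tau> r by (intro powr_mono2) auto
      also have "\<dots> = 2 powr (1 / r) * (1 + K * \<tau>) powr (1 / r)"
        by (rule powr_mult)
      also have "\<dots> \<le> 2 powr 1 * (1 + K * \<tau>) powr (1 / r)"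
        using r by (intro mult_right_mono powr_mono) auto
      finally show "(1 + real (2 ^ j) * \<tau>) powr (1 / r) \<le> 2 * (1 + K * \<tau>) powr (1 / r)" by simp
      show "sqrt (\<Sum>k\<in>S. (norm (a k))\<^sup>2) \<le> 2 powr \<gamma> * (2 powr (- (real j * \<gamma>)) * ?A)"
        using S by (intro sobolev_block \<gamma>) auto
    qed (use C in \<open>auto intro!: sum_nonneg\<close>)
    also have "real (2 ^ j) powr ?\<sigma> = 2 powr (real j * ?\<sigma>)"
      by (simp add: powr_powr[symmetric] powr_realpow)
    also have "C * (2 * (1 + K * \<tau>) powr (1 / r)) * 2 powr (real j * ?\<sigma>) * (2 powr \<gamma> * (2 powr (- (real j * \<gamma>)) * ?A))
      = ?c * (1 + K * \<tau>) powr (1 / r) * ((2 powr (real j * ?\<sigma>) * 2 powr (- (real j * \<gamma>))) * ?A)"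
      by (simp only: mult.assoc mult.commute mult.left_commute)
    also have "2 powr (real j * ?\<sigma>) * 2 powr (- (real j * \<gamma>)) = 2 powr (real j * (?\<sigma> - \<gamma>))"
    proof -
    have "real j * ?\<sigma> + - (real j * \<gamma>) = real j * (?\<sigma> - \<gamma>)" by (simp add: right_diff_distrib)
    then show ?thesis by (simp only: powr_add[symmetric])
  qed
    finally show ?thesis .
  qed
  moreover have "?c \<ge> 0" using C by simp
  ultimately show ?thesis by blast
qed

text \<open>The counterpart of \<open>block_estimate\<close> at a single time, with Bernstein's
  inequality in place of the dispersive argument.\<close>

lemma block_estimate_sup:
  assumes s: "s > 2" and \<gamma>: "\<gamma> \<ge> 0"
    and S: "S \<noteq> {}" "\<forall>k\<in>S. freq_level k = j" and \<phi>: "\<phi> = cos \<or> \<phi> = sin"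
  shows "lpnorm torus s (wave_part \<phi> S a t)
       \<le> (27 * (1 + torus_vol) * 2 powr \<gamma>) * (2 powr (real j * (3 / 2 - 3 / s - \<gamma>)) *
          sqrt (\<Sum>k\<in>S. (1 + (norm (freq k))\<^sup>2) powr \<gamma> * (norm (a k))\<^sup>2))"
proof -
  let ?\<sigma> = "3 / 2 - 3 / s" and ?C = "27 * (1 + torus_vol)"
  let ?A = "sqrt (\<Sum>k\<in>S. (1 + (norm (freq k))\<^sup>2) powr \<gamma> * (norm (a k))\<^sup>2)"
  have sub: "S \<subseteq> freq_box (2 ^ j)"
  proof
    fix k assume "k \<in> S"
    then have "freq_level k = j" using S by auto
    then show "k \<in> freq_box (2 ^ j)" using freq_level_in[of k] by simp
  qed
  have "lpnorm torus s (wave_part \<phi> S a t) \<le> ?C * real (2 ^ j) powr ?\<sigma> * sqrt (\<Sum>k\<in>S. (norm (a k))\<^sup>2)"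
    by (rule dyadic_bernstein[OF s _ sub \<phi>]) simp
  also have "\<dots> \<le> ?C * real (2 ^ j) powr ?\<sigma> * (2 powr \<gamma> * (2 powr (- (real j * \<gamma>)) * ?A))"
    using torus_vol_pos S by (intro mult_left_mono sobolev_block \<gamma>) auto
  also have "real (2 ^ j) powr ?\<sigma> = 2 powr (real j * ?\<sigma>)"
    by (simp add: powr_powr[symmetric] powr_realpow)
  also have "?C * 2 powr (real j * ?\<sigma>) * (2 powr \<gamma> * (2 powr (- (real j * \<gamma>)) * ?A))
    = (?C * 2 powr \<gamma>) * ((2 powr (real j * ?\<sigma>) * 2 powr (- (real j * \<gamma>))) * ?A)"
    by (simp only: mult.assoc mult.commute mult.left_commute)
  also have "2 powr (real j * ?\<sigma>) * 2 powr (- (real j * \<gamma>)) = 2 powr (real j * (?\<sigma> - \<gamma>))"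
  proof -
    have "real j * ?\<sigma> + - (real j * \<gamma>) = real j * (?\<sigma> - \<gamma>)" by (simp add: right_diff_distrib)
    then show ?thesis by (simp only: powr_add[symmetric])
  qed
  finally show ?thesis .
qed

text \<open>In each pair the larger index carries the negative power and the smaller one the
  positive power. The two combine to 2^(- \<delta> |i - j|), and the Schur bound applies.\<close>

lemma bilinear_block_sum:
  fixes A :: "nat \<Rightarrow> real" and Z :: "nat \<Rightarrow> nat \<Rightarrow> real"
  assumes P: "finite P" and \<delta>: "\<delta> > 0" and E: "E \<ge> 0"
    and Z: "\<And>i j. i \<in> P \<Longrightarrow> j \<in> P \<Longrightarrow> j \<le> i \<Longrightarrow> Z i j \<le> E * ((2 powr (- (real i * \<delta>)) * A i) * (2 powr (real j * \<delta>) * A j))"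
      "\<And>i j. i \<in> P \<Longrightarrow> j \<in> P \<Longrightarrow> i < j \<Longrightarrow> Z i j \<le> E * ((2 powr (- (real j * \<delta>)) * A j) * (2 powr (real i * \<delta>) * A i))"
  shows "(\<Sum>p\<in>P \<times> P. Z (fst p) (snd p)) \<le> E * (1 + 2 / (1 - 2 powr (- \<delta>))) * (\<Sum>j\<in>P. (A j)\<^sup>2)"
proof -
  let ?\<rho> = "2 powr (- \<delta>) :: real"
  have \<rho>: "0 < ?\<rho>" "?\<rho> < 1" using \<delta> by (auto simp: powr_minus powr_less_one inverse_less_1_iff)
  have pow: "2 powr (- (real i * \<delta>)) * 2 powr (real j * \<delta>) = ?\<rho> ^ nat \<bar>int i - int j\<bar>" if "j \<le> i" for i j
  proof -
    have "2 powr (- (real i * \<delta>)) * 2 powr (real j * \<delta>) = 2 powr (- \<delta> * real (i - j))"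
      using that by (simp add: powr_add[symmetric] of_nat_diff algebra_simps)
    also have "\<dots> = ?\<rho> ^ (i - j)" by (simp only: powr_powr[symmetric] powr_realpow[OF \<rho>(1)])
    also have "i - j = nat \<bar>int i - int j\<bar>" using that by simp
    finally show ?thesis .
  qed
  have "(\<Sum>p\<in>P \<times> P. Z (fst p) (snd p)) \<le> (\<Sum>p\<in>P \<times> P. E * (?\<rho> ^ nat \<bar>int (fst p) - int (snd p)\<bar> * (A (fst p) * A (snd p))))"
  proof (rule sum_mono)
    fix p assume "p \<in> P \<times> P"
    then obtain i j where p: "p = (i, j)" "i \<in> P" "j \<in> P" by auto
    show "Z (fst p) (snd p) \<le> E * (?\<rho> ^ nat \<bar>int (fst p) - int (snd p)\<bar> * (A (fst p) * A (snd p)))"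
    proof (cases "j \<le> i")
      case True
      have "Z i j \<le> E * ((2 powr (- (real i * \<delta>)) * A i) * (2 powr (real j * \<delta>) * A j))" by (rule Z(1)[OF p(2,3) True])
      also have "\<dots> = E * ((2 powr (- (real i * \<delta>)) * 2 powr (real j * \<delta>)) * (A i * A j))"
        by (simp only: mult.assoc mult.commute mult.left_commute)
      finally show ?thesis unfolding pow[OF True] p(1) fst_conv snd_conv .
    next
      case False
      then have ij: "i < j" "i \<le> j" by auto
      have "Z i j \<le> E * ((2 powr (- (real j * \<delta>)) * A j) * (2 powr (real i * \<delta>) * A i))" by (rule Z(2)[OF p(2,3) ij(1)])
      also have "\<dots> = E * ((2 powr (- (real j * \<delta>)) * 2 powr (real i * \<delta>)) * (A i * A j))"
        by (simp only: mult.assoc mult.commute mult.left_commute)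
      finally show ?thesis unfolding pow[OF ij(2)] p(1) fst_conv snd_conv abs_minus_commute[of "int i" "int j"] .
    qed
  qed
  also have "\<dots> \<le> E * ((1 + 2 / (1 - ?\<rho>)) * (\<Sum>j\<in>P. (A j)\<^sup>2))"
    unfolding sum_distrib_left[symmetric] by (intro mult_left_mono schur_geometric P \<rho> E)
  finally show ?thesis by (simp only: mult.assoc)
qed

lemma perturb_exponents:
  fixes x y :: real
  assumes "0 < x" "x < 1 / 2" "0 < y" "y < 1 / 2"
  obtains \<epsilon> where "0 < \<epsilon>" "\<epsilon> < 1" "(1 + \<epsilon>) * x < 1 / 2" "(1 + \<epsilon>) * y < 1 / 2"
proof -
  define m where "m = max x y"
  have m: "0 < m" "m < 1 / 2" "x \<le> m" "y \<le> m" using assms by (auto simp: m_def)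
  \<comment> \<open>The product (1 + \<epsilon>) m reaches 1/2 at \<epsilon> = 1/(2m) - 1. Half of
    that, capped by 1/2, leaves strict inequalities.\<close>
  define \<epsilon> where "\<epsilon> = min (1 / 2) ((1 / (2 * m) - 1) / 2)"
  have "1 / (2 * m) > 1" using m by simp
  then have \<epsilon>: "0 < \<epsilon>" "\<epsilon> < 1" by (auto simp: \<epsilon>_def)
  have "\<epsilon> * m \<le> (1 / (2 * m) - 1) / 2 * m" unfolding \<epsilon>_def using m by (intro mult_right_mono min.cobounded2) simp
  also have "\<dots> = (1 / 2 - m) / 2" using m by (simp add: field_simps)
  finally have em: "(1 + \<epsilon>) * m < 1 / 2" using m by (simp add: distrib_right)
  have "(1 + \<epsilon>) * x \<le> (1 + \<epsilon>) * m" "(1 + \<epsilon>) * y \<le> (1 + \<epsilon>) * m"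
    using m \<epsilon> by (auto intro!: mult_left_mono)
  then show ?thesis using that[OF \<epsilon>] em by linarith
qed

lemma sum_blocks:
  assumes "finite S"
  shows "(\<Sum>j\<in>freq_level ` S. \<Sum>k\<in>{k\<in>S. freq_level k = j}. g k) = (\<Sum>k\<in>S. (g k :: real))"
  by (rule sum.group) (use assms in auto)

lemma block_product_le:
  assumes q: "q > 2" and q01: "q0 > 0" "q1 > 0" "1 / q0 + 1 / q1 = 2 / q"
    and w: "u \<in> bounded_measurable torus" "v \<in> bounded_measurable torus"
  shows "lpnorm torus (q / 2) (\<lambda>x. u x * v x) \<le> lpnorm torus q0 u * lpnorm torus q1 v"
proof (rule lpnorm_mult_le)
  have [measurable]: "u \<in> borel_measurable torus" "v \<in> borel_measurable torus"
    using w by (auto dest: bounded_measurable_measurable)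
  show "(\<lambda>x. norm (u x)) \<in> borel_measurable torus" "(\<lambda>x. norm (v x)) \<in> borel_measurable torus"
    "(\<lambda>x. norm (u x * v x)) \<in> borel_measurable torus" by measurable
  show "integrable torus (\<lambda>x. norm (u x) powr q0)" "integrable torus (\<lambda>x. norm (v x) powr q1)"
    using w q01 by (auto intro!: torus.integrable_norm_powr)
qed (use q q01 in auto)

theorem strichartz_part:
  assumes p: "p > 2" and q: "q > 2" and pq: "1 / p + 1 / q \<le> 1 / 2" and T: "T \<ge> 0"
  defines "\<gamma> \<equiv> 3 / 2 - 3 / q - 1 / p"
  shows "\<exists>C\<ge>0. \<forall>K \<tau> I S a \<phi>. K \<ge> 1 \<longrightarrow> \<tau> > 0 \<longrightarrow> finite I \<longrightarrow> (\<forall>n\<in>I. of_int n * \<tau> \<in> {0..T}) \<longrightarrow>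
     finite S \<longrightarrow> (\<forall>k\<in>S. infnorm (freq k) \<le> K) \<longrightarrow> \<phi> = cos \<or> \<phi> = sin \<longrightarrow>
     (\<tau> * (\<Sum>n\<in>I. lpnorm torus q (wave_part \<phi> S a (of_int n * \<tau>)) powr p)) powr (1 / p)
       \<le> C * (1 + K * \<tau>) powr (1 / p) * sqrt (\<Sum>k\<in>S. (1 + (norm (freq k))\<^sup>2) powr \<gamma> * (norm (a k))\<^sup>2)"
proof -
  define b where "b = 1 / 2 - 1 / q"
  have a: "0 < 1 / p" "1 / p < 1 / 2" and b: "0 < b" "b < 1 / 2" and ab: "1 / p \<le> b"
    using p q pq by (auto simp: b_def field_simps)
  have \<gamma>: "\<gamma> = 3 * b - 1 / p" by (simp add: \<gamma>_def b_def)
  then have \<gamma>0: "\<gamma> > 0" using ab b by linarith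
  obtain \<epsilon> where \<epsilon>: "0 < \<epsilon>" "\<epsilon> < 1" "(1 + \<epsilon>) * (1 / p) < 1 / 2" "(1 + \<epsilon>) * b < 1 / 2"
    using perturb_exponents[OF a b] by blast
  define p0 where "p0 = p / (1 - \<epsilon>)"
  define p1 where "p1 = p / (1 + \<epsilon>)"
  define q0 where "q0 = 1 / (1 / 2 - (1 - \<epsilon>) * b)"
  define q1 where "q1 = 1 / (1 / 2 - (1 + \<epsilon>) * b)"
  define \<delta> where "\<delta> = \<epsilon> * \<gamma>"
  have \<delta>: "\<delta> > 0" using \<epsilon> \<gamma>0 by (simp add: \<delta>_def)
  have ip: "1 / p0 = (1 - \<epsilon>) * (1 / p)" "1 / p1 = (1 + \<epsilon>) * (1 / p)" by (simp_all add: p0_def p1_def)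
  have iq: "1 / q0 = 1 / 2 - (1 - \<epsilon>) * b" "1 / q1 = 1 / 2 - (1 + \<epsilon>) * b" by (simp_all add: q0_def q1_def)
  have eb: "(1 - \<epsilon>) * b \<le> (1 + \<epsilon>) * b" "(1 - \<epsilon>) * (1 / p) \<le> (1 + \<epsilon>) * (1 / p)"
  proof -
    have e: "1 - \<epsilon> \<le> 1 + \<epsilon>" using \<epsilon> by simp
    show "(1 - \<epsilon>) * b \<le> (1 + \<epsilon>) * b" by (rule mult_right_mono[OF e less_imp_le[OF b(1)]])
    show "(1 - \<epsilon>) * (1 / p) \<le> (1 + \<epsilon>) * (1 / p)" by (rule mult_right_mono[OF e less_imp_le[OF a(1)]])
  qed
  have epos: "0 < (1 - \<epsilon>) * b" "0 < (1 + \<epsilon>) * b" "0 < (1 - \<epsilon>) * (1 / p)" "0 < (1 + \<epsilon>) * (1 / p)"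
    using \<epsilon>(1,2) a(1) b(1) by (intro mult_pos_pos; simp)+
  have gt2: "x > 2" if "1 / x < 1 / 2" "1 / x > 0" for x :: real
    using that by (simp add: field_simps)
  have "1 / p0 < 1 / 2" "1 / p1 < 1 / 2" "1 / q0 < 1 / 2" "1 / q1 < 1 / 2"
    "1 / p0 > 0" "1 / p1 > 0" "1 / q0 > 0" "1 / q1 > 0"
    unfolding ip iq using \<epsilon> eb epos by linarith+
  then have p01: "p0 > 2" "p1 > 2" and q01: "q0 > 2" "q1 > 2" using gt2 by blast+
  have adm: "1 / p0 + 1 / q0 \<le> 1 / 2" "1 / p1 + 1 / q1 \<le> 1 / 2"
    unfolding ip iq using mult_left_mono[OF ab, of "1 - \<epsilon>"] mult_left_mono[OF ab, of "1 + \<epsilon>"] \<epsilon> by linarith+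
  have s0: "3 / 2 - 3 / q0 - 1 / p0 - \<gamma> = - \<delta>" "3 / 2 - 3 / q1 - 1 / p1 - \<gamma> = \<delta>"
  proof -
    have e: "3 * (1 / 2 - (1 / 2 - (1 - \<epsilon>) * b)) - (1 - \<epsilon>) * w - (3 * b - w) = - (\<epsilon> * (3 * b - w))"
      "3 * (1 / 2 - (1 / 2 - (1 + \<epsilon>) * b)) - (1 + \<epsilon>) * w - (3 * b - w) = \<epsilon> * (3 * b - w)" for w
      by (simp_all add: algebra_simps)
    have "3 / 2 - 3 / q0 - 1 / p0 - \<gamma> = 3 * (1 / 2 - 1 / q0) - 1 / p0 - \<gamma>" by simp
    also have "\<dots> = - \<delta>" unfolding ip iq \<delta>_def \<gamma> by (rule e)
    finally show "3 / 2 - 3 / q0 - 1 / p0 - \<gamma> = - \<delta>" .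
    have "3 / 2 - 3 / q1 - 1 / p1 - \<gamma> = 3 * (1 / 2 - 1 / q1) - 1 / p1 - \<gamma>" by simp
    also have "\<dots> = \<delta>" unfolding ip iq \<delta>_def \<gamma> by (rule e)
    finally show "3 / 2 - 3 / q1 - 1 / p1 - \<gamma> = \<delta>" .
  qed
  have hq: "1 / q0 + 1 / q1 = 2 / q" "1 / p0 + 1 / p1 = 1 / (p / 2)"
  proof -
    have e: "(1 - \<epsilon>) * w + (1 + \<epsilon>) * w = 2 * w" for w by (simp add: algebra_simps)
    have "1 / q0 + 1 / q1 = 1 - ((1 - \<epsilon>) * b + (1 + \<epsilon>) * b)" unfolding iq by simp
    then show "1 / q0 + 1 / q1 = 2 / q" unfolding e by (simp add: b_def)
    have "1 / p0 + 1 / p1 = 2 * (1 / p)" unfolding ip by (rule e)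
    then show "1 / p0 + 1 / p1 = 1 / (p / 2)" by simp
  qed
  obtain c0 where c0: "c0 \<ge> 0" and B0: "\<And>K \<tau> I S j a \<phi>. \<lbrakk>K \<ge> 1; \<tau> > 0; finite I; \<forall>n\<in>I. of_int n * \<tau> \<in> {0..T};
     S \<noteq> {}; \<forall>k\<in>S. infnorm (freq k) \<le> K \<and> freq_level k = j; \<phi> = cos \<or> \<phi> = sin\<rbrakk> \<Longrightarrow>
     (\<tau> * (\<Sum>n\<in>I. lpnorm torus q0 (wave_part \<phi> S a (of_int n * \<tau>)) powr p0)) powr (1 / p0)
       \<le> c0 * (1 + K * \<tau>) powr (1 / p0) * (2 powr (real j * - \<delta>) *
          sqrt (\<Sum>k\<in>S. (1 + (norm (freq k))\<^sup>2) powr \<gamma> * (norm (a k))\<^sup>2))"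
    using block_estimate[OF p01(1) q01(1) adm(1) T less_imp_le[OF \<gamma>0]] that unfolding s0 by (elim exE conjE) blast
  obtain c1 where c1: "c1 \<ge> 0" and B1: "\<And>K \<tau> I S j a \<phi>. \<lbrakk>K \<ge> 1; \<tau> > 0; finite I; \<forall>n\<in>I. of_int n * \<tau> \<in> {0..T};
     S \<noteq> {}; \<forall>k\<in>S. infnorm (freq k) \<le> K \<and> freq_level k = j; \<phi> = cos \<or> \<phi> = sin\<rbrakk> \<Longrightarrow>
     (\<tau> * (\<Sum>n\<in>I. lpnorm torus q1 (wave_part \<phi> S a (of_int n * \<tau>)) powr p1)) powr (1 / p1)
       \<le> c1 * (1 + K * \<tau>) powr (1 / p1) * (2 powr (real j * \<delta>) *
          sqrt (\<Sum>k\<in>S. (1 + (norm (freq k))\<^sup>2) powr \<gamma> * (norm (a k))\<^sup>2))"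
    using block_estimate[OF p01(2) q01(2) adm(2) T less_imp_le[OF \<gamma>0]] that unfolding s0 by (elim exE conjE) blast
  define G where "G = 1 + 2 / (1 - 2 powr (- \<delta>))"
  have "2 powr (- \<delta>) < (1::real)" using \<delta> by (simp add: powr_minus inverse_less_1_iff)
  then have G0: "G \<ge> 0" by (simp add: G_def)
  let ?C = "sqrt (c0 * c1 * G)"
  have "(\<tau> * (\<Sum>n\<in>I. lpnorm torus q (wave_part \<phi> S a (of_int n * \<tau>)) powr p)) powr (1 / p)
       \<le> ?C * (1 + K * \<tau>) powr (1 / p) * sqrt (\<Sum>k\<in>S. (1 + (norm (freq k))\<^sup>2) powr \<gamma> * (norm (a k))\<^sup>2)"
    if K: "K \<ge> 1" and \<tau>: "\<tau> > 0" and I: "finite I" and J: "\<forall>n\<in>I. of_int n * \<tau> \<in> {0..T}"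
      and S: "finite S" "\<forall>k\<in>S. infnorm (freq k) \<le> K" and \<phi>: "\<phi> = cos \<or> \<phi> = sin"
    for K \<tau> I S and a :: "int^3 \<Rightarrow> complex" and \<phi> :: "real \<Rightarrow> real"
  proof -
    let ?M = "point_measure I (\<lambda>_. ennreal \<tau>)"
    let ?P = "freq_level ` S"
    let ?S = "\<lambda>j. {k\<in>S. freq_level k = j}"
    let ?w = "\<lambda>j n. wave_part \<phi> (?S j) a (of_int n * \<tau>)"
    define A where "A j = sqrt (\<Sum>k\<in>?S j. (1 + (norm (freq k))\<^sup>2) powr \<gamma> * (norm (a k))\<^sup>2)" for j
    have P: "finite ?P" using S by simp
    have tn: "lpnorm ?M r x = (\<tau> * (\<Sum>n\<in>I. \<bar>x n\<bar> powr r)) powr (1 / r)" for r and x :: "int \<Rightarrow> real"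
      unfolding lpnorm_def using I \<tau> by (subst lebesgue_integral_point_measure_finite) (auto simp: sum_distrib_left)
    have meas: "x \<in> borel_measurable ?M" for x :: "int \<Rightarrow> real"
      by (simp add: measurable_def space_point_measure sets_point_measure)
    have intM: "integrable ?M x" for x :: "int \<Rightarrow> real"
      using I by (rule integrable_point_measure_finite)
    define x0 where "x0 j n = lpnorm torus q0 (?w j n)" for j n
    define x1 where "x1 j n = lpnorm torus q1 (?w j n)" for j n
    have x01: "x0 j n \<ge> 0" "x1 j n \<ge> 0" for j n by (simp_all add: x0_def x1_def)
    \<comment> \<open>The block of higher frequency is measured with the pair (p0, q0), whose bound
      gains 2^(-j \<delta>), and the lower one with (p1, q1), whose bound loses 2^(j
      \<delta>).\<close>
    define y where "y p n = (if snd p \<le> fst p then x0 (fst p) n * x1 (snd p) n else x0 (snd p) n * x1 (fst p) n)" for p n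
    have y0: "y p n \<ge> 0" for p n by (simp add: y_def x01)
    define L where "L n = lpnorm torus q (wave_part \<phi> S a (of_int n * \<tau>))" for n
    have L2: "(L n)\<^sup>2 \<le> (\<Sum>p\<in>?P \<times> ?P. y p n)" for n
    proof -
      have eq: "wave_part \<phi> S a (of_int n * \<tau>) = (\<lambda>x. \<Sum>j\<in>?P. ?w j n x)"
        by (rule ext) (rule wave_part_blocks[OF S(1)])
      have "(L n)\<^sup>2 = (lpnorm torus q (\<lambda>x. \<Sum>j\<in>?P. ?w j n x))\<^sup>2"
        unfolding L_def eq ..
      also have "\<dots> \<le> (\<Sum>p\<in>?P \<times> ?P. lpnorm torus (q / 2) (\<lambda>x. ?w (fst p) n x * ?w (snd p) n x))"
        using P q by (intro torus.lpnorm_sum_squared_le) auto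
      also have "\<dots> \<le> (\<Sum>p\<in>?P \<times> ?P. y p n)"
      proof (rule sum_mono)
        fix p
        have "lpnorm torus (q / 2) (\<lambda>x. ?w i n x * ?w j n x) \<le> x0 i n * x1 j n" for i j
          unfolding x0_def x1_def by (rule block_product_le[OF q _ _ hq(1)]) (use q01 in auto)
        from this[of "fst p" "snd p"] this[of "snd p" "fst p"]
        show "lpnorm torus (q / 2) (\<lambda>x. ?w (fst p) n x * ?w (snd p) n x) \<le> y p n"
          by (simp add: y_def mult.commute)
      qed
      finally show ?thesis .
    qed
    have "(lpnorm ?M p L)\<^sup>2 = lpnorm ?M (p / 2) (\<lambda>n. (norm (L n))\<^sup>2)"
      by (rule lpnorm_half_square[symmetric]) (use p in simp)
    also have "\<dots> \<le> lpnorm ?M (p / 2) (\<lambda>n. \<Sum>p\<in>?P \<times> ?P. y p n)"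
    proof (rule lpnorm_mono)
      fix n
      have "(\<Sum>p\<in>?P \<times> ?P. y p n) \<ge> 0" by (intro sum_nonneg y0)
      then show "norm ((norm (L n))\<^sup>2) \<le> norm (\<Sum>p\<in>?P \<times> ?P. y p n)" using L2[of n] by simp
    qed (use p in \<open>auto intro: intM meas\<close>)
    \<comment> \<open>Squaring has lowered the time exponent to p/2, which is still at least
      1.\<close>
    also have "\<dots> \<le> (\<Sum>z\<in>?P \<times> ?P. lpnorm ?M (p / 2) (y z))"
      by (rule lpnorm_sum_le) (use P p y0 in \<open>auto intro: intM meas\<close>)
    also have "\<dots> = (\<Sum>z\<in>?P \<times> ?P. lpnorm ?M (p / 2) (y (fst z, snd z)))" by simp
    also have "\<dots> \<le> ((c0 * (1 + K * \<tau>) powr (1 / p0)) * (c1 * (1 + K * \<tau>) powr (1 / p1))) * G * (\<Sum>j\<in>?P. (A j)\<^sup>2)"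
      (is "_ \<le> ?E * G * _")
      unfolding G_def
    proof (rule bilinear_block_sum[OF P \<delta>])
      show "?E \<ge> 0" using c0 c1 by simp
      have Sj: "?S j \<noteq> {}" "\<forall>k\<in>?S j. infnorm (freq k) \<le> K \<and> freq_level k = j" if "j \<in> ?P" for j
        using that S by auto
      have t0: "lpnorm ?M p0 (x0 j) \<le> c0 * (1 + K * \<tau>) powr (1 / p0) * (2 powr (- (real j * \<delta>)) * A j)" if "j \<in> ?P" for j
        using B0[OF K \<tau> I J Sj[OF that] \<phi>, of a] unfolding tn A_def x0_def by simp
      have t1: "lpnorm ?M p1 (x1 j) \<le> c1 * (1 + K * \<tau>) powr (1 / p1) * (2 powr (real j * \<delta>) * A j)" if "j \<in> ?P" for j
        using B1[OF K \<tau> I J Sj[OF that] \<phi>, of a] unfolding tn A_def x1_def by simp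
      have A0: "A j \<ge> 0" for j unfolding A_def by (intro real_sqrt_ge_zero sum_nonneg mult_nonneg_nonneg) auto
      have prod: "lpnorm ?M (p / 2) (\<lambda>n. x0 i n * x1 j n) \<le> ?E * ((2 powr (- (real i * \<delta>)) * A i) * (2 powr (real j * \<delta>) * A j))"
        if ij: "i \<in> ?P" "j \<in> ?P" for i j
      proof -
        have "lpnorm ?M (p / 2) (\<lambda>n. x0 i n * x1 j n) \<le> lpnorm ?M p0 (x0 i) * lpnorm ?M p1 (x1 j)"
          by (rule lpnorm_mult_le[OF meas meas meas intM intM _ _ _ hq(2)]) (use p p01 in auto)
        also have "\<dots> \<le> (c0 * (1 + K * \<tau>) powr (1 / p0) * (2 powr (- (real i * \<delta>)) * A i)) * (c1 * (1 + K * \<tau>) powr (1 / p1) * (2 powr (real j * \<delta>) * A j))"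
          by (intro mult_mono t0 t1 ij) (use c0 A0 in auto)
        finally show ?thesis by (simp only: mult.assoc mult.commute mult.left_commute)
      qed
      show "lpnorm ?M (p / 2) (y (i, j)) \<le> ?E * ((2 powr (- (real i * \<delta>)) * A i) * (2 powr (real j * \<delta>) * A j))"
        if "i \<in> ?P" "j \<in> ?P" "j \<le> i" for i j
      proof -
        have "y (i, j) = (\<lambda>n. x0 i n * x1 j n)" using that by (simp add: y_def fun_eq_iff)
        then show ?thesis using prod[OF that(1,2)] by (simp only:)
      qed
      show "lpnorm ?M (p / 2) (y (i, j)) \<le> ?E * ((2 powr (- (real j * \<delta>)) * A j) * (2 powr (real i * \<delta>) * A i))"
        if "i \<in> ?P" "j \<in> ?P" "i < j" for i j
      proof -
        have "y (i, j) = (\<lambda>n. x0 j n * x1 i n)" using that by (simp add: y_def fun_eq_iff)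
        then show ?thesis using prod[OF that(2,1)] by (simp only:)
      qed
    qed
    also have "(\<Sum>j\<in>?P. (A j)\<^sup>2) = (\<Sum>k\<in>S. (1 + (norm (freq k))\<^sup>2) powr \<gamma> * (norm (a k))\<^sup>2)"
      unfolding sum_blocks[OF S(1), symmetric] A_def
      by (intro sum.cong refl real_sqrt_pow2 sum_nonneg mult_nonneg_nonneg) auto
    also have "?E * G = (c0 * c1 * G) * ((1 + K * \<tau>) powr (1 / p))\<^sup>2"
    proof -
      have "1 / p0 + 1 / p1 = 1 / p + 1 / p" using hq(2) by simp
      then have "(1 + K * \<tau>) powr (1 / p0) * (1 + K * \<tau>) powr (1 / p1) = ((1 + K * \<tau>) powr (1 / p))\<^sup>2"
        by (simp only: powr_add[symmetric] power2_eq_square)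
      then show ?thesis by (simp only: mult.assoc mult.commute mult.left_commute)
    qed
    finally have "sqrt ((lpnorm ?M p L)\<^sup>2) \<le> sqrt ((c0 * c1 * G) * ((1 + K * \<tau>) powr (1 / p))\<^sup>2 * (\<Sum>k\<in>S. (1 + (norm (freq k))\<^sup>2) powr \<gamma> * (norm (a k))\<^sup>2))"
      by (rule real_sqrt_le_mono)
    then have "lpnorm ?M p L \<le> ?C * (1 + K * \<tau>) powr (1 / p) * sqrt (\<Sum>k\<in>S. (1 + (norm (freq k))\<^sup>2) powr \<gamma> * (norm (a k))\<^sup>2)"
      by (simp add: real_sqrt_mult)
    moreover have "lpnorm ?M p L = (\<tau> * (\<Sum>n\<in>I. L n powr p)) powr (1 / p)"
      unfolding tn by (simp add: L_def)
    ultimately show ?thesis unfolding L_def by (simp only:)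
  qed
  moreover have "?C \<ge> 0" using c0 c1 G0 by simp
  ultimately show ?thesis by blast
qed

text \<open>The same summation at a fixed time, with the perturbed spatial exponents only; here
  \<gamma> = 3b scales with b.\<close>

theorem sobolev_part:
  assumes q: "q > 2"
  defines "\<gamma> \<equiv> 3 / 2 - 3 / q"
  shows "\<exists>C\<ge>0. \<forall>S a \<phi> t. finite S \<longrightarrow> \<phi> = cos \<or> \<phi> = sin \<longrightarrow>
     lpnorm torus q (wave_part \<phi> S a t) \<le> C * sqrt (\<Sum>k\<in>S. (1 + (norm (freq k))\<^sup>2) powr \<gamma> * (norm (a k))\<^sup>2)"
proof -
  define b where "b = 1 / 2 - 1 / q"
  have b: "0 < b" "b < 1 / 2" using q by (auto simp: b_def field_simps)
  have \<gamma>: "\<gamma> = 3 * b" by (simp add: \<gamma>_def b_def)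
  then have \<gamma>0: "\<gamma> > 0" using b by linarith
  obtain \<epsilon> where \<epsilon>: "0 < \<epsilon>" "\<epsilon> < 1" "(1 + \<epsilon>) * b < 1 / 2"
    using perturb_exponents[OF b b] by blast
  define q0 where "q0 = 1 / (1 / 2 - (1 - \<epsilon>) * b)"
  define q1 where "q1 = 1 / (1 / 2 - (1 + \<epsilon>) * b)"
  define \<delta> where "\<delta> = \<epsilon> * \<gamma>"
  have \<delta>: "\<delta> > 0" using \<epsilon> \<gamma>0 by (simp add: \<delta>_def)
  have iq: "1 / q0 = 1 / 2 - (1 - \<epsilon>) * b" "1 / q1 = 1 / 2 - (1 + \<epsilon>) * b" by (simp_all add: q0_def q1_def)
  have "1 - \<epsilon> \<le> 1 + \<epsilon>" using \<epsilon> by simp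
  from mult_right_mono[OF this less_imp_le[OF b(1)]] have eb: "(1 - \<epsilon>) * b \<le> (1 + \<epsilon>) * b" .
  have epos: "0 < (1 - \<epsilon>) * b" "0 < (1 + \<epsilon>) * b" using \<epsilon>(1,2) b(1) by (intro mult_pos_pos; simp)+
  have gt2: "x > 2" if "1 / x < 1 / 2" "1 / x > 0" for x :: real
    using that by (simp add: field_simps)
  have "1 / q0 < 1 / 2" "1 / q1 < 1 / 2" "1 / q0 > 0" "1 / q1 > 0"
    unfolding iq using \<epsilon> eb epos by linarith+
  then have q01: "q0 > 2" "q1 > 2" using gt2 by blast+
  have e: "3 / 2 - 3 / q0 - \<gamma> = - \<delta>" "3 / 2 - 3 / q1 - \<gamma> = \<delta>"
  proof -
    have "3 / 2 - 3 / q0 - \<gamma> = 3 * (1 / 2 - 1 / q0) - \<gamma>" "3 / 2 - 3 / q1 - \<gamma> = 3 * (1 / 2 - 1 / q1) - \<gamma>" by simp_all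
    then show "3 / 2 - 3 / q0 - \<gamma> = - \<delta>" "3 / 2 - 3 / q1 - \<gamma> = \<delta>"
      unfolding iq \<delta>_def \<gamma> by (simp_all add: algebra_simps)
  qed
  have hq: "1 / q0 + 1 / q1 = 2 / q"
  proof -
    have e: "(1 - \<epsilon>) * w + (1 + \<epsilon>) * w = 2 * w" for w by (simp add: algebra_simps)
    have "1 / q0 + 1 / q1 = 1 - ((1 - \<epsilon>) * b + (1 + \<epsilon>) * b)" unfolding iq by simp
    then show "1 / q0 + 1 / q1 = 2 / q" unfolding e by (simp add: b_def)
  qed
  define c where "c = 27 * (1 + torus_vol) * 2 powr \<gamma>"
  have c: "c \<ge> 0" using torus_vol_pos by (simp add: c_def)
  define G where "G = 1 + 2 / (1 - 2 powr (- \<delta>))"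
  have "2 powr (- \<delta>) < (1::real)" using \<delta> by (simp add: powr_minus inverse_less_1_iff)
  then have G0: "G \<ge> 0" by (simp add: G_def)
  let ?C = "sqrt (c * c * G)"
  have "lpnorm torus q (wave_part \<phi> S a t) \<le> ?C * sqrt (\<Sum>k\<in>S. (1 + (norm (freq k))\<^sup>2) powr \<gamma> * (norm (a k))\<^sup>2)"
    if S: "finite S" and \<phi>: "\<phi> = cos \<or> \<phi> = sin"
    for S t and a :: "int^3 \<Rightarrow> complex" and \<phi> :: "real \<Rightarrow> real"
  proof -
    let ?P = "freq_level ` S"
    let ?S = "\<lambda>j. {k\<in>S. freq_level k = j}"
    let ?w = "\<lambda>j. wave_part \<phi> (?S j) a t"
    define A where "A j = sqrt (\<Sum>k\<in>?S j. (1 + (norm (freq k))\<^sup>2) powr \<gamma> * (norm (a k))\<^sup>2)" for j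
    have P: "finite ?P" using S by simp
    have A0: "A j \<ge> 0" for j unfolding A_def by (intro real_sqrt_ge_zero sum_nonneg mult_nonneg_nonneg) auto
    have Sj: "?S j \<noteq> {}" "\<forall>k\<in>?S j. freq_level k = j" if "j \<in> ?P" for j
      using that S by auto
    have t0: "lpnorm torus q0 (?w j) \<le> c * (2 powr (- (real j * \<delta>)) * A j)" if "j \<in> ?P" for j
      using block_estimate_sup[OF q01(1) less_imp_le[OF \<gamma>0] Sj[OF that] \<phi>, of a t] unfolding e A_def c_def by simp
    have t1: "lpnorm torus q1 (?w j) \<le> c * (2 powr (real j * \<delta>) * A j)" if "j \<in> ?P" for j
      using block_estimate_sup[OF q01(2) less_imp_le[OF \<gamma>0] Sj[OF that] \<phi>, of a t] unfolding e A_def c_def by simp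
    have prod: "lpnorm torus (q / 2) (\<lambda>x. ?w i x * ?w j x) \<le> (c * c) * ((2 powr (- (real i * \<delta>)) * A i) * (2 powr (real j * \<delta>) * A j))"
      if ij: "i \<in> ?P" "j \<in> ?P" for i j
    proof -
      have "lpnorm torus (q / 2) (\<lambda>x. ?w i x * ?w j x) \<le> lpnorm torus q0 (?w i) * lpnorm torus q1 (?w j)"
        by (rule block_product_le[OF q _ _ hq]) (use q01 in auto)
      also have "\<dots> \<le> (c * (2 powr (- (real i * \<delta>)) * A i)) * (c * (2 powr (real j * \<delta>) * A j))"
        by (intro mult_mono t0 t1 ij) (use c A0 in auto)
      finally show ?thesis by (simp only: mult.assoc mult.commute mult.left_commute)
    qed
    have eq: "wave_part \<phi> S a t = (\<lambda>x. \<Sum>j\<in>?P. ?w j x)"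
      by (rule ext) (rule wave_part_blocks[OF S])
    have "(lpnorm torus q (wave_part \<phi> S a t))\<^sup>2 = (lpnorm torus q (\<lambda>x. \<Sum>j\<in>?P. ?w j x))\<^sup>2"
      unfolding eq ..
    also have "\<dots> \<le> (\<Sum>p\<in>?P \<times> ?P. lpnorm torus (q / 2) (\<lambda>x. ?w (fst p) x * ?w (snd p) x))"
      using P q by (intro torus.lpnorm_sum_squared_le) auto
    also have "\<dots> \<le> (c * c) * G * (\<Sum>j\<in>?P. (A j)\<^sup>2)"
      unfolding G_def
    proof (rule bilinear_block_sum[OF P \<delta>])
      show "lpnorm torus (q / 2) (\<lambda>x. ?w i x * ?w j x) \<le> (c * c) * ((2 powr (- (real j * \<delta>)) * A j) * (2 powr (real i * \<delta>) * A i))"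
        if "i \<in> ?P" "j \<in> ?P" "i < j" for i j
        using prod[OF that(2,1)] by (simp only: mult.commute[of "?w i _"])
    qed (use c prod in auto)
    also have "(\<Sum>j\<in>?P. (A j)\<^sup>2) = (\<Sum>k\<in>S. (1 + (norm (freq k))\<^sup>2) powr \<gamma> * (norm (a k))\<^sup>2)"
      unfolding sum_blocks[OF S, symmetric] A_def
      by (intro sum.cong refl real_sqrt_pow2 sum_nonneg mult_nonneg_nonneg) auto
    finally have "sqrt ((lpnorm torus q (wave_part \<phi> S a t))\<^sup>2) \<le> sqrt (c * c * G * (\<Sum>k\<in>S. (1 + (norm (freq k))\<^sup>2) powr \<gamma> * (norm (a k))\<^sup>2))"
      by (rule real_sqrt_le_mono)
    then show ?thesis by (simp add: real_sqrt_mult)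
  qed
  moreover have "?C \<ge> 0" using c G0 by simp
  ultimately show ?thesis by blast
qed

section \<open>Recombination of cosine and sine and the passage to the half wave\<close>

definition half_wave_poly :: "(int^3) set \<Rightarrow> (int^3 \<Rightarrow> complex) \<Rightarrow> real \<Rightarrow> real^3 \<Rightarrow> complex" where
  "half_wave_poly S a t = trig_poly S (\<lambda>k. cis (t * norm (freq k)) * a k)"

lemma half_wave_poly_eq:
  "half_wave_poly S a t x = wave_part cos S a t x + \<i> * wave_part sin S a t x"
proof -
  have "cis z * a k = of_real (cos z) * a k + \<i> * (of_real (sin z) * a k)" for z k
    by (simp add: complex_eq_iff algebra_simps)
  then show ?thesis
    unfolding half_wave_poly_def wave_part_def trig_poly_def
    by (simp add: sum_distrib_left sum.distrib[symmetric] distrib_right mult.assoc)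
qed

lemma lpnorm_triangle:
  assumes u: "u \<in> bounded_measurable torus" and v: "v \<in> bounded_measurable torus" and q: "q \<ge> 1"
    and le: "\<And>x. norm (f x) \<le> norm (u x) + norm (v x)" and f: "f \<in> borel_measurable torus"
  shows "lpnorm torus q f \<le> lpnorm torus q u + lpnorm torus q v"
proof -
  \<comment> \<open>The two summands are indexed by booleans to fit
    \<open>lpnorm_sum_le\<close>.\<close>
  let ?w = "\<lambda>b x. if b then norm (u x) else norm (v x)"
  have [measurable]: "u \<in> borel_measurable torus" "v \<in> borel_measurable torus"
    using u v by (auto dest: bounded_measurable_measurable)
  have s: "(\<Sum>b\<in>UNIV. ?w b x) = norm (u x) + norm (v x)" for x by (simp add: UNIV_bool)
  obtain c d where c: "\<And>x. norm (u x) \<le> c" and d: "\<And>x. norm (v x) \<le> d"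
    using u v by (auto simp: bounded_measurable_def)
  have "(\<lambda>x. complex_of_real (norm (u x) + norm (v x))) \<in> bounded_measurable torus"
  proof (rule bounded_measurableI[where c="c + d"])
    show "norm (complex_of_real (norm (u x) + norm (v x))) \<le> c + d" for x
      unfolding norm_of_real using c[of x] d[of x] by simp
  qed measurable
  from torus.integrable_norm_powr[OF this, of q] q
  have int: "integrable torus (\<lambda>x. (norm (u x) + norm (v x)) powr q)" unfolding norm_of_real by simp
  have "lpnorm torus q f \<le> lpnorm torus q (\<lambda>x. norm (u x) + norm (v x))"
    using le q int f by (intro lpnorm_mono) auto
  also have "\<dots> = lpnorm torus q (\<lambda>x. \<Sum>b\<in>UNIV. ?w b x)" unfolding s ..
  also have "\<dots> \<le> (\<Sum>b\<in>UNIV. lpnorm torus q (?w b))"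
  proof (rule lpnorm_sum_le)
    show "integrable torus (\<lambda>x. ?w b x powr q)" for b
      using torus.integrable_norm_powr[OF u, of q] torus.integrable_norm_powr[OF v, of q] q by (cases b) auto
    show "?w b \<in> borel_measurable torus" for b by (cases b) auto
    show "integrable torus (\<lambda>x. (\<Sum>b\<in>UNIV. ?w b x) powr q)" unfolding s by (rule int)
  qed (use q in auto)
  also have "\<dots> = lpnorm torus q u + lpnorm torus q v" by (simp add: UNIV_bool)
  finally show ?thesis .
qed

lemma lpnorm_half_wave_le:
  "q \<ge> 1 \<Longrightarrow> lpnorm torus q (half_wave_poly S a t) \<le> lpnorm torus q (wave_part cos S a t) + lpnorm torus q (wave_part sin S a t)"
proof (rule lpnorm_triangle)
  fix x
  show "norm (half_wave_poly S a t x) \<le> norm (wave_part cos S a t x) + norm (wave_part sin S a t x)"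
    unfolding half_wave_poly_eq by (rule order_trans[OF norm_triangle_ineq]) (simp add: norm_mult)
  show "half_wave_poly S a t \<in> borel_measurable torus" unfolding half_wave_poly_def by measurable
qed auto

text \<open>A rough triangle inequality: x \<le> 2 max y z, the p-th power of a maximum is at most
  the sum of the powers, and 2 \<le> 2^p. Each of the last two losses costs a factor 2 after the
  root, hence 4 for every p.\<close>

lemma discrete_triangle:
  fixes x y z :: "int \<Rightarrow> real"
  assumes p: "p \<ge> 1" and \<tau>: "\<tau> > 0" and nn: "\<And>n. x n \<ge> 0" "\<And>n. y n \<ge> 0" "\<And>n. z n \<ge> 0"
    and le: "\<And>n. x n \<le> y n + z n"
    and E: "(\<tau> * (\<Sum>n\<in>I. y n powr p)) powr (1 / p) \<le> E" "(\<tau> * (\<Sum>n\<in>I. z n powr p)) powr (1 / p) \<le> E"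
  shows "(\<tau> * (\<Sum>n\<in>I. x n powr p)) powr (1 / p) \<le> 4 * E"
proof -
  have E0: "E \<ge> 0" by (rule order_trans[OF _ E(1)]) simp
  have root: "t \<le> E powr p" if "t powr (1 / p) \<le> E" "t \<ge> 0" for t
  proof -
    have "(t powr (1 / p)) powr p \<le> E powr p" using that p by (intro powr_mono2) auto
    then show ?thesis using that p by (simp add: powr_powr)
  qed
  have pw: "x n powr p \<le> 2 powr p * (y n powr p + z n powr p)" for n
  proof -
    have "x n \<le> 2 * max (y n) (z n)" using le[of n] by simp
    then have "x n powr p \<le> (2 * max (y n) (z n)) powr p" using p nn by (intro powr_mono2) auto
    also have "\<dots> = 2 powr p * max (y n) (z n) powr p" by (rule powr_mult)
    also have "\<dots> \<le> 2 powr p * (y n powr p + z n powr p)" by (intro mult_left_mono) (auto simp: max_def)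
    finally show ?thesis .
  qed
  have "\<tau> * (\<Sum>n\<in>I. x n powr p) \<le> \<tau> * (\<Sum>n\<in>I. 2 powr p * (y n powr p + z n powr p))"
    using \<tau> by (intro mult_left_mono sum_mono pw) auto
  also have "\<dots> = 2 powr p * (\<tau> * (\<Sum>n\<in>I. y n powr p) + \<tau> * (\<Sum>n\<in>I. z n powr p))"
    by (simp add: sum_distrib_left[symmetric] sum.distrib distrib_left)
  also have "\<dots> \<le> 2 powr p * (E powr p + E powr p)"
    using E \<tau> by (intro mult_left_mono add_mono root) (auto intro!: sum_nonneg mult_nonneg_nonneg)
  also have "\<dots> \<le> 2 powr p * (2 powr p * E powr p)"
  proof (rule mult_left_mono)
    have "(2::real) powr 1 \<le> 2 powr p" using p by (intro powr_mono) auto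
    then have "2 * E powr p \<le> 2 powr p * E powr p" by (intro mult_right_mono) auto
    then show "E powr p + E powr p \<le> 2 powr p * E powr p" by simp
  qed simp
  also have "\<dots> = (4 * E) powr p"
  proof -
    have "2 powr p * (2 powr p * E powr p) = (2 * (2 * E)) powr p" by (simp only: powr_mult)
    then show ?thesis by simp
  qed
  finally have "(\<tau> * (\<Sum>n\<in>I. x n powr p)) powr (1 / p) \<le> ((4 * E) powr p) powr (1 / p)"
    using \<tau> p by (intro powr_mono2) (auto intro!: mult_nonneg_nonneg sum_nonneg)
  also have "\<dots> = 4 * E" using E0 p by (simp add: powr_powr)
  finally show ?thesis .
qed

lemma finite_infnorm_freq: "finite {k. infnorm (freq k) \<le> K}"
  and infnorm_freq_box: "{k. infnorm (freq k) \<le> K} \<subseteq> freq_box (nat \<lfloor>K\<rfloor>)"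
proof -
  show sub: "{k. infnorm (freq k) \<le> K} \<subseteq> freq_box (nat \<lfloor>K\<rfloor>)"
  proof
    fix k assume "k \<in> {k. infnorm (freq k) \<le> K}"
    then have "\<bar>real_of_int (k $ i)\<bar> \<le> K" for i
      using component_le_infnorm_cart[of "freq k" i] by (simp add: freq_def)
    then have "\<bar>k $ i\<bar> \<le> \<lfloor>K\<rfloor>" for i by (simp add: le_floor_iff)
    moreover have "\<lfloor>K\<rfloor> \<le> int (nat \<lfloor>K\<rfloor>)" by simp
    ultimately show "k \<in> freq_box (nat \<lfloor>K\<rfloor>)" unfolding freq_box_iff using order_trans by blast
  qed
  then show "finite {k. infnorm (freq k) \<le> K}" by (rule finite_subset) simp
qed

lemma fourier_mode_exp: "exp (\<i> * of_real (freq k \<bullet> x)) = fourier_mode k x"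
  "exp (- (\<i> * of_real (freq k \<bullet> x))) = cnj (fourier_mode k x)"
  by (simp_all add: fourier_mode_def cis_conv_exp exp_cnj)

definition fourier_const :: real where
  "fourier_const = (2 * pi) powr (- 3 / 2)"

lemma fourier_const: "0 < fourier_const" "fourier_const \<le> 1" "fourier_const * (torus_vol * fourier_const) = 1"
proof -
  show "0 < fourier_const" by (simp add: fourier_const_def)
  have "(2 * pi) powr (- 3 / 2) \<le> (2 * pi) powr 0" using pi_ge_two by (intro powr_mono) auto
  then show "fourier_const \<le> 1" by (simp add: fourier_const_def)
  have "fourier_const * fourier_const = (2 * pi) powr (- 3)"
    unfolding fourier_const_def by (simp only: powr_add[symmetric]) simp
  also have "\<dots> = inverse torus_vol" by (simp add: powr_minus torus_vol_def)
  finally have c: "fourier_const * fourier_const = inverse torus_vol" .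
  have "fourier_const * (torus_vol * fourier_const) = (fourier_const * fourier_const) * torus_vol"
    by (simp only: mult.assoc mult.commute mult.left_commute)
  then show "fourier_const * (torus_vol * fourier_const) = 1"
    unfolding c using torus_vol_pos by simp
qed

text \<open>By orthogonality the coefficients of the projected function are those of f inside the
  cube and 0 outside, so the unconditional sum of the multiplier has finitely many nonzero
  terms.\<close>

lemma half_wave_freq_proj:
  fixes f :: "real^3 \<Rightarrow> complex" and K :: real
  defines "S \<equiv> {k. infnorm (freq k) \<le> K}"
  shows "half_wave t (freq_proj K f) = half_wave_poly S (\<lambda>k. of_real fourier_const * fourier_coeff f k) t"
proof
  fix x
  have S: "finite S" unfolding S_def by (rule finite_infnorm_freq)
  have "freq_proj K f = trig_poly S (\<lambda>k. of_real fourier_const * fourier_coeff f k)"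
    by (rule ext) (simp add: freq_proj_def trig_poly_def S_def fourier_mode_exp fourier_const_def sum_distrib_left mult.assoc)
  then have "fourier_coeff (freq_proj K f) k = of_real fourier_const * mode_integral (trig_poly S (\<lambda>k. of_real fourier_const * fourier_coeff f k)) k" for k
    by (simp add: fourier_coeff_def mode_integral_def fourier_mode_exp fourier_const_def)
  also have "\<dots> k = (if k \<in> S then of_real (fourier_const * (torus_vol * fourier_const)) * fourier_coeff f k else 0)" for k
    unfolding mode_integral_trig_poly[OF S] by simp
  finally have coeff: "fourier_coeff (freq_proj K f) k = (if k \<in> S then fourier_coeff f k else 0)" for k
    unfolding fourier_const(3) by simp
  have "(\<Sum>\<^sub>\<infinity>k\<in>UNIV. exp (\<i> * of_real (t * norm (freq k))) * fourier_coeff (freq_proj K f) k * exp (\<i> * of_real (freq k \<bullet> x)))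
    = (\<Sum>\<^sub>\<infinity>k\<in>S. cis (t * norm (freq k)) * fourier_coeff f k * fourier_mode k x)"
    by (rule infsum_cong_neutral) (auto simp: coeff fourier_mode_exp cis_conv_exp)
  also have "\<dots> = (\<Sum>k\<in>S. cis (t * norm (freq k)) * fourier_coeff f k * fourier_mode k x)"
    using S by (rule infsum_finite)
  finally show "half_wave t (freq_proj K f) x = half_wave_poly S (\<lambda>k. of_real fourier_const * fourier_coeff f k) t x"
    by (simp add: half_wave_def fourier_multiplier_def half_wave_poly_def trig_poly_def fourier_const_def sum_distrib_left mult_ac)
qed

section \<open>Transfer to extended-real norms and the final estimates\<close>

lemma Lnorm_eq_lpnorm:
  assumes "v \<in> bounded_measurable torus" "q > 0"
  shows "Lnorm (ennreal q) v = ennreal (lpnorm torus q v)"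
proof -
  have "(\<integral>\<^sup>+x. ennreal (norm (v x) powr q) \<partial>torus) = ennreal (\<integral>x. norm (v x) powr q \<partial>torus)"
    using assms by (intro nn_integral_eq_integral torus.integrable_norm_powr) auto
  then show ?thesis
    using assms(2) by (simp add: Lnorm_def ennreal_powr_def lpnorm_def integral_nonneg_AE)
qed

lemma ennreal_powr_mono:
  assumes "x \<le> y" "a \<ge> 0"
  shows "ennreal_powr x a \<le> ennreal_powr y a"
proof (cases "y = \<infinity>")
  case False
  then have "x < top" "y < top" using assms(1) by (auto simp: less_top[symmetric] top_unique)
  then have "enn2real x \<le> enn2real y" using assms(1) by (intro enn2real_mono) auto
  then show ?thesis
    using False \<open>x < top\<close> assms(2) by (auto simp: ennreal_powr_def intro!: ennreal_leI powr_mono2)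
qed (simp add: ennreal_powr_def)

lemma ennreal_powr_ennreal: "x \<ge> 0 \<Longrightarrow> ennreal_powr (ennreal x) a = ennreal (x powr a)"
  by (simp add: ennreal_powr_def)

text \<open>The extended-real sum of nonnegative terms is the supremum of its finite partial
  sums.\<close>

lemma sobolev_sum_le_Hnorm:
  assumes "finite S"
  shows "ennreal (sqrt (\<Sum>k\<in>S. (1 + (norm (freq k))\<^sup>2) powr s * (norm (fourier_coeff f k))\<^sup>2)) \<le> Hnorm s f"
proof -
  let ?g = "\<lambda>k. (1 + (norm (freq k))\<^sup>2) powr s * (norm (fourier_coeff f k))\<^sup>2"
  have "ennreal (\<Sum>k\<in>S. ?g k) = (\<Sum>k\<in>S. ennreal (?g k))" by (intro sum_ennreal[symmetric]) auto
  also have "\<dots> \<le> (\<Sum>\<^sub>\<infinity>k\<in>UNIV. ennreal (?g k))"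
    unfolding nonneg_infsum_complete[OF zero_le] using assms by (intro SUP_upper) auto
  finally have "ennreal_powr (ennreal (\<Sum>k\<in>S. ?g k)) (1 / 2) \<le> Hnorm s f"
    unfolding Hnorm_def by (intro ennreal_powr_mono) auto
  moreover have "(\<Sum>k\<in>S. ?g k) \<ge> 0" by (intro sum_nonneg) auto
  ultimately show ?thesis by (simp add: ennreal_powr_ennreal powr_half_sqrt)
qed

lemma finite_times:
  fixes \<tau> T :: real
  assumes "\<tau> > 0"
  shows "finite {n::int. of_int n * \<tau> \<in> {0..T}}"
proof (rule finite_subset)
  show "{n::int. of_int n * \<tau> \<in> {0..T}} \<subseteq> {0..\<lfloor>T / \<tau>\<rfloor>}"
  proof
    fix n :: int assume "n \<in> {n. of_int n * \<tau> \<in> {0..T}}"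
    then have n: "0 \<le> of_int n * \<tau>" "of_int n * \<tau> \<le> T" by auto
    have "0 \<le> (of_int n :: real)" using n(1) assms by (simp add: zero_le_mult_iff)
    moreover have "of_int n \<le> T / \<tau>" using n(2) assms by (simp add: pos_le_divide_eq)
    ultimately show "n \<in> {0..\<lfloor>T / \<tau>\<rfloor>}" by (simp add: le_floor_iff)
  qed
qed simp

text \<open>Only finitely many grid times lie in [0, T], so the sum over them is finite and the
  bounds can be added as real numbers.\<close>

lemma discrete_norm_le:
  fixes x :: "int \<Rightarrow> real"
  assumes \<tau>: "\<tau> > 0" and p: "p > 0" and x: "\<And>n. x n \<ge> 0"
    and le: "\<And>n. of_int n * \<tau> \<in> {0..T} \<Longrightarrow> N (F n) \<le> ennreal (x n)"
  shows "discrete_norm (ennreal p) \<tau> {0..T} N F \<le> ennreal ((\<tau> * (\<Sum>n\<in>{n. of_int n * \<tau> \<in> {0..T}}. x n powr p)) powr (1 / p))"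
proof -
  let ?I = "{n::int. of_int n * \<tau> \<in> {0..T}}"
  have fin: "finite ?I" by (rule finite_times[OF \<tau>])
  have "(\<Sum>\<^sub>\<infinity>n\<in>?I. ennreal_powr (N (F n)) p) = (\<Sum>n\<in>?I. ennreal_powr (N (F n)) p)"
    using fin by (rule infsum_finite)
  also have "\<dots> \<le> (\<Sum>n\<in>?I. ennreal (x n powr p))"
  proof (rule sum_mono)
    fix n assume "n \<in> ?I"
    then have "ennreal_powr (N (F n)) p \<le> ennreal_powr (ennreal (x n)) p"
      using le p by (intro ennreal_powr_mono) auto
    then show "ennreal_powr (N (F n)) p \<le> ennreal (x n powr p)" by (simp add: ennreal_powr_ennreal x)
  qed
  also have "\<dots> = ennreal (\<Sum>n\<in>?I. x n powr p)" by (intro sum_ennreal) auto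
  finally have "ennreal \<tau> * (\<Sum>\<^sub>\<infinity>n\<in>?I. ennreal_powr (N (F n)) p) \<le> ennreal \<tau> * ennreal (\<Sum>n\<in>?I. x n powr p)"
    by (rule mult_left_mono) simp
  also have "\<dots> = ennreal (\<tau> * (\<Sum>n\<in>?I. x n powr p))"
    using \<tau> by (intro ennreal_mult[symmetric]) (auto intro: sum_nonneg)
  finally have "ennreal_powr (ennreal \<tau> * (\<Sum>\<^sub>\<infinity>n\<in>?I. ennreal_powr (N (F n)) p)) (1 / p)
    \<le> ennreal_powr (ennreal (\<tau> * (\<Sum>n\<in>?I. x n powr p))) (1 / p)"
    using p by (intro ennreal_powr_mono) auto
  also have "\<dots> = ennreal ((\<tau> * (\<Sum>n\<in>?I. x n powr p)) powr (1 / p))"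
    using \<tau> by (intro ennreal_powr_ennreal mult_nonneg_nonneg sum_nonneg) auto
  finally show ?thesis using p by (simp add: discrete_norm_def)
qed

lemma scaled_sobolev_sum_le:
  "sqrt (\<Sum>k\<in>S. (1 + (norm (freq k))\<^sup>2) powr s * (norm (of_real fourier_const * fourier_coeff f k))\<^sup>2)
    \<le> sqrt (\<Sum>k\<in>S. (1 + (norm (freq k))\<^sup>2) powr s * (norm (fourier_coeff f k))\<^sup>2)"
proof (intro real_sqrt_le_mono sum_mono mult_left_mono power_mono)
  fix k
  show "norm (of_real fourier_const * fourier_coeff f k) \<le> norm (fourier_coeff f k)"
    unfolding norm_mult norm_of_real using fourier_const by (intro mult_left_le_one_le) auto
qed auto

lemma bounded_measurable_half_wave_poly [simp]: "half_wave_poly S a t \<in> bounded_measurable torus"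
  by (simp add: half_wave_poly_def)

lemma ennreal_bound_trans:
  assumes "X \<le> ennreal y" "y \<le> c * z" "ennreal z \<le> H" "c \<ge> 0" "z \<ge> 0"
  shows "X \<le> ennreal c * H"
proof -
  have "X \<le> ennreal (c * z)" using assms(1,2) by (rule order_trans[OF _ ennreal_leI])
  also have "\<dots> = ennreal c * ennreal z" using assms by (simp add: ennreal_mult)
  also have "\<dots> \<le> ennreal c * H" using assms(3) by (rule mult_left_mono) simp
  finally show ?thesis .
qed

theorem strichartz_finite:
  assumes T: "T \<ge> 0" and p: "p > 2" and pq: "1 / p + 1 / q \<le> 1 / 2" and q: "q \<ge> 2"
    and \<gamma>: "\<gamma> = 3 / 2 - 3 / q - 1 / p"
  shows "\<exists>C\<ge>0. \<forall>f. \<forall>\<tau>::real. \<forall>K::real. 0 < \<tau> \<and> 1 \<le> K \<longrightarrow>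
    discrete_norm (ennreal p) \<tau> {0..T} (Lnorm (ennreal q)) (\<lambda>n. half_wave (of_int n * \<tau>) (freq_proj K f))
      \<le> ennreal (C * (1 + K * \<tau>) powr (1 / p)) * Hnorm \<gamma> f"
proof -
  \<comment> \<open>At q = 2 the condition would force 1/p \<le> 0, which is impossible for a finite
    p.\<close>
  have q2: "q > 2"
  proof (rule ccontr)
    assume "\<not> q > 2"
    then have "q = 2" using q by simp
    then show False using pq p by simp
  qed
  obtain C where C: "C \<ge> 0" and main: "\<And>K \<tau> I S a \<phi>. \<lbrakk>K \<ge> 1; \<tau> > 0; finite I; \<forall>n\<in>I. of_int n * \<tau> \<in> {0..T};
     finite S; \<forall>k\<in>S. infnorm (freq k) \<le> K; \<phi> = cos \<or> \<phi> = sin\<rbrakk> \<Longrightarrow>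
     (\<tau> * (\<Sum>n\<in>I. lpnorm torus q (wave_part \<phi> S a (of_int n * \<tau>)) powr p)) powr (1 / p)
       \<le> C * (1 + K * \<tau>) powr (1 / p) * sqrt (\<Sum>k\<in>S. (1 + (norm (freq k))\<^sup>2) powr \<gamma> * (norm (a k))\<^sup>2)"
    using strichartz_part[OF p q2 pq T] that unfolding \<gamma> by (elim exE conjE) blast
  have "discrete_norm (ennreal p) \<tau> {0..T} (Lnorm (ennreal q)) (\<lambda>n. half_wave (of_int n * \<tau>) (freq_proj K f))
      \<le> ennreal (4 * C * (1 + K * \<tau>) powr (1 / p)) * Hnorm \<gamma> f"
    if \<tau>: "0 < \<tau>" and K: "1 \<le> K" for f \<tau> K
  proof -
    let ?S = "{k. infnorm (freq k) \<le> K}" and ?I = "{n::int. of_int n * \<tau> \<in> {0..T}}"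
    let ?a = "\<lambda>k. of_real fourier_const * fourier_coeff f k"
    let ?A = "sqrt (\<Sum>k\<in>?S. (1 + (norm (freq k))\<^sup>2) powr \<gamma> * (norm (?a k))\<^sup>2)"
    let ?F = "sqrt (\<Sum>k\<in>?S. (1 + (norm (freq k))\<^sup>2) powr \<gamma> * (norm (fourier_coeff f k))\<^sup>2)"
    let ?E = "C * (1 + K * \<tau>) powr (1 / p) * ?A"
    have S: "finite ?S" by (rule finite_infnorm_freq)
    have I: "finite ?I" by (rule finite_times[OF \<tau>])
    have part: "(\<tau> * (\<Sum>n\<in>?I. lpnorm torus q (wave_part \<phi> ?S ?a (of_int n * \<tau>)) powr p)) powr (1 / p) \<le> ?E"
      if "\<phi> = cos \<or> \<phi> = sin" for \<phi> :: "real \<Rightarrow> real"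
      by (rule main[OF K \<tau> I _ S _ that]) auto
    have tri: "(\<tau> * (\<Sum>n\<in>?I. lpnorm torus q (half_wave_poly ?S ?a (of_int n * \<tau>)) powr p)) powr (1 / p) \<le> 4 * ?E"
      by (rule discrete_triangle[where y="\<lambda>n. lpnorm torus q (wave_part cos ?S ?a (of_int n * \<tau>))"
            and z="\<lambda>n. lpnorm torus q (wave_part sin ?S ?a (of_int n * \<tau>))"])
        (use p q2 \<tau> part lpnorm_half_wave_le[of q] in auto)
    show ?thesis
    proof (rule ennreal_bound_trans)
      show "discrete_norm (ennreal p) \<tau> {0..T} (Lnorm (ennreal q)) (\<lambda>n. half_wave (of_int n * \<tau>) (freq_proj K f))
        \<le> ennreal ((\<tau> * (\<Sum>n\<in>?I. lpnorm torus q (half_wave_poly ?S ?a (of_int n * \<tau>)) powr p)) powr (1 / p))"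
        by (rule discrete_norm_le) (use \<tau> p q2 in \<open>auto simp: half_wave_freq_proj Lnorm_eq_lpnorm\<close>)
      have "4 * ?E = (4 * C * (1 + K * \<tau>) powr (1 / p)) * ?A" by (simp only: mult.assoc)
      also have "\<dots> \<le> (4 * C * (1 + K * \<tau>) powr (1 / p)) * ?F"
        using C by (intro mult_left_mono scaled_sobolev_sum_le) auto
      finally show "(\<tau> * (\<Sum>n\<in>?I. lpnorm torus q (half_wave_poly ?S ?a (of_int n * \<tau>)) powr p)) powr (1 / p)
        \<le> (4 * C * (1 + K * \<tau>) powr (1 / p)) * ?F"
        using tri by (rule order_trans[rotated])
      show "ennreal ?F \<le> Hnorm \<gamma> f" by (rule sobolev_sum_le_Hnorm[OF S])
    qed (use C in \<open>auto intro!: sum_nonneg\<close>)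
  qed
  moreover have "4 * C \<ge> 0" using C by simp
  ultimately show ?thesis by blast
qed

text \<open>For p = \<infinity> the times decouple, and the claim is a Sobolev embedding with a
  constant that does not depend on the time.\<close>

theorem strichartz_infinite:
  assumes q: "q \<ge> 2" and \<gamma>: "\<gamma> = 3 / 2 - 3 / q"
  shows "\<exists>C\<ge>0. \<forall>f. \<forall>\<tau>::real. \<forall>K::real.
    discrete_norm \<infinity> \<tau> {0..T} (Lnorm (ennreal q)) (\<lambda>n. half_wave (of_int n * \<tau>) (freq_proj K f))
      \<le> ennreal C * Hnorm \<gamma> f"
proof -
  have "\<exists>C\<ge>0. \<forall>S a t. finite S \<longrightarrow> lpnorm torus q (half_wave_poly S a t)
      \<le> C * sqrt (\<Sum>k\<in>S. (1 + (norm (freq k))\<^sup>2) powr \<gamma> * (norm (a k))\<^sup>2)"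
  \<comment> \<open>At q = 2 the order \<gamma> is 0 and Plancherel suffices;
    \<open>sobolev_part\<close> covers q > 2.\<close>
  proof (cases "q = 2")
    case True
    have "lpnorm torus q (half_wave_poly S a t) \<le> sqrt torus_vol * sqrt (\<Sum>k\<in>S. (1 + (norm (freq k))\<^sup>2) powr \<gamma> * (norm (a k))\<^sup>2)"
      if "finite S" for S a t
    proof -
      \<comment> \<open>A nonzero base is what makes the zeroth power equal to 1.\<close>
      have r: "1 + (norm (freq k))\<^sup>2 \<noteq> 0" for k using zero_le_power2[of "norm (freq k)"] by linarith
      have "lpnorm torus q (half_wave_poly S a t) = sqrt (\<integral>x. (norm (half_wave_poly S a t x))\<^sup>2 \<partial>torus)"
        using True by (simp add: lpnorm_def powr_half_sqrt integral_nonneg_AE)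
      also have "\<dots> = sqrt (torus_vol * (\<Sum>k\<in>S. (norm (a k))\<^sup>2))"
        unfolding half_wave_poly_def integral_norm_squared_trig_poly[OF that] by (simp add: norm_mult)
      finally show ?thesis using True r by (simp add: real_sqrt_mult \<gamma>)
    qed
    then show ?thesis using torus_vol_pos by (intro exI[of _ "sqrt torus_vol"]) auto
  next
    case False
    then have q2: "q > 2" using q by simp
    obtain C where C: "C \<ge> 0" and main: "\<And>S a \<phi> t. \<lbrakk>finite S; \<phi> = cos \<or> \<phi> = sin\<rbrakk> \<Longrightarrow>
     lpnorm torus q (wave_part \<phi> S a t) \<le> C * sqrt (\<Sum>k\<in>S. (1 + (norm (freq k))\<^sup>2) powr \<gamma> * (norm (a k))\<^sup>2)"
      using sobolev_part[OF q2] that unfolding \<gamma> by (elim exE conjE) blast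
    have "lpnorm torus q (half_wave_poly S a t) \<le> (2 * C) * sqrt (\<Sum>k\<in>S. (1 + (norm (freq k))\<^sup>2) powr \<gamma> * (norm (a k))\<^sup>2)"
      if "finite S" for S a t
      using lpnorm_half_wave_le[of q S a t] main[OF that, of cos a t] main[OF that, of sin a t] q2 by simp
    then show ?thesis using C by (intro exI[of _ "2 * C"]) auto
  qed
  then obtain C where C: "C \<ge> 0" and main: "\<And>S a t. finite S \<Longrightarrow> lpnorm torus q (half_wave_poly S a t)
      \<le> C * sqrt (\<Sum>k\<in>S. (1 + (norm (freq k))\<^sup>2) powr \<gamma> * (norm (a k))\<^sup>2)" by blast
  have "discrete_norm \<infinity> \<tau> {0..T} (Lnorm (ennreal q)) (\<lambda>n. half_wave (of_int n * \<tau>) (freq_proj K f)) \<le> ennreal C * Hnorm \<gamma> f"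
    for f \<tau> K
  proof -
    let ?S = "{k. infnorm (freq k) \<le> K}"
    let ?a = "\<lambda>k. of_real fourier_const * fourier_coeff f k"
    let ?F = "sqrt (\<Sum>k\<in>?S. (1 + (norm (freq k))\<^sup>2) powr \<gamma> * (norm (fourier_coeff f k))\<^sup>2)"
    have S: "finite ?S" by (rule finite_infnorm_freq)
    have "Lnorm (ennreal q) (half_wave t (freq_proj K f)) \<le> ennreal C * Hnorm \<gamma> f" for t
    proof (rule ennreal_bound_trans)
      show "Lnorm (ennreal q) (half_wave t (freq_proj K f)) \<le> ennreal (lpnorm torus q (half_wave_poly ?S ?a t))"
        using q by (simp add: half_wave_freq_proj Lnorm_eq_lpnorm)
      show "lpnorm torus q (half_wave_poly ?S ?a t) \<le> C * ?F"
        by (rule order_trans[OF main[OF S] mult_left_mono[OF scaled_sobolev_sum_le C]])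
      show "ennreal ?F \<le> Hnorm \<gamma> f" by (rule sobolev_sum_le_Hnorm[OF S])
    qed (use C in \<open>auto intro!: sum_nonneg\<close>)
    then show ?thesis by (simp add: discrete_norm_def SUP_least)
  qed
  then show ?thesis using C by blast
qed

text \<open>A trigonometric polynomial is continuous on the compact cube, so its modulus has a
  maximum there, which bounds the essential supremum. These maximum points are the X n of
  \<open>endpoint_strichartz\<close>.\<close>

lemma Lnorm_infinity_attained:
  obtains X where "Lnorm \<infinity> (half_wave_poly S a t) \<le> ennreal (norm (half_wave_poly S a t X))"
proof -
  let ?u = "half_wave_poly S a t" and ?Q = "cbox (\<chi> i. - pi) (\<chi> i. pi) :: (real^3) set"
  have cont: "continuous_on ?Q (\<lambda>x. norm (?u x))"
    unfolding half_wave_poly_def trig_poly_def fourier_mode_def by (intro continuous_intros)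
  have "0 \<in> ?Q" by (simp add: mem_box_cart)
  then obtain X where X: "\<And>x. x \<in> ?Q \<Longrightarrow> norm (?u x) \<le> norm (?u X)"
    using continuous_attains_sup[OF compact_cbox _ cont] by blast
  have [measurable]: "?u \<in> borel_measurable torus" unfolding half_wave_poly_def by measurable
  have "esssup torus (\<lambda>x. ennreal (norm (?u x))) \<le> ennreal (norm (?u X))"
    by (rule esssup_I) (auto intro!: AE_I2 ennreal_leI X simp: space_torus)
  then show ?thesis by (intro that[of X]) (simp add: Lnorm_def)
qed

theorem strichartz_endpoint:
  assumes T: "T \<ge> 0"
  shows "\<exists>C\<ge>0. \<forall>h. \<forall>\<tau>::real. \<forall>K::real. 0 < \<tau> \<and> 1 \<le> K \<longrightarrow>
    discrete_norm 2 \<tau> {0..T} (Lnorm \<infinity>) (\<lambda>n. half_wave (of_int n * \<tau>) (freq_proj K h))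
      \<le> ennreal (C * (1 + K * \<tau> + ln K) powr (1 / 2)) * Hnorm 1 h"
proof -
  obtain C where C: "C \<ge> 0" and main: "\<And>K \<tau> I S a \<phi> X. \<lbrakk>K \<ge> 1; \<tau> > 0; finite I; \<forall>n\<in>I. of_int n * \<tau> \<in> {0..T};
     S \<subseteq> freq_box (nat \<lfloor>K\<rfloor>); \<phi> = cos \<or> \<phi> = sin\<rbrakk> \<Longrightarrow>
     \<tau> * (\<Sum>n\<in>I. (norm (wave_part \<phi> S a (of_int n * \<tau>) (X n)))\<^sup>2)
       \<le> C * (1 + K * \<tau> + ln K) * (\<Sum>k\<in>S. (1 + (norm (freq k))\<^sup>2) * (norm (a k))\<^sup>2)"
    using endpoint_strichartz[OF T] that by (elim exE conjE) blast
  have "discrete_norm 2 \<tau> {0..T} (Lnorm \<infinity>) (\<lambda>n. half_wave (of_int n * \<tau>) (freq_proj K h))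
      \<le> ennreal (sqrt (4 * C) * (1 + K * \<tau> + ln K) powr (1 / 2)) * Hnorm 1 h"
    if \<tau>: "0 < \<tau>" and K: "1 \<le> K" for h \<tau> K
  proof -
    let ?S = "{k. infnorm (freq k) \<le> K}" and ?I = "{n::int. of_int n * \<tau> \<in> {0..T}}"
    let ?a = "\<lambda>k. of_real fourier_const * fourier_coeff h k"
    let ?A = "sqrt (\<Sum>k\<in>?S. (1 + (norm (freq k))\<^sup>2) powr 1 * (norm (?a k))\<^sup>2)"
    let ?F = "sqrt (\<Sum>k\<in>?S. (1 + (norm (freq k))\<^sup>2) powr 1 * (norm (fourier_coeff h k))\<^sup>2)"
    have S: "finite ?S" by (rule finite_infnorm_freq)
    have I: "finite ?I" by (rule finite_times[OF \<tau>])
    let ?u = "\<lambda>n::int. half_wave_poly ?S ?a (of_int n * \<tau>)"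
    have "\<exists>X. Lnorm \<infinity> (?u n) \<le> ennreal (norm (?u n X))" for n
      using Lnorm_infinity_attained[of ?S ?a "of_int n * \<tau>"] by blast
    then obtain X where X: "\<And>n. Lnorm \<infinity> (?u n) \<le> ennreal (norm (?u n (X n)))" by metis
    let ?w = "\<lambda>\<phi> (n::int). wave_part \<phi> ?S ?a (of_int n * \<tau>) (X n)"
    let ?L = "1 + K * \<tau> + ln K"
    have L: "?L > 0" using K \<tau> by (intro add_pos_nonneg) auto
    have A2: "(\<Sum>k\<in>?S. (1 + (norm (freq k))\<^sup>2) * (norm (?a k))\<^sup>2) = ?A\<^sup>2"
      by (simp add: sum_nonneg)
    have part: "\<tau> * (\<Sum>n\<in>?I. (norm (?w \<phi> n))\<^sup>2) \<le> C * ?L * ?A\<^sup>2" if "\<phi> = cos \<or> \<phi> = sin" for \<phi> :: "real \<Rightarrow> real"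
      unfolding A2[symmetric] by (rule main[OF K \<tau> I _ infnorm_freq_box that]) auto
    have "(norm (?u n (X n)))\<^sup>2 \<le> 2 * (norm (?w cos n))\<^sup>2 + 2 * (norm (?w sin n))\<^sup>2" for n
    proof -
      have "norm (?u n (X n)) \<le> norm (?w cos n) + norm (?w sin n)"
        unfolding half_wave_poly_eq by (rule order_trans[OF norm_triangle_ineq]) (simp add: norm_mult)
      then have "(norm (?u n (X n)))\<^sup>2 \<le> (norm (?w cos n) + norm (?w sin n))\<^sup>2" by (intro power_mono) auto
      also have "\<dots> \<le> 2 * (norm (?w cos n))\<^sup>2 + 2 * (norm (?w sin n))\<^sup>2"
        using sum_squares_bound[of "norm (?w cos n)" "norm (?w sin n)"] by (simp add: power2_sum)
      finally show ?thesis .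
    qed
    then have "\<tau> * (\<Sum>n\<in>?I. (norm (?u n (X n)))\<^sup>2) \<le> \<tau> * (\<Sum>n\<in>?I. 2 * (norm (?w cos n))\<^sup>2 + 2 * (norm (?w sin n))\<^sup>2)"
      using \<tau> by (intro mult_left_mono sum_mono) auto
    also have "\<dots> = 2 * (\<tau> * (\<Sum>n\<in>?I. (norm (?w cos n))\<^sup>2)) + 2 * (\<tau> * (\<Sum>n\<in>?I. (norm (?w sin n))\<^sup>2))"
      by (simp only: sum.distrib sum_distrib_left[symmetric] distrib_left mult.left_commute)
    also have "\<dots> \<le> 4 * C * ?L * ?A\<^sup>2" using part[of cos] part[of sin] by simp
    finally have tot: "\<tau> * (\<Sum>n\<in>?I. (norm (?u n (X n)))\<^sup>2) \<le> 4 * C * ?L * ?A\<^sup>2" .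
    show ?thesis
    proof (rule ennreal_bound_trans)
      have "discrete_norm (ennreal 2) \<tau> {0..T} (Lnorm \<infinity>) (\<lambda>n. half_wave (of_int n * \<tau>) (freq_proj K h))
        \<le> ennreal ((\<tau> * (\<Sum>n\<in>?I. norm (?u n (X n)) powr 2)) powr (1 / 2))"
        by (rule discrete_norm_le) (use \<tau> X in \<open>auto simp: half_wave_freq_proj\<close>)
      then show "discrete_norm 2 \<tau> {0..T} (Lnorm \<infinity>) (\<lambda>n. half_wave (of_int n * \<tau>) (freq_proj K h))
        \<le> ennreal ((\<tau> * (\<Sum>n\<in>?I. (norm (?u n (X n)))\<^sup>2)) powr (1 / 2))" by simp
      have "(\<tau> * (\<Sum>n\<in>?I. (norm (?u n (X n)))\<^sup>2)) powr (1 / 2) \<le> (4 * C * ?L * ?A\<^sup>2) powr (1 / 2)"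
        using tot \<tau> by (intro powr_mono2) (auto intro!: mult_nonneg_nonneg sum_nonneg)
      also have "\<dots> = sqrt (4 * C) * ?L powr (1 / 2) * ?A"
      proof -
        have "?A \<ge> 0" by (intro real_sqrt_ge_zero sum_nonneg mult_nonneg_nonneg) auto
        then have "sqrt (?A\<^sup>2) = ?A" by (rule real_sqrt_unique[OF refl])
        moreover have "(4 * C * ?L * ?A\<^sup>2) powr (1 / 2) = sqrt (4 * C) * sqrt ?L * sqrt (?A\<^sup>2)"
          using C L by (simp only: powr_half_sqrt mult_nonneg_nonneg zero_le_power2 less_imp_le real_sqrt_mult zero_le_numeral)
        ultimately show ?thesis using L by (simp only: powr_half_sqrt less_imp_le)
      qed
      also have "\<dots> \<le> sqrt (4 * C) * ?L powr (1 / 2) * ?F"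
        using C by (intro mult_left_mono scaled_sobolev_sum_le) auto
      finally show "(\<tau> * (\<Sum>n\<in>?I. (norm (?u n (X n)))\<^sup>2)) powr (1 / 2) \<le> sqrt (4 * C) * ?L powr (1 / 2) * ?F" .
      show "ennreal ?F \<le> Hnorm 1 h" by (rule sobolev_sum_le_Hnorm[OF S])
    qed (use C in \<open>auto intro!: sum_nonneg\<close>)
  qed
  moreover have "sqrt (4 * C) \<ge> 0" using C by simp
  ultimately show ?thesis by blast
qed

theorem theorem2p6:
  fixes T :: real
  assumes "T \<ge> 0"
  shows
    "(\<forall>(p::ennreal) (q::real) (\<gamma>::real). admissible p q \<gamma> \<longrightarrow>
        (\<exists>C::real. \<forall>f \<in> Hspace \<gamma>. \<forall>\<tau>::real. \<forall>K::real. 0 < \<tau> \<and> \<tau> \<le> 1 \<and> 1 \<le> K \<longrightarrow>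
          discrete_norm p \<tau> {0..T} (Lnorm (ennreal q))
              (\<lambda>n. half_wave (of_int n * \<tau>) (freq_proj K f))
            \<le> ennreal (C * (1 + K * \<tau>) powr enn2real (inverse p)) * Hnorm \<gamma> f))
     \<and> (\<exists>C::real. \<forall>h \<in> Hspace 1. \<forall>\<tau>::real. \<forall>K::real. 0 < \<tau> \<and> \<tau> \<le> 1 \<and> 1 \<le> K \<longrightarrow>
          discrete_norm 2 \<tau> {0..T} (Lnorm \<infinity>)
              (\<lambda>n. half_wave (of_int n * \<tau>) (freq_proj K h))
            \<le> ennreal (C * (1 + K * \<tau> + ln K) powr (1 / 2)) * Hnorm 1 h)"
proof (intro conjI allI impI)
  fix p :: ennreal and q \<gamma> :: real
  assume adm: "admissible p q \<gamma>"
  then have q: "q \<ge> 2" and p2: "2 < p" by (auto simp: admissible_def)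
  show "\<exists>C::real. \<forall>f \<in> Hspace \<gamma>. \<forall>\<tau>::real. \<forall>K::real. 0 < \<tau> \<and> \<tau> \<le> 1 \<and> 1 \<le> K \<longrightarrow>
          discrete_norm p \<tau> {0..T} (Lnorm (ennreal q))
              (\<lambda>n. half_wave (of_int n * \<tau>) (freq_proj K f))
            \<le> ennreal (C * (1 + K * \<tau>) powr enn2real (inverse p)) * Hnorm \<gamma> f"
  proof (cases "p = \<infinity>")
    case True
    have "\<gamma> = 3 / 2 - 3 / q" using adm True by (simp add: admissible_def)
    from strichartz_infinite[OF q this, of T] obtain C where
      C: "\<And>f \<tau> K. discrete_norm \<infinity> \<tau> {0..T} (Lnorm (ennreal q)) (\<lambda>n. half_wave (of_int n * \<tau>) (freq_proj K f))
        \<le> ennreal C * Hnorm \<gamma> f" by blast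
    show ?thesis
    proof (intro exI[of _ C] ballI allI impI)
      fix f and \<tau> K :: real assume "0 < \<tau> \<and> \<tau> \<le> 1 \<and> (1::real) \<le> K"
      \<comment> \<open>The exponent is 0 here, and the zeroth power of a nonzero base is 1, so the
        factor disappears.\<close>
      then have "1 + K * \<tau> \<noteq> 0" using mult_nonneg_nonneg[of K \<tau>] by linarith
      then show "discrete_norm p \<tau> {0..T} (Lnorm (ennreal q)) (\<lambda>n. half_wave (of_int n * \<tau>) (freq_proj K f))
          \<le> ennreal (C * (1 + K * \<tau>) powr enn2real (inverse p)) * Hnorm \<gamma> f"
        using C[of \<tau> K f] True by simp
    qed
  next
    case False
    define r where "r = enn2real p"
    have p: "p = ennreal r" using False by (simp add: r_def less_top[symmetric])
    have "ennreal 2 < ennreal r" using p2 p by simp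
    then have r: "r > 2" by (simp add: ennreal_less_iff)
    have inv: "enn2real (inverse p) = 1 / r" using r by (simp add: p inverse_ennreal inverse_eq_divide)
    have "1 / r + 1 / q \<le> 1 / 2" "\<gamma> = 3 / 2 - 3 / q - 1 / r"
      using adm unfolding admissible_def inv by auto
    from strichartz_finite[OF assms r this(1) q this(2)] show ?thesis
      unfolding inv unfolding p by blast
  qed
next
  show "\<exists>C::real. \<forall>h \<in> Hspace 1. \<forall>\<tau>::real. \<forall>K::real. 0 < \<tau> \<and> \<tau> \<le> 1 \<and> 1 \<le> K \<longrightarrow>
          discrete_norm 2 \<tau> {0..T} (Lnorm \<infinity>)
              (\<lambda>n. half_wave (of_int n * \<tau>) (freq_proj K h))
            \<le> ennreal (C * (1 + K * \<tau> + ln K) powr (1 / 2)) * Hnorm 1 h"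
    using strichartz_endpoint[OF assms] by blast
qed

end
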